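(* Let $W$ be an irreducible complex reflection group with reflection representation $V$, let $c$ be a conjugation-invariant complex function on the set $S$ of complex reflections of $W$, and let $\mathbf{H}=\mathbf{H}_{0,c}$ be the associated rational Cherednik algebra (at $t=0$). Then $\mathbf{H}$ is a symmetric (free) Frobenius extension of its central subalgebra $\mathcal{Z}=S(V)^W\otimes_{\mathbb{C}} S(V^* )^W$.
   Context: All algebras are over $\mathbb{C}$. Rational Cherednik algebra: $W$ is an irreducible complex reflection group, $S\subset W$ its set of complex reflections, $V$ the (finite-dimensional complex) reflection representation. $c:S\to\mathbb{C}$ satisfies $c(wsw^{-1})=c(s)$. For $s\in S$, $\alpha_s\in V^*$ is a linear functional on $V$ vanishing on the reflection hyperplane of $s$ in $V$, and $\check\alpha_s\in V$ is a linear functional on $V^*$ vanishing on the reflection hyperplane of $s$ in $V^*$, normalised by $\langle\alpha_s,\check\alpha_s\rangle=2$. The algebra $\mathbf{H}=\mathbf{H}_{0,c}$ is generated by $W$, $V$, $V^*$ (i.e. it is a quotient of $T(V\oplus V^* )\rtimes W$) with relations $wxw^{-1}={}^wx$, $wyw^{-1}={}^wy$, $[x,x']=0$, $[y,y']=0$, and $[x,y]=\sum_{s\in S}c(s)\langle y,\check\alpha_s\rangle\langle\alpha_s,x\rangle s$, for $x,x'\in V$, $y,y'\in V^*$, $w\in W$. It is known that multiplication gives a vector space isomorphism $S(V)\otimes\mathbb{C}W\otimes S(V^* )\to\mathbf{H}$ (PBW property) and that the centre of $\mathbf{H}$ contains $\mathcal{Z}=S(V)^W\otimes S(V^* )^W$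 (identified with its image under multiplication). Frobenius extensions: let $\mathcal{Z}$ be a subring of the centre of a ring $R$. $R$ is a free Frobenius extension of $\mathcal{Z}$ if $R$ is a free $\mathcal{Z}$-module of finite rank and there is an isomorphism $F:R\to\mathrm{Hom}_{\mathcal{Z}}(R,\mathcal{Z})$ of $R$-$\mathcal{Z}$-bimodules, where $(r\cdot f\cdot s)(x)=f(xr)s$. Then $\mathbb{B}(r,t)=F(t)(r)$ is a non-degenerate associative $\mathcal{Z}$-bilinear form, and there is a $\mathcal{Z}$-algebra automorphism $\nu$ of $R$ (the Nakayama automorphism), with $\mathbb{B}(x,y)=\mathbb{B}(\nu(y),x)$ for all $x,y\in R$; it is unique up to inner automorphisms. The extension is called symmetric if $\nu$ is inner (the Nakayama automorphism is then said to be trivial). *)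

theory Defs
  imports
    "HOL-Analysis.Analysis"
    "HOL-Algebra.Generated_Groups"
    "HOL-Algebra.Subrings"
    "HOL-Library.Poly_Mapping"
begin

section \<open>Free Frobenius extensions\<close>

definition ring_center :: "('a, 'm) ring_scheme \<Rightarrow> 'a set" where
  "ring_center R = {z \<in> carrier R. \<forall>r \<in> carrier R. z \<otimes>\<^bsub>R\<^esub> r = r \<otimes>\<^bsub>R\<^esub> z}"

definition free_of_finite_rank :: "('a, 'm) ring_scheme \<Rightarrow> 'a set \<Rightarrow> bool" where
  "free_of_finite_rank R Z \<longleftrightarrow>
    (\<exists>B. finite B \<and> B \<subseteq> carrier R \<and>
      (\<forall>r \<in> carrier R. \<exists>!a. a \<in> B \<rightarrow>\<^sub>E Z \<and> r = (\<Oplus>\<^bsub>R\<^esub>b\<in>B. a b \<otimes>\<^bsub>R\<^esub> b)))"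

text \<open>Homomorphisms of \<open>Z\<close>-modules from \<open>R\<close> to \<open>Z\<close>; they are extensional functions,
  so that equality of homomorphisms is equality in HOL.\<close>

definition hom_to_base :: "('a, 'm) ring_scheme \<Rightarrow> 'a set \<Rightarrow> ('a \<Rightarrow> 'a) set" where
  "hom_to_base R Z = {f \<in> carrier R \<rightarrow>\<^sub>E Z.
     (\<forall>x \<in> carrier R. \<forall>y \<in> carrier R. f (x \<oplus>\<^bsub>R\<^esub> y) = f x \<oplus>\<^bsub>R\<^esub> f y) \<and>
     (\<forall>z \<in> Z. \<forall>x \<in> carrier R. f (z \<otimes>\<^bsub>R\<^esub> x) = z \<otimes>\<^bsub>R\<^esub> f x)}"

text \<open>The bimodule structure on the homomorphisms is \<open>(r \<cdot> f \<cdot> s) x = f (x r) s\<close>.\<close>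

definition frobenius_iso ::
  "('a, 'm) ring_scheme \<Rightarrow> 'a set \<Rightarrow> ('a \<Rightarrow> 'a \<Rightarrow> 'a) \<Rightarrow> bool" where
  "frobenius_iso R Z F \<longleftrightarrow>
     bij_betw F (carrier R) (hom_to_base R Z) \<and>
     (\<forall>a \<in> carrier R. \<forall>b \<in> carrier R. \<forall>x \<in> carrier R.
        F (a \<oplus>\<^bsub>R\<^esub> b) x = F a x \<oplus>\<^bsub>R\<^esub> F b x) \<and>
     (\<forall>r \<in> carrier R. \<forall>a \<in> carrier R. \<forall>x \<in> carrier R.
        F (r \<otimes>\<^bsub>R\<^esub> a) x = F a (x \<otimes>\<^bsub>R\<^esub> r)) \<and>
     (\<forall>a \<in> carrier R. \<forall>s \<in> Z. \<forall>x \<in> carrier R.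
        F (a \<otimes>\<^bsub>R\<^esub> s) x = F a x \<otimes>\<^bsub>R\<^esub> s)"

definition frobenius_form :: "('a \<Rightarrow> 'a \<Rightarrow> 'a) \<Rightarrow> 'a \<Rightarrow> 'a \<Rightarrow> 'a" where
  "frobenius_form F r t = F t r"

definition nakayama_automorphism ::
  "('a, 'm) ring_scheme \<Rightarrow> 'a set \<Rightarrow> ('a \<Rightarrow> 'a \<Rightarrow> 'a) \<Rightarrow> ('a \<Rightarrow> 'a) \<Rightarrow> bool" where
  "nakayama_automorphism R Z F \<nu> \<longleftrightarrow>
     \<nu> \<in> ring_iso R R \<and> (\<forall>z \<in> Z. \<nu> z = z) \<and>
     (\<forall>x \<in> carrier R. \<forall>y \<in> carrier R. frobenius_form F x y = frobenius_form F (\<nu> y) x)"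

definition inner_automorphism :: "('a, 'm) ring_scheme \<Rightarrow> ('a \<Rightarrow> 'a) \<Rightarrow> bool" where
  "inner_automorphism R \<nu> \<longleftrightarrow>
     (\<exists>u \<in> Units R. \<forall>x \<in> carrier R. \<nu> x = u \<otimes>\<^bsub>R\<^esub> x \<otimes>\<^bsub>R\<^esub> inv\<^bsub>R\<^esub> u)"

definition free_frobenius_extension :: "('a, 'm) ring_scheme \<Rightarrow> 'a set \<Rightarrow> bool" where
  "free_frobenius_extension R Z \<longleftrightarrow>
     ring R \<and> subring Z R \<and> Z \<subseteq> ring_center R \<and> free_of_finite_rank R Z \<and>
     (\<exists>F. frobenius_iso R Z F)"

text \<open>\<open>F\<close> determines the Nakayama automorphism, and another choice of \<open>F\<close> changes it by an
  inner automorphism; so it does not matter for which \<open>F\<close> one asks it to be inner.\<close>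

definition symmetric_frobenius_extension :: "('a, 'm) ring_scheme \<Rightarrow> 'a set \<Rightarrow> bool" where
  "symmetric_frobenius_extension R Z \<longleftrightarrow>
     free_frobenius_extension R Z \<and>
     (\<exists>F \<nu>. frobenius_iso R Z F \<and> nakayama_automorphism R Z F \<nu> \<and> inner_automorphism R \<nu>)"


section \<open>Complex reflection groups\<close>

text \<open>\<open>V\<close> is the space of column vectors \<open>complex ^ 'n\<close>, and its dual is the space of row vectors,
  which has the same type; an element \<open>w\<close> of the general linear group acts on it by \<open>y \<mapsto> y w\<^sup>-\<^sup>1\<close>.\<close>

definition pairing :: "complex ^ 'n \<Rightarrow> complex ^ 'n \<Rightarrow> complex" where
  "pairing y x = (\<Sum>i\<in>UNIV. y $ i * x $ i)"

definition dual_act :: "complex ^ 'n ^ 'n \<Rightarrow> complex ^ 'n \<Rightarrow> complex ^ 'n" where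
  "dual_act w y = y v* matrix_inv w"

definition GL :: "(complex ^ 'n ^ 'n) monoid" where
  "GL = \<lparr>carrier = {A. invertible A}, mult = (**), one = mat 1\<rparr>"

definition reflections :: "(complex ^ 'n ^ 'n) set \<Rightarrow> (complex ^ 'n ^ 'n) set" where
  "reflections W = {s \<in> W. vec.dim {v. s *v v = v} + 1 = CARD('n)}"

definition irreducible_complex_reflection_group :: "(complex ^ 'n ^ 'n) set \<Rightarrow> bool" where
  "irreducible_complex_reflection_group W \<longleftrightarrow>
     finite W \<and> subgroup W GL \<and> generate GL (reflections W) = W \<and>
     (\<forall>U. vec.subspace U \<and> (\<forall>w \<in> W. (*v) w ` U \<subseteq> U) \<longrightarrow> U = {0} \<or> U = UNIV)"

text \<open>\<open>\<alpha> s\<close> is a row vector and \<open>\<alpha>' s\<close> is a column vector.\<close>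

definition roots_and_coroots ::
  "(complex ^ 'n ^ 'n) set \<Rightarrow> (complex ^ 'n ^ 'n \<Rightarrow> complex ^ 'n) \<Rightarrow>
   (complex ^ 'n ^ 'n \<Rightarrow> complex ^ 'n) \<Rightarrow> bool" where
  "roots_and_coroots W \<alpha> \<alpha>' \<longleftrightarrow>
     (\<forall>s \<in> reflections W.
        (\<forall>x. s *v x = x \<longrightarrow> pairing (\<alpha> s) x = 0) \<and>
        (\<forall>y. dual_act s y = y \<longrightarrow> pairing y (\<alpha>' s) = 0) \<and>
        pairing (\<alpha> s) (\<alpha>' s) = 2)"


section \<open>Free algebras\<close>

text \<open>Lists as the free monoid; finitely supported functions on it, with convolution,
  then form the free algebra.\<close>

instantiation list :: (type) monoid_add
begin
definition zero_list :: "'a list" where "zero_list = []"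
definition plus_list :: "'a list \<Rightarrow> 'a list \<Rightarrow> 'a list" where "plus_list xs ys = xs @ ys"
instance by standard (simp_all add: zero_list_def plus_list_def)
end

type_synonym 'g free = "'g list \<Rightarrow>\<^sub>0 complex"

definition gen :: "'g \<Rightarrow> 'g free" where
  "gen g = Poly_Mapping.single [g] 1"

definition scalar :: "complex \<Rightarrow> 'g free" where
  "scalar a = Poly_Mapping.single [] a"

definition free_algebra :: "'g set \<Rightarrow> 'g free ring" where
  "free_algebra G =
     \<lparr>carrier = {p. \<forall>w \<in> Poly_Mapping.keys p. set w \<subseteq> G},
      mult = (*), one = 1, zero = 0, add = (+)\<rparr>"

definition relabel :: "('g \<Rightarrow> 'h) \<Rightarrow> 'g free \<Rightarrow> 'h free" where
  "relabel f p =
     (\<Sum>w\<in>Poly_Mapping.keys p. Poly_Mapping.single (map f w) (Poly_Mapping.lookup p w))"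

lemma ring_free_algebra: "ring (free_algebra G)"
proof -
  have minus: "\<exists>q. (\<forall>w \<in> Poly_Mapping.keys q. set w \<subseteq> G) \<and> p + q = 0"
    if "\<forall>w \<in> Poly_Mapping.keys p. set w \<subseteq> G" for p :: "'a free"
    using that by (intro exI[of _ "- p"]) simp
  have add: "\<forall>w \<in> Poly_Mapping.keys (p + q). set w \<subseteq> G"
    if "\<forall>w \<in> Poly_Mapping.keys p. set w \<subseteq> G" "\<forall>w \<in> Poly_Mapping.keys q. set w \<subseteq> G"
    for p q :: "'a free"
    using that Poly_Mapping.keys_add[of p q] by blast
  have mult: "\<forall>w \<in> Poly_Mapping.keys (p * q). set w \<subseteq> G"
    if "\<forall>w \<in> Poly_Mapping.keys p. set w \<subseteq> G" "\<forall>w \<in> Poly_Mapping.keys q. set w \<subseteq> G"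
    for p q :: "'a free"
    using that keys_mult[of p q] by (fastforce simp: plus_list_def)
  have one: "\<forall>w \<in> Poly_Mapping.keys (1 :: 'a free). set w \<subseteq> G"
    by (simp add: zero_list_def flip: single_one)
  show ?thesis
    by (intro ringI abelian_groupI monoidI)
       (auto simp: free_algebra_def algebra_simps one intro: minus
             dest: add[THEN bspec, rotated -1] mult[THEN bspec, rotated -1])
qed


section \<open>The rational Cherednik algebra at \<open>t = 0\<close>\<close>

text \<open>Elements of \<open>W\<close>, of \<open>V\<close> and of the dual of \<open>V\<close>.\<close>

datatype ('w, 'x, 'y) cherednik_gen = Grp 'w | Vec 'x | Covec 'y

type_synonym 'n cgen = "(complex ^ 'n ^ 'n, complex ^ 'n, complex ^ 'n) cherednik_gen"

definition cherednik_gens :: "(complex ^ 'n ^ 'n) set \<Rightarrow> 'n cgen set" where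
  "cherednik_gens W = Grp ` W \<union> range Vec \<union> range Covec"

definition linear_relators :: "(complex ^ 'n \<Rightarrow> 'g) \<Rightarrow> 'g free set" where
  "linear_relators \<iota> =
     {gen (\<iota> (x + x')) - (gen (\<iota> x) + gen (\<iota> x')) | x x'. True} \<union>
     {gen (\<iota> (a *s x)) - scalar a * gen (\<iota> x) | a x. True}"

definition commutator_relators :: "(complex ^ 'n \<Rightarrow> 'g) \<Rightarrow> 'g free set" where
  "commutator_relators \<iota> =
     {gen (\<iota> x) * gen (\<iota> x') - gen (\<iota> x') * gen (\<iota> x) | x x'. True}"

text \<open>Modulo the linear relators and the group relators, the words in \<open>W\<close>, \<open>V\<close> and the dual of
  \<open>V\<close> give the free product of the group algebra of \<open>W\<close> with the tensor algebra of the sum of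
  \<open>V\<close> and its dual; the conjugation relators turn it into the smash product.\<close>

definition group_relators :: "(complex ^ 'n ^ 'n) set \<Rightarrow> 'n cgen free set" where
  "group_relators W =
     {gen (Grp (mat 1)) - 1} \<union>
     {gen (Grp w) * gen (Grp w') - gen (Grp (w ** w')) | w w'. w \<in> W \<and> w' \<in> W}"

definition conjugation_relators :: "(complex ^ 'n ^ 'n) set \<Rightarrow> 'n cgen free set" where
  "conjugation_relators W =
     {gen (Grp w) * gen (Vec x) * gen (Grp (matrix_inv w)) - gen (Vec (w *v x)) | w x. w \<in> W} \<union>
     {gen (Grp w) * gen (Covec y) * gen (Grp (matrix_inv w)) - gen (Covec (dual_act w y))
        | w y. w \<in> W}"

definition cherednik_relators ::
  "(complex ^ 'n ^ 'n) set \<Rightarrow> (complex ^ 'n ^ 'n \<Rightarrow> complex) \<Rightarrow>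
   (complex ^ 'n ^ 'n \<Rightarrow> complex ^ 'n) \<Rightarrow> (complex ^ 'n ^ 'n \<Rightarrow> complex ^ 'n) \<Rightarrow>
   'n cgen free set" where
  "cherednik_relators W c \<alpha> \<alpha>' =
     linear_relators Vec \<union> linear_relators Covec \<union>
     group_relators W \<union> conjugation_relators W \<union>
     commutator_relators Vec \<union> commutator_relators Covec \<union>
     {gen (Vec x) * gen (Covec y) - gen (Covec y) * gen (Vec x) -
        (\<Sum>s\<in>reflections W.
           scalar (c s * pairing y (\<alpha>' s) * pairing (\<alpha> s) x) * gen (Grp s)) | x y. True}"

definition cherednik_ideal where
  "cherednik_ideal W c \<alpha> \<alpha>' =
     genideal (free_algebra (cherednik_gens W)) (cherednik_relators W c \<alpha> \<alpha>')"

definition cherednik_algebra ::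
  "(complex ^ 'n ^ 'n) set \<Rightarrow> (complex ^ 'n ^ 'n \<Rightarrow> complex) \<Rightarrow>
   (complex ^ 'n ^ 'n \<Rightarrow> complex ^ 'n) \<Rightarrow> (complex ^ 'n ^ 'n \<Rightarrow> complex ^ 'n) \<Rightarrow>
   'n cgen free set ring" where
  "cherednik_algebra W c \<alpha> \<alpha>' =
     free_algebra (cherednik_gens W) Quot cherednik_ideal W c \<alpha> \<alpha>'"

lemma cherednik_relators_closed:
  assumes "subgroup W GL"
  shows "cherednik_relators W c \<alpha> \<alpha>' \<subseteq> carrier (free_algebra (cherednik_gens W))"
proof -
  let ?G = "cherednik_gens W"
  define C where "C = carrier (free_algebra ?G)"
  have C: "p \<in> C \<longleftrightarrow> (\<forall>w \<in> Poly_Mapping.keys p. set w \<subseteq> ?G)" for p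
    by (simp add: C_def free_algebra_def)
  have one: "mat 1 \<in> W" and mult: "\<And>w w'. w \<in> W \<Longrightarrow> w' \<in> W \<Longrightarrow> w ** w' \<in> W"
    using subgroup.one_closed[OF assms] subgroup.m_closed[OF assms] by (simp_all add: GL_def)
  have inv: "matrix_inv w \<in> W" if w: "w \<in> W" for w
  proof -
    have "w \<in> carrier GL" using subgroup.subset[OF assms] w by blast
    then have iw: "invertible w" by (simp add: GL_def)
    have i: "inv\<^bsub>GL\<^esub> w \<in> W" using subgroup.m_inv_closed[OF assms w] .
    have r: "w ** matrix_inv w = mat 1" and l: "matrix_inv w ** w = mat 1"
      using someI_ex[OF iw[unfolded invertible_def]] by (simp_all add: matrix_inv_def)
    have "monoid (GL :: (complex ^ 'a ^ 'a) monoid)"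
      by standard (auto simp: GL_def matrix_mul_assoc invertible_mult invertible_def[of "mat 1"])
    then have "inv\<^bsub>GL\<^esub> w = matrix_inv w"
    proof (rule monoid.inv_unique'[symmetric])
      have "invertible (matrix_inv w)" using l r invertible_def by blast
      then show "matrix_inv w \<in> carrier GL" by (simp add: GL_def)
    qed (use iw l r in \<open>simp_all add: GL_def\<close>)
    then show ?thesis using i by simp
  qed
  have g: "gen g \<in> C" if "g \<in> ?G" for g using that by (simp add: C gen_def)
  have sc: "scalar a \<in> C" for a by (simp add: C scalar_def)
  have on: "1 \<in> C" by (simp add: C zero_list_def flip: single_one)
  have zero: "0 \<in> C" by (simp add: C)
  have ad: "p + q \<in> C" if "p \<in> C" "q \<in> C" for p q
    using that Poly_Mapping.keys_add[of p q] unfolding C by blast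
  have mi: "p - q \<in> C" if "p \<in> C" "q \<in> C" for p q
    using that keys_diff[of p q] unfolding C by blast
  have mu: "p * q \<in> C" if "p \<in> C" "q \<in> C" for p q
    using that keys_mult[of p q] unfolding C by (fastforce simp: plus_list_def)
  have su: "(\<Sum>i\<in>I. f i) \<in> C" if "\<And>i. i \<in> I \<Longrightarrow> f i \<in> C"
    for I :: "(complex ^ 'a ^ 'a) set" and f
    using that by (induction I rule: infinite_finite_induct) (simp_all add: ad zero)
  have gens: "Vec x \<in> ?G" "Covec y \<in> ?G" "Grp w \<in> ?G \<longleftrightarrow> w \<in> W" for x y w
    by (auto simp: cherednik_gens_def)
  have R: "s \<in> W" if "s \<in> reflections W" for s using that by (simp add: reflections_def)
  show ?thesis
    unfolding C_def[symmetric] cherednik_relators_def linear_relators_def group_relators_def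
      conjugation_relators_def commutator_relators_def
    by (intro Un_least subsetI; (elim CollectE exE conjE singletonE)?; hypsubst)
       (intro mi mu ad su sc on g; simp add: gens one mult inv R)+
qed

lemma ring_cherednik_algebra:
  assumes "subgroup W GL"
  shows "ring (cherednik_algebra W c \<alpha> \<alpha>')"
  unfolding cherednik_algebra_def cherednik_ideal_def
  by (intro ideal.quotient_is_ring ring.genideal_ideal ring_free_algebra
      cherednik_relators_closed assms)


section \<open>The central subalgebra\<close>

definition symmetric_ideal :: "(complex ^ 'n) free set" where
  "symmetric_ideal = genideal (free_algebra UNIV) (linear_relators id \<union> commutator_relators id)"

definition symmetric_algebra :: "(complex ^ 'n) free set ring" where
  "symmetric_algebra = free_algebra UNIV Quot symmetric_ideal"

text \<open>For a linear action \<open>\<phi>\<close> of \<open>W\<close> on the generating vector space, \<open>w\<close> sends the class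
  (coset) \<open>A\<close> of a tensor to the elementwise image of \<open>A\<close> under the substitution \<open>\<phi> w\<close>.\<close>

definition symmetric_invariants ::
  "'w set \<Rightarrow> ('w \<Rightarrow> complex ^ 'n \<Rightarrow> complex ^ 'n) \<Rightarrow> (complex ^ 'n) free set set" where
  "symmetric_invariants W \<phi> =
     {A \<in> carrier symmetric_algebra. \<forall>w \<in> W. relabel (\<phi> w) ` A = A}"

text \<open>Image of a set of elements of the symmetric algebra under the algebra homomorphism to the
  Cherednik algebra that extends \<open>\<iota>\<close>, which is \<open>Vec\<close> or \<open>Covec\<close>.\<close>

definition symmetric_image where
  "symmetric_image W c \<alpha> \<alpha>' \<iota> P =
     {cherednik_ideal W c \<alpha> \<alpha>' +>\<^bsub>free_algebra (cherednik_gens W)\<^esub> relabel \<iota> p | p A. A \<in> P \<and> p \<in> A}"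

text \<open>The image of the tensor product of the two invariant algebras under multiplication
  consists of the finite sums of products.\<close>

definition cherednik_base ::
  "(complex ^ 'n ^ 'n) set \<Rightarrow> (complex ^ 'n ^ 'n \<Rightarrow> complex) \<Rightarrow>
   (complex ^ 'n ^ 'n \<Rightarrow> complex ^ 'n) \<Rightarrow> (complex ^ 'n ^ 'n \<Rightarrow> complex ^ 'n) \<Rightarrow>
   'n cgen free set set" where
  "cherednik_base W c \<alpha> \<alpha>' =
     generate (add_monoid (cherednik_algebra W c \<alpha> \<alpha>'))
       {p \<otimes>\<^bsub>cherednik_algebra W c \<alpha> \<alpha>'\<^esub> q | p q.
          p \<in> symmetric_image W c \<alpha> \<alpha>' Vec (symmetric_invariants W (*v)) \<and>
          q \<in> symmetric_image W c \<alpha> \<alpha>' Covec (symmetric_invariants W dual_act)}"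

end

theory Submission
  imports Defs "HOL-Library.Function_Algebras" "HOL-Computational_Algebra.Polynomial" "HOL-Library.Multiset"
begin

text \<open>An element of \<open>H\<close> is a sum of normal forms \<open>f g w\<close> with \<open>f\<close> in \<open>S(V)\<close>, \<open>g\<close> in \<open>S(V*)\<close> and \<open>w\<close> in
  \<open>W\<close>. Normal forms exist because they span a left ideal, and the coefficient of the identity is
  read off from the action of \<open>H\<close> on the module induced from the subalgebra of \<open>V*\<close> and \<open>W\<close>.

  By Chevalley's argument with divided differences, the semi-invariants of the character by which
  \<open>W\<close> acts on the socle of the coinvariant algebra are the multiples \<open>h Delta\<close> of one of them by
  invariants \<open>h\<close>. Projecting \<open>f\<close> to the semi-invariants and dividing by \<open>Delta\<close> gives a form
  \<open>Phi\<close> on \<open>S(V)\<close> over the invariants, which kills divided differences and has dual bases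
  \<open>b\<close>, \<open>b'\<close>; likewise \<open>d\<close>, \<open>d'\<close> for \<open>S(V*)\<close>. Let \<open>T (f g w)\<close> be \<open>Phi f Phi g\<close> if \<open>w = 1\<close>, and
  zero otherwise. As commutators of vectors and covectors only produce divided differences, and the
  characters on \<open>V\<close> and \<open>V*\<close> are inverse to each other, \<open>T\<close> is a trace, so that the Nakayama
  automorphism is the identity. The dual bases of \<open>H\<close> are the products \<open>b d w\<close> and \<open>w^-1 d' b'\<close>.\<close>

section \<open>Polynomial functions\<close>

text \<open>The relations alone do not exclude that the algebra collapses. The induced module enters
  only through \<open>nf_zero_coeff\<close>, which makes \<open>T\<close> well defined and separates
  1 from 0; all later identities are computed from the relations. Every division takes place among
  polynomial functions, which represent the symmetric algebras faithfully and have no zero divisors,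
  whereas elements of the algebra are compared modulo the ideal, as their representatives involve
  choices.

  That \<open>Phi\<close> kills divided differences is a matter of degree: it lowers degrees by that
  of \<open>Delta\<close>, the basis \<open>b\<close> can be taken in degrees up to that of
  \<open>Delta\<close>, and a divided difference lowers the degree by one. The basis itself is a
  maximal family with dual partners; it is finite because its members are independent in bounded
  degree. The obstacle to symmetry lies in the group: reflections of higher order act on the socle
  by scalars other than signs, so in general neither \<open>Phi\<close> is invariant by itself, and
  only the product of the two forms is.\<close>

definition cst :: "complex \<Rightarrow> 'a \<Rightarrow> complex" where
  "cst a = (\<lambda>_. a)"

definition lf :: "complex ^ 'n \<Rightarrow> complex ^ 'n \<Rightarrow> complex" where
  "lf x = (\<lambda>v. pairing v x)"

text \<open>Over an infinite field a polynomial is determined by its values, so functions stand for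
  elements of a symmetric algebra: equality is equality in HOL, and a group acts by substitution.
  The generators \<open>cst\<close> and \<open>lf\<close> give an induction principle in which an
  operator only has to be checked on scalars, linear forms, sums and products.\<close>

inductive polyfun :: "(complex ^ 'n \<Rightarrow> complex) \<Rightarrow> bool" where
  polyfun_cst: "polyfun (cst a)"
| polyfun_lf: "polyfun (lf x)"
| polyfun_add: "polyfun f \<Longrightarrow> polyfun g \<Longrightarrow> polyfun (f + g)"
| polyfun_mult: "polyfun f \<Longrightarrow> polyfun g \<Longrightarrow> polyfun (f * g)"

text \<open>The induction methods leave eta-expanded functions behind, on which the evaluation rules
  would fire; so they are no simplification rules.\<close>

declare plus_fun_apply [simp del] times_fun_apply [simp del] zero_fun_apply [simp del]
  one_fun_apply [simp del] minus_apply [simp del] uminus_apply [simp del]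

lemma cst_apply: "cst a v = a"
  by (simp add: cst_def)

lemma sum_fun_apply: "(\<Sum>i\<in>I. f i) x = (\<Sum>i\<in>I. f i x)"
  for f :: "'i \<Rightarrow> 'a \<Rightarrow> 'b :: comm_monoid_add"
  by (induction I rule: infinite_finite_induct) (auto simp: plus_fun_apply zero_fun_apply)

lemma prod_fun_apply: "(\<Prod>i\<in>I. f i) x = (\<Prod>i\<in>I. f i x)"
  for f :: "'i \<Rightarrow> 'a \<Rightarrow> complex"
  by (induction I rule: infinite_finite_induct) (auto simp: times_fun_apply one_fun_apply)

lemma power_fun_apply: "(f ^ n) x = f x ^ n" for f :: "'a \<Rightarrow> complex"
  by (induction n) (auto simp: times_fun_apply one_fun_apply)

lemmas fun_apply = plus_fun_apply times_fun_apply zero_fun_apply one_fun_apply minus_apply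
  uminus_apply cst_apply sum_fun_apply prod_fun_apply power_fun_apply

lemma cst_0: "cst 0 = 0" and cst_1: "cst 1 = 1" and cst_add: "cst (a + b) = cst a + cst b"
  and cst_mult: "cst (a * b) = cst a * cst b" and cst_minus: "cst (- a) = - cst a"
  by (simp_all add: fun_eq_iff fun_apply)

lemma pairing_commute: "pairing x y = pairing y x"
  by (simp add: pairing_def mult.commute)

lemma pairing_add_left: "pairing (x + y) z = pairing x z + pairing y z"
  and pairing_add_right: "pairing z (x + y) = pairing z x + pairing z y"
  and pairing_diff_left: "pairing (x - y) z = pairing x z - pairing y z"
  and pairing_diff_right: "pairing z (x - y) = pairing z x - pairing z y"
  and pairing_scale_left: "pairing (a *s x) z = a * pairing x z"
  and pairing_scale_right: "pairing z (a *s x) = a * pairing z x"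
  and pairing_0_left: "pairing 0 z = 0"
  and pairing_0_right: "pairing z 0 = 0"
  by (simp_all add: pairing_def algebra_simps sum.distrib sum_subtractf sum_distrib_left)

lemma pairing_axis: "pairing v (axis i 1) = v $ i"
  by (simp add: pairing_def axis_def if_distrib sum.delta cong: if_cong)

lemma pairing_matrix: "pairing y (A *v x) = pairing (y v* A) x"
  unfolding pairing_def matrix_vector_mult_def vector_matrix_mult_def
  by (simp add: sum_distrib_left sum_distrib_right, subst sum.swap)
     (simp add: algebra_simps)

lemma pairing_eq_0_imp: "(\<And>v. pairing v x = 0) \<Longrightarrow> x = 0"
  by (metis pairing_axis pairing_commute vec_eq_iff zero_index)

lemma lf_apply: "lf x v = pairing v x" by (simp add: lf_def)

lemma lf_add: "lf (x + y) = lf x + lf y" and lf_scale: "lf (a *s x) = cst a * lf x"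
  by (auto simp: lf_def fun_eq_iff fun_apply pairing_add_right pairing_scale_right)

lemma lf_eq_0_iff: "lf x = 0 \<longleftrightarrow> x = 0"
  using pairing_eq_0_imp[of x] by (auto simp: lf_def fun_eq_iff fun_apply pairing_0_right)

lemma polyfun_0: "polyfun 0" and polyfun_1: "polyfun 1"
  using polyfun_cst[of 0] polyfun_cst[of 1] by (simp_all add: cst_0 cst_1)

lemma polyfun_uminus: "polyfun f \<Longrightarrow> polyfun (- f)"
  using polyfun_mult[OF polyfun_cst[of "-1"], of f] by (simp add: cst_minus cst_1)

lemma polyfun_diff: "polyfun f \<Longrightarrow> polyfun g \<Longrightarrow> polyfun (f - g)"
  using polyfun_add[OF _ polyfun_uminus, of f g] by simp

lemma polyfun_sum: "(\<And>i. i \<in> I \<Longrightarrow> polyfun (f i)) \<Longrightarrow> polyfun (\<Sum>i\<in>I. f i)"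
  by (induction I rule: infinite_finite_induct) (auto simp: polyfun_0 polyfun_add)

lemma polyfun_prod: "(\<And>i. i \<in> I \<Longrightarrow> polyfun (f i)) \<Longrightarrow> polyfun (\<Prod>i\<in>I. f i)"
  by (induction I rule: infinite_finite_induct) (auto simp: polyfun_1 polyfun_mult)

lemma polyfun_power: "polyfun f \<Longrightarrow> polyfun (f ^ n)"
  by (induction n) (auto simp: polyfun_1 polyfun_mult)

lemmas polyfun_intros = polyfun_cst polyfun_lf polyfun_add polyfun_mult polyfun_0 polyfun_1
  polyfun_uminus polyfun_diff polyfun_sum polyfun_prod polyfun_power

lemma polyfun_compose:
  assumes "polyfun f" shows "polyfun (\<lambda>v. f (A *v v))"
  using assms
proof induction
  case (polyfun_lf x)
  have "(\<lambda>v. lf x (A *v v)) = lf (x v* A)"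
    by (simp add: lf_def fun_eq_iff fun_apply pairing_commute[of _ x] pairing_commute[of _ "x v* A"]
        pairing_matrix)
  then show ?case using polyfun.polyfun_lf by metis
qed (auto simp: plus_fun_def times_fun_def cst_def intro: polyfun_cst[unfolded cst_def]
      polyfun_add[unfolded plus_fun_def] polyfun_mult[unfolded times_fun_def])

lemma polyfun_line:
  assumes "polyfun f"
  shows "\<exists>P. \<forall>t. poly P t = f (a + t *s b)"
  using assms
proof induction
  case (polyfun_cst c) then show ?case by (intro exI[of _ "[:c:]"]) (simp add: fun_apply)
next
  case (polyfun_lf x)
  show ?case
    by (rule exI[of _ "[:pairing a x, pairing b x:]"])
       (simp add: lf_def pairing_add_left pairing_scale_left)
next
  case (polyfun_add f g)
  then obtain P Q where "\<forall>t. poly P t = f (a + t *s b)" "\<forall>t. poly Q t = g (a + t *s b)" by blast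
  then show ?case by (intro exI[of _ "P + Q"]) (simp add: fun_apply)
next
  case (polyfun_mult f g)
  then obtain P Q where "\<forall>t. poly P t = f (a + t *s b)" "\<forall>t. poly Q t = g (a + t *s b)" by blast
  then show ?case by (intro exI[of _ "P * Q"]) (simp add: fun_apply)
qed

text \<open>Restriction to the line through a point where \<open>f\<close> does not vanish and one
  where \<open>g\<close> does not reduces this to polynomials in one variable: both restrictions are
  nonzero, hence so is their product.\<close>

lemma polyfun_mult_eq_0:
  assumes f: "polyfun f" and g: "polyfun g" and fg: "f * g = 0"
  shows "f = 0 \<or> g = 0"
proof (rule ccontr)
  assume "\<not> ?thesis"
  then obtain a b where a: "f a \<noteq> 0" and b: "g b \<noteq> 0" by (auto simp: fun_eq_iff fun_apply)
  obtain P where P: "\<forall>t. poly P t = f (a + t *s (b - a))" using polyfun_line[OF f] by blast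
  obtain Q where Q: "\<forall>t. poly Q t = g (a + t *s (b - a))" using polyfun_line[OF g] by blast
  have "poly (P * Q) t = 0" for t using fg P Q by (auto simp: fun_eq_iff fun_apply)
  then have "P * Q = 0" using poly_all_0_iff_0 by blast
  then have "P = 0 \<or> Q = 0" by simp
  then show False using P[rule_format, of 0] Q[rule_format, of 1] a b by auto
qed

lemma polyfun_mult_cancel:
  assumes "polyfun f" "polyfun g" "polyfun h" "h \<noteq> 0" "f * h = g * h"
  shows "f = g"
proof -
  have "(f - g) * h = 0" using assms(5) by (simp add: algebra_simps)
  then show ?thesis using polyfun_mult_eq_0[OF polyfun_diff] assms by (metis eq_iff_diff_eq_0)
qed

lemma polyfun_prod_eq_0:
  assumes "finite I" "\<And>i. i \<in> I \<Longrightarrow> polyfun (f i)" "(\<Prod>i\<in>I. f i) = 0"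
  shows "\<exists>i\<in>I. f i = 0"
  using assms
proof (induction I)
  case (insert i I)
  then have "f i = 0 \<or> (\<Prod>i\<in>I. f i) = 0" by (intro polyfun_mult_eq_0) (auto intro!: polyfun_intros)
  with insert show ?case by auto
qed (auto simp: fun_eq_iff fun_apply)

section \<open>Homogeneous functions and homogeneous components\<close>

definition homog :: "nat \<Rightarrow> (complex ^ 'n \<Rightarrow> complex) \<Rightarrow> bool" where
  "homog d f \<longleftrightarrow> (\<forall>t v. f (t *s v) = t ^ d * f v)"

definition ray :: "(complex ^ 'n \<Rightarrow> complex) \<Rightarrow> complex ^ 'n \<Rightarrow> complex poly" where
  "ray f v = (THE P. \<forall>t. poly P t = f (t *s v))"

text \<open>The coefficient of \<open>t ^ d\<close> in the restriction of \<open>f\<close> to the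
  ray through \<open>v\<close> is the value at \<open>v\<close> of the homogeneous part of degree
  \<open>d\<close>. That this is again a polynomial function of \<open>v\<close> is proved in
  \<open>polyfun_comp\<close>.\<close>

definition comp :: "nat \<Rightarrow> (complex ^ 'n \<Rightarrow> complex) \<Rightarrow> complex ^ 'n \<Rightarrow> complex" where
  "comp d f v = Polynomial.coeff (ray f v) d"

lemma ray_eqI:
  assumes "\<And>t. poly P t = f (t *s v)"
  shows "ray f v = P"
  unfolding ray_def
proof (rule the_equality)
  fix Q :: "complex poly" assume "\<forall>t. poly Q t = f (t *s v)"
  then show "Q = P" using assms by (metis poly_eq_poly_eq_iff ext)
qed (use assms in simp)

lemma poly_ray: "polyfun f \<Longrightarrow> poly (ray f v) t = f (t *s v)"
  using polyfun_line[of f 0 v] ray_eqI[of _ f v] by (metis add_0)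

lemma ray_cst: "ray (cst a) v = [:a:]"
  and ray_lf: "ray (lf x) v = [:0, pairing v x:]"
  by (auto intro!: ray_eqI simp: lf_apply cst_apply pairing_scale_left)

lemma ray_add: "polyfun f \<Longrightarrow> polyfun g \<Longrightarrow> ray (f + g) v = ray f v + ray g v"
  and ray_mult: "polyfun f \<Longrightarrow> polyfun g \<Longrightarrow> ray (f * g) v = ray f v * ray g v"
  by (auto intro!: ray_eqI simp: poly_ray fun_apply)

lemma comp_cst: "comp d (cst a) = (if d = 0 then cst a else 0)"
  and comp_lf: "comp d (lf x) = (if d = 1 then lf x else 0)"
  by (auto simp: fun_eq_iff fun_apply comp_def ray_cst ray_lf coeff_pCons lf_apply split: nat.splits)

lemma comp_add: "polyfun f \<Longrightarrow> polyfun g \<Longrightarrow> comp d (f + g) = comp d f + comp d g"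
  by (auto simp: fun_eq_iff fun_apply comp_def ray_add)

lemma comp_mult:
  "polyfun f \<Longrightarrow> polyfun g \<Longrightarrow> comp d (f * g) = (\<Sum>i\<le>d. comp i f * comp (d - i) g)"
  by (auto simp: fun_eq_iff fun_apply comp_def ray_mult coeff_mult)

lemma polyfun_comp: "polyfun f \<Longrightarrow> polyfun (comp d f)"
proof (induction arbitrary: d rule: polyfun.induct)
qed (auto simp: comp_cst comp_lf comp_add comp_mult intro!: polyfun_intros)

lemma ray_scale: "polyfun f \<Longrightarrow> ray f (s *s v) = pcompose (ray f v) [:0, s:]"
  by (rule ray_eqI) (simp add: poly_pcompose poly_ray mult.commute vector_smult_assoc)

lemma homog_comp: "polyfun f \<Longrightarrow> homog d (comp d f)"
  unfolding homog_def comp_def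
  by (auto simp: ray_scale coeff_pcompose_linear)

lemma comp_homog:
  assumes "homog d f" shows "comp k f = (if k = d then f else 0)"
proof -
  have "ray f v = Polynomial.monom (f v) d" for v
    using assms by (intro ray_eqI) (simp add: homog_def poly_monom mult.commute)
  then show ?thesis by (auto simp: comp_def fun_eq_iff fun_apply)
qed

lemma comp_eventually_0: "polyfun f \<Longrightarrow> \<exists>N. \<forall>k>N. comp k f = 0"
proof (induction rule: polyfun.induct)
  case (polyfun_cst a) show ?case by (rule exI[of _ 0]) (auto simp: comp_cst)
next
  case (polyfun_lf x) show ?case by (rule exI[of _ 1]) (auto simp: comp_lf)
next
  case (polyfun_add f g)
  then obtain M N where "\<forall>k>M. comp k f = 0" "\<forall>k>N. comp k g = 0" by blast
  then show ?case using polyfun_add.hyps by (intro exI[of _ "max M N"]) (auto simp: comp_add)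
next
  case (polyfun_mult f g)
  then obtain M N where MN: "\<forall>k>M. comp k f = 0" "\<forall>k>N. comp k g = 0" by blast
  have "comp i f * comp (k - i) g = 0" if "k > M + N" for k i
  proof (cases "i > M")
    case False then have "k - i > N" using that by auto
    then show ?thesis using MN by auto
  qed (use MN in auto)
  then show ?case using polyfun_mult.hyps by (intro exI[of _ "M + N"]) (auto simp: comp_mult)
qed

lemma sum_comp:
  assumes "polyfun f" "\<forall>k>N. comp k f = 0"
  shows "f = (\<Sum>k\<le>N. comp k f)"
proof
  fix v
  have "Polynomial.degree (ray f v) \<le> N"
    using assms(2) by (intro degree_le) (auto simp: comp_def fun_eq_iff fun_apply)
  then have "poly (ray f v) 1 = (\<Sum>k\<le>N. Polynomial.coeff (ray f v) k)"
    by (auto simp: poly_altdef le_degree intro!: sum.mono_neutral_left)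
  then show "f v = (\<Sum>k\<le>N. comp k f) v"
    by (simp add: poly_ray[OF assms(1)] comp_def fun_apply)
qed

lemma comp_0: "polyfun f \<Longrightarrow> comp 0 f = cst (f 0)"
proof -
  assume f: "polyfun f"
  have "comp 0 f v = f 0" for v
    using poly_ray[OF f, of v 0] by (simp add: comp_def poly_0_coeff_0)
  then show ?thesis by (auto simp: fun_eq_iff fun_apply)
qed

lemma polyfun_induct_homog [consumes 1, case_names homog add]:
  assumes "polyfun f"
    and "\<And>d g. polyfun g \<Longrightarrow> homog d g \<Longrightarrow> P g"
    and "\<And>g h. polyfun g \<Longrightarrow> polyfun h \<Longrightarrow> P g \<Longrightarrow> P h \<Longrightarrow> P (g + h)"
  shows "P f"
proof -
  obtain N where N: "\<forall>k>N. comp k f = 0" using comp_eventually_0[OF assms(1)] by blast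
  have "polyfun (\<Sum>k\<le>M. comp k f) \<and> P (\<Sum>k\<le>M. comp k f)" for M
  proof (induction M)
    case (Suc M)
    then show ?case
      using assms(2)[OF polyfun_comp[OF assms(1)] homog_comp[OF assms(1)]] assms(3)
      by (auto simp: polyfun_comp assms(1) intro: polyfun_add)
  qed (use assms(2)[OF polyfun_comp[OF assms(1)] homog_comp[OF assms(1)]] in
      \<open>simp add: assms polyfun_comp\<close>)
  then show ?thesis using sum_comp[OF assms(1) N] by metis
qed

lemma homog_mult: "homog d f \<Longrightarrow> homog e g \<Longrightarrow> homog (d + e) (f * g)"
  by (simp add: homog_def power_add fun_apply)

lemma homog_add: "homog d f \<Longrightarrow> homog d g \<Longrightarrow> homog d (f + g)"
  and homog_diff: "homog d f \<Longrightarrow> homog d g \<Longrightarrow> homog d (f - g)"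
  and homog_zero: "homog d 0"
  and homog_cst: "homog 0 (cst a)"
  and homog_lf: "homog 1 (lf x)"
  by (simp_all add: homog_def fun_apply lf_apply pairing_scale_left algebra_simps)

lemma homog_cst_mult: "homog d f \<Longrightarrow> homog d (cst a * f)"
  using homog_mult[OF homog_cst, of d f a] by simp

lemma homog_sum: "(\<And>i. i \<in> I \<Longrightarrow> homog d (f i)) \<Longrightarrow> homog d (\<Sum>i\<in>I. f i)"
  by (induction I rule: infinite_finite_induct) (auto simp: homog_zero homog_add)

lemma homog_0_const: "homog 0 f \<Longrightarrow> f = cst (f 0)"
proof
  fix v assume "homog 0 f"
  then have "f (0 *s v) = 0 ^ 0 * f v" unfolding homog_def by blast
  then show "f v = cst (f 0) v" by (simp add: cst_apply)
qed

lemma homog_Suc_at_0: "homog d f \<Longrightarrow> 0 < d \<Longrightarrow> f 0 = 0"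
  unfolding homog_def by (metis mult_zero_left vector_smult_lzero zero_power)

text \<open>As \<open>D\<close> lives in the single degree \<open>N\<close>, the component of
  \<open>h * D\<close> in degree \<open>j + N\<close> is \<open>comp j h * D\<close>, and
  \<open>D\<close> may be cancelled. The zero quotient is split off because it gives no bound on
  \<open>N\<close>.\<close>

lemma homog_quotient:
  assumes h: "polyfun h" and D: "polyfun D" "homog N D" "D \<noteq> 0" and hD: "homog d (h * D)"
  shows "h = 0 \<or> (N \<le> d \<and> homog (d - N) h)"
proof (cases "h = 0")
  case False
  have c: "comp j h = 0" if "j + N \<noteq> d" for j
  proof -
    have "comp (j + N) (h * D) = (\<Sum>i\<le>j + N. comp i h * comp (j + N - i) D)"
      using h D by (simp add: comp_mult)
    also have "\<dots> = (\<Sum>i\<in>{j}. comp i h * comp (j + N - i) D)"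
      by (intro sum.mono_neutral_right) (auto simp: comp_homog[OF D(2)])
    finally have "comp j h * D = 0" using that by (simp add: comp_homog[OF hD] comp_homog[OF D(2)])
    then show ?thesis using polyfun_mult_eq_0[OF polyfun_comp[OF h] D(1)] D(3) by auto
  qed
  obtain M where M: "\<forall>k>M. comp k h = 0" using comp_eventually_0[OF h] by blast
  have Nd: "N \<le> d"
  proof (rule ccontr)
    assume "\<not> N \<le> d" then have "\<And>j. comp j h = 0" using c by auto
    then show False using sum_comp[OF h M] False by simp
  qed
  have "homog (d - N) (\<Sum>k\<le>M. comp k h)"
  proof (rule homog_sum)
    fix k show "homog (d - N) (comp k h)"
      using c[of k] homog_comp[OF h, of k] Nd by (cases "k = d - N") (auto simp: homog_zero)
  qed
  then show ?thesis using Nd sum_comp[OF h M] by simp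
qed auto

section \<open>Monomials and the spaces of homogeneous functions\<close>

definition mon :: "'n list \<Rightarrow> complex ^ 'n \<Rightarrow> complex" where
  "mon ws = (\<lambda>v. \<Prod>i\<leftarrow>ws. v $ i)"

interpretation cfun: vector_space "\<lambda>a (f :: 'a \<Rightarrow> complex). cst a * f"
  by standard (auto simp: cst_def fun_eq_iff fun_apply algebra_simps)

lemma mon_append: "mon (xs @ ys) = mon xs * mon ys"
  by (simp add: mon_def fun_eq_iff fun_apply)

lemma mon_simps: "mon [] = 1" "mon (i # xs) = lf (axis i 1) * mon xs"
  by (auto simp: mon_def fun_eq_iff fun_apply lf_def pairing_axis)

lemma span_mon_mult:
  assumes "f \<in> cfun.span (mon ` {ws. length ws = d})" "g \<in> cfun.span (mon ` {ws. length ws = e})"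
  shows "f * g \<in> cfun.span (mon ` {ws. length ws = d + e})"
  using assms(1)
proof (induction rule: cfun.span_induct_alt)
  case base show ?case by (simp add: cfun.span_zero)
next
  case (step a f1 f2)
  have "f1 * g \<in> cfun.span (mon ` {ws. length ws = d + e})"
    using assms(2)
  proof (induction rule: cfun.span_induct_alt)
    case base show ?case by (simp add: cfun.span_zero)
  next
    case (step b g1 g2)
    then obtain xs ys where "f1 = mon xs" "length xs = d" "g1 = mon ys" "length ys = e"
      using \<open>f1 \<in> mon ` {ws. length ws = d}\<close> by auto
    then have "f1 * g1 \<in> cfun.span (mon ` {ws. length ws = d + e})"
      by (intro cfun.span_base) (auto simp flip: mon_append)
    then have "cst b * (f1 * g1) + f1 * g2 \<in> cfun.span (mon ` {ws. length ws = d + e})"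
      using step by (intro cfun.span_add cfun.span_scale)
    then show ?case by (simp add: algebra_simps)
  qed
  then have "cst a * (f1 * g) + f2 * g \<in> cfun.span (mon ` {ws. length ws = d + e})"
    using step by (intro cfun.span_add cfun.span_scale)
  then show ?case by (simp add: algebra_simps)
qed

lemma lf_eq_sum: "lf x = (\<Sum>i\<in>UNIV. cst (x $ i) * lf (axis i 1))"
  by (auto simp: fun_eq_iff fun_apply lf_def pairing_axis) (simp add: pairing_def mult.commute)

lemma comp_in_span_mon:
  "polyfun f \<Longrightarrow> comp d f \<in> cfun.span (mon ` {ws. length ws = d})"
proof (induction arbitrary: d rule: polyfun.induct)
  case (polyfun_cst a)
  have "cst a * mon [] \<in> cfun.span (mon ` {ws. length ws = 0})"
    by (intro cfun.span_scale cfun.span_base) auto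
  then show ?case by (auto simp: comp_cst cfun.span_zero mon_simps)
next
  case (polyfun_lf x)
  have "(\<Sum>i\<in>UNIV. cst (x $ i) * mon [i]) \<in> cfun.span (mon ` {ws. length ws = 1})"
    by (intro cfun.span_sum cfun.span_scale cfun.span_base) auto
  then have "lf x \<in> cfun.span (mon ` {ws. length ws = 1})"
    by (simp add: mon_simps flip: lf_eq_sum)
  then show ?case by (auto simp: comp_lf cfun.span_zero)
next
  case (polyfun_add f g) then show ?case by (auto simp: comp_add intro: cfun.span_add)
next
  case (polyfun_mult f g)
  show ?case
    unfolding comp_mult[OF polyfun_mult.hyps]
  proof (intro cfun.span_sum)
    fix i assume "i \<in> {..d}"
    then show "comp i f * comp (d - i) g \<in> cfun.span (mon ` {ws. length ws = d})"
      using span_mon_mult[OF polyfun_mult.IH, of i "d - i"] by simp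
  qed
qed

text \<open>All finiteness arguments rest on this spanning set. Words list a monomial several times,
  which is harmless: what counts is that there are finitely many words of bounded length, and that a
  long word repeats some letter often.\<close>

lemma homog_in_span_mon:
  "polyfun f \<Longrightarrow> homog d f \<Longrightarrow> f \<in> cfun.span (mon ` {ws. length ws = d})"
  using comp_in_span_mon[of f d] by (simp add: comp_homog)

section \<open>Invariants of reflection groups\<close>

text \<open>One set-up for two actions, on functions on \<open>V\<close> and on functions on its
  dual. \<open>A\<close> reverses products because \<open>act\<close> substitutes
  \<open>A w v\<close> for the argument, and this makes \<open>act\<close> a left action. The root
  form \<open>l s\<close> and the vector \<open>u s\<close> carry no mutual normalisation, so that
  reflections of any order and any choice of scale fit.\<close>

locale reflection_action = group G for G (structure) +
  fixes A :: "'a \<Rightarrow> complex ^ 'n ^ 'n" and R :: "'a set" and l u :: "'a \<Rightarrow> complex ^ 'n"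
  assumes fin: "finite (carrier G)"
    and A_one: "A \<one> = mat 1"
    and A_mult: "x \<in> carrier G \<Longrightarrow> y \<in> carrier G \<Longrightarrow> A (x \<otimes> y) = A y ** A x"
    and R_sub: "R \<subseteq> carrier G"
    and R_gen: "generate G R = carrier G"
    and A_refl: "s \<in> R \<Longrightarrow> A s *v v = v - pairing v (l s) *s u s"
    and l_nz: "s \<in> R \<Longrightarrow> l s \<noteq> 0"
begin

definition act :: "'a \<Rightarrow> (complex ^ 'n \<Rightarrow> complex) \<Rightarrow> complex ^ 'n \<Rightarrow> complex" where
  "act w f = (\<lambda>v. f (A w *v v))"

lemma act_one: "act \<one> f = f" by (simp add: act_def A_one)

lemma act_mult: "x \<in> carrier G \<Longrightarrow> y \<in> carrier G \<Longrightarrow> act (x \<otimes> y) f = act x (act y f)"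
  by (simp add: act_def A_mult matrix_vector_mul_assoc)

lemma act_inv: "x \<in> carrier G \<Longrightarrow> act (inv x) (act x f) = f"
  by (simp flip: act_mult add: act_one)

lemma act_add: "act w (f + g) = act w f + act w g"
  and act_times: "act w (f * g) = act w f * act w g"
  and act_diff: "act w (f - g) = act w f - act w g"
  and act_uminus: "act w (- f) = - act w f"
  and act_cst: "act w (cst a) = cst a"
  and act_0: "act w 0 = 0"
  by (simp_all add: act_def fun_eq_iff fun_apply)

lemma act_sum: "act w (\<Sum>i\<in>I. f i) = (\<Sum>i\<in>I. act w (f i))"
  and act_prod: "act w (\<Prod>i\<in>I. f i) = (\<Prod>i\<in>I. act w (f i))"
  by (simp_all add: act_def fun_eq_iff fun_apply)

lemma polyfun_act: "polyfun f \<Longrightarrow> polyfun (act w f)"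
  unfolding act_def by (rule polyfun_compose)

lemma homog_act: "homog d f \<Longrightarrow> homog d (act w f)"
  by (simp add: homog_def act_def vector_scalar_commute)

lemma act_inj: "w \<in> carrier G \<Longrightarrow> act w f = 0 \<Longrightarrow> f = 0"
  by (metis act_inv act_0)

lemma comp_act: "polyfun f \<Longrightarrow> comp d (act w f) = act w (comp d f)"
proof -
  assume f: "polyfun f"
  have "ray (act w f) v = ray f (A w *v v)" for v
    by (rule ray_eqI) (simp add: poly_ray[OF f] act_def vector_scalar_commute)
  then show ?thesis by (simp add: comp_def act_def fun_eq_iff)
qed

lemma bij_mult: "x \<in> carrier G \<Longrightarrow> bij_betw (\<lambda>w. x \<otimes> w) (carrier G) (carrier G)"
  by (rule bij_betwI[where g = "\<lambda>w. inv x \<otimes> w"]) (auto simp flip: m_assoc)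

lemma bij_mult': "x \<in> carrier G \<Longrightarrow> bij_betw (\<lambda>w. w \<otimes> x) (carrier G) (carrier G)"
  by (rule bij_betwI[where g = "\<lambda>w. w \<otimes> inv x"]) (auto simp: m_assoc)

section \<open>Invariants and the Reynolds operator\<close>

definition invariant :: "(complex ^ 'n \<Rightarrow> complex) \<Rightarrow> bool" where
  "invariant f \<longleftrightarrow> polyfun f \<and> (\<forall>w \<in> carrier G. act w f = f)"

lemma invariantD: "invariant f \<Longrightarrow> polyfun f" "invariant f \<Longrightarrow> w \<in> carrier G \<Longrightarrow> act w f = f"
  by (auto simp: invariant_def)

lemma invariant_cst: "invariant (cst a)"
  and invariant_add: "invariant f \<Longrightarrow> invariant g \<Longrightarrow> invariant (f + g)"
  and invariant_mult: "invariant f \<Longrightarrow> invariant g \<Longrightarrow> invariant (f * g)"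
  and invariant_uminus: "invariant f \<Longrightarrow> invariant (- f)"
  and invariant_comp: "invariant f \<Longrightarrow> invariant (comp d f)"
  by (auto simp: invariant_def act_cst act_add act_times act_uminus polyfun_comp
      simp flip: comp_act intro: polyfun_intros)

lemma invariant_0: "invariant 0" and invariant_1: "invariant 1"
  using invariant_cst[of 0] invariant_cst[of 1] by (simp_all add: cst_0 cst_1)

definition average :: "(complex ^ 'n \<Rightarrow> complex) \<Rightarrow> complex ^ 'n \<Rightarrow> complex" where
  "average f = cst (1 / of_nat (order G)) * (\<Sum>w\<in>carrier G. act w f)"

lemma order_nz: "of_nat (order G) \<noteq> (0 :: complex)"
  using fin order_gt_0_iff_finite by auto

lemma invariant_average: "polyfun f \<Longrightarrow> invariant (average f)"
proof -
  assume f: "polyfun f"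
  have "act x (\<Sum>w\<in>carrier G. act w f) = (\<Sum>w\<in>carrier G. act w f)" if x: "x \<in> carrier G" for x
  proof -
    have "act x (\<Sum>w\<in>carrier G. act w f) = (\<Sum>w\<in>carrier G. act (x \<otimes> w) f)"
      using x by (simp add: act_sum act_mult)
    also have "\<dots> = (\<Sum>w\<in>carrier G. act w f)" using sum.reindex_bij_betw[OF bij_mult[OF x]] .
    finally show ?thesis .
  qed
  then show ?thesis
    unfolding invariant_def average_def
    using f by (auto simp: act_times act_cst intro!: polyfun_intros polyfun_act)
qed

lemma average_mult_invariant: "invariant g \<Longrightarrow> average (g * f) = g * average f"
  by (simp add: average_def act_times invariantD sum_distrib_left mult.left_commute)

lemma average_invariant: "invariant g \<Longrightarrow> average g = g"
  using order_nz by (simp add: average_def invariantD fun_eq_iff fun_apply order_def)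

lemma average_add: "average (f + g) = average f + average g"
  by (simp add: average_def act_add sum.distrib algebra_simps)

lemma average_at_0: "average f 0 = f 0"
  using order_nz by (simp add: average_def fun_apply act_def order_def)

lemma average_0: "average 0 = 0"
  by (simp add: average_def act_0)

subsection \<open>Divided differences\<close>

text \<open>The Demazure operator, the quotient of \<open>f - s f\<close> by the root form. The
  choice by \<open>SOME\<close> is unique, since root forms can be cancelled:
  \<open>dd_eqI\<close>.\<close>

definition dd :: "'a \<Rightarrow> (complex ^ 'n \<Rightarrow> complex) \<Rightarrow> complex ^ 'n \<Rightarrow> complex" where
  "dd s f = (SOME q. polyfun q \<and> f - act s f = lf (l s) * q)"

lemma act_lf: "s \<in> R \<Longrightarrow> act s (lf x) = lf x - cst (pairing (u s) x) * lf (l s)"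
  by (simp add: act_def A_refl fun_eq_iff lf_apply fun_apply pairing_diff_left pairing_scale_left)

text \<open>On linear forms \<open>s\<close> differs from the identity by a multiple of
  \<open>lf (l s)\<close>; divisibility then spreads to products, because
  \<open>f g - s f s g\<close> is the sum of \<open>(f - s f) g\<close> and
  \<open>s f (g - s g)\<close>.\<close>

lemma dd_exists:
  assumes s: "s \<in> R" and "polyfun f"
  shows "\<exists>q. polyfun q \<and> f - act s f = lf (l s) * q"
  using assms(2)
proof induction
  case (polyfun_cst a) show ?case by (rule exI[of _ 0]) (simp add: act_cst polyfun_0)
next
  case (polyfun_lf x)
  show ?case by (rule exI[of _ "cst (pairing (u s) x)"])
      (simp add: act_lf[OF s] polyfun_cst mult.commute)
next
  case (polyfun_add f g)
  then obtain p q where "polyfun p" "polyfun q"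
    "f - act s f = lf (l s) * p" "g - act s g = lf (l s) * q" by blast
  then show ?case
    by (intro exI[of _ "p + q"]) (simp add: polyfun.polyfun_add act_add algebra_simps)
next
  case (polyfun_mult f g)
  then obtain p q where "polyfun p" "polyfun q"
    and eq: "f - act s f = lf (l s) * p" "g - act s g = lf (l s) * q" by blast
  moreover have "f * g - act s (f * g) = lf (l s) * (p * g + act s f * q)"
  proof -
    have "f * g - act s (f * g) = (f - act s f) * g + act s f * (g - act s g)"
      by (simp add: act_times algebra_simps)
    then show ?thesis by (simp only: eq) (simp add: algebra_simps)
  qed
  ultimately show ?case using polyfun_mult.hyps
    by (intro exI[of _ "p * g + act s f * q"])
       (simp add: polyfun.polyfun_mult polyfun.polyfun_add polyfun_act)
qed

lemma
  assumes "s \<in> R" "polyfun f"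
  shows polyfun_dd: "polyfun (dd s f)" and dd_eq: "f - act s f = lf (l s) * dd s f"
  using someI_ex[OF dd_exists[OF assms]] by (auto simp: dd_def)

lemma lf_l_nz: "s \<in> R \<Longrightarrow> lf (l s) \<noteq> 0"
  using l_nz lf_eq_0_iff by blast

lemma dd_eqI:
  assumes s: "s \<in> R" and f: "polyfun f" and q: "polyfun q" "f - act s f = lf (l s) * q"
  shows "dd s f = q"
  using polyfun_mult_cancel[OF polyfun_dd[OF s f] q(1) polyfun_lf lf_l_nz[OF s]] dd_eq[OF s f] q(2)
  by (simp add: mult.commute)

lemma dd_add:
  assumes s: "s \<in> R" and f: "polyfun f" and g: "polyfun g"
  shows "dd s (f + g) = dd s f + dd s g"
proof (rule dd_eqI[OF s])
  have "f + g - act s (f + g) = (f - act s f) + (g - act s g)"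
    by (simp add: act_add algebra_simps)
  then show "f + g - act s (f + g) = lf (l s) * (dd s f + dd s g)"
    using s f g by (simp only: dd_eq distrib_left)
qed (use assms in \<open>auto intro!: polyfun_add polyfun_dd\<close>)

text \<open>The twisted Leibniz rule, with \<open>s\<close> acting on the right factor. The same
  twist arises in the algebra when \<open>s\<close> is carried to the right across \<open>g\<close>,
  which is what \<open>commutator\<close> exploits.\<close>

lemma dd_mult:
  assumes s: "s \<in> R" and f: "polyfun f" and g: "polyfun g"
  shows "dd s (f * g) = f * dd s g + dd s f * act s g"
proof (rule dd_eqI[OF s])
  have "f * g - act s (f * g) = f * (g - act s g) + (f - act s f) * act s g"
    by (simp add: act_times algebra_simps)
  also have "\<dots> = f * (lf (l s) * dd s g) + (lf (l s) * dd s f) * act s g"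
    using s f g by (simp only: dd_eq)
  also have "\<dots> = lf (l s) * (f * dd s g + dd s f * act s g)"
    by (simp only: distrib_left mult.assoc mult.left_commute[of f])
  finally show "f * g - act s (f * g) = \<dots>" .
qed (use assms in \<open>auto intro!: polyfun_add polyfun_mult polyfun_dd polyfun_act\<close>)

lemma dd_lf: "s \<in> R \<Longrightarrow> dd s (lf x) = cst (pairing (u s) x)"
  by (rule dd_eqI) (auto simp: act_lf polyfun_lf polyfun_cst mult.commute)

lemma dd_invariant: "s \<in> R \<Longrightarrow> invariant g \<Longrightarrow> dd s g = 0"
  by (rule dd_eqI) (use R_sub in \<open>auto simp: invariantD polyfun_0\<close>)

lemma dd_invariant_mult:
  "s \<in> R \<Longrightarrow> invariant g \<Longrightarrow> polyfun f \<Longrightarrow> dd s (g * f) = g * dd s f"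
  by (simp add: dd_mult invariantD dd_invariant)

lemma dd_cst: "s \<in> R \<Longrightarrow> dd s (cst a) = 0"
  by (simp add: dd_invariant invariant_cst)

lemma dd_homog:
  assumes s: "s \<in> R" and f: "polyfun f" "homog d f"
  shows "dd s f = 0 \<or> (1 \<le> d \<and> homog (d - 1) (dd s f))"
proof (rule homog_quotient[OF polyfun_dd[OF s f(1)] polyfun_lf homog_lf lf_l_nz[OF s]])
  show "homog d (dd s f * lf (l s))"
    using f homog_diff[OF f(2) homog_act[OF f(2)]] by (simp add: mult.commute flip: dd_eq[OF s f(1)])
qed

subsection \<open>The Hilbert ideal\<close>

text \<open>The ideal generated by the invariants that vanish at the origin; its quotient is the
  coinvariant algebra. One multiple of a generator is added at a time, so that induction follows a
  representation as a sum of such multiples.\<close>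

inductive hilbert :: "(complex ^ 'n \<Rightarrow> complex) \<Rightarrow> bool" where
  hilbert_0: "hilbert 0"
| hilbert_step: "hilbert f \<Longrightarrow> invariant g \<Longrightarrow> g 0 = 0 \<Longrightarrow> polyfun p \<Longrightarrow> hilbert (g * p + f)"

lemma polyfun_hilbert: "hilbert f \<Longrightarrow> polyfun f"
  by (induction rule: hilbert.induct) (auto intro: polyfun_intros invariantD)

lemma hilbert_gen: "invariant g \<Longrightarrow> g 0 = 0 \<Longrightarrow> polyfun p \<Longrightarrow> hilbert (g * p)"
  using hilbert_step[OF hilbert_0] by fastforce

lemma hilbert_add: "hilbert f \<Longrightarrow> hilbert g \<Longrightarrow> hilbert (f + g)"
  by (induction rule: hilbert.induct) (auto simp: add.assoc intro: hilbert_step)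

lemma hilbert_mult: "hilbert f \<Longrightarrow> polyfun h \<Longrightarrow> hilbert (h * f)"
proof (induction rule: hilbert.induct)
  case (hilbert_step f g p)
  then have "hilbert (g * (h * p) + h * f)" by (intro hilbert.hilbert_step polyfun_mult) auto
  then show ?case by (simp add: algebra_simps)
qed (auto intro: hilbert_0)

lemma hilbert_cst_mult: "hilbert f \<Longrightarrow> hilbert (cst a * f)"
  by (simp add: hilbert_mult polyfun_cst)

lemma hilbert_uminus: "hilbert f \<Longrightarrow> hilbert (- f)"
  using hilbert_cst_mult[of f "-1"] by (simp add: cst_minus cst_1)

lemma hilbert_diff: "hilbert f \<Longrightarrow> hilbert g \<Longrightarrow> hilbert (f - g)"
  using hilbert_add[OF _ hilbert_uminus, of f g] by simp

lemma hilbert_sum: "(\<And>i. i \<in> I \<Longrightarrow> hilbert (f i)) \<Longrightarrow> hilbert (\<Sum>i\<in>I. f i)"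
  by (induction I rule: infinite_finite_induct) (auto simp: hilbert_0 hilbert_add)

lemma hilbert_act: "hilbert f \<Longrightarrow> w \<in> carrier G \<Longrightarrow> hilbert (act w f)"
  by (induction rule: hilbert.induct)
     (auto simp: act_0 act_add act_times invariantD polyfun_act intro: hilbert.intros)

lemma hilbert_at_0: "hilbert f \<Longrightarrow> f 0 = 0"
  by (induction rule: hilbert.induct) (auto simp: fun_apply)

lemma hilbert_cst_cancel: "hilbert (cst a * f) \<Longrightarrow> a \<noteq> 0 \<Longrightarrow> hilbert f"
  using hilbert_cst_mult[of "cst a * f" "inverse a"]
  by (simp add: cst_1 flip: mult.assoc cst_mult)

text \<open>Congruence of \<open>p\<close> with \<open>s p\<close> modulo the Hilbert ideal spreads
  along words in the reflections, as \<open>p - x y p = (p - x p) + x (p - y p)\<close> and the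
  ideal is stable under the group.\<close>

lemma hilbert_average_diff:
  assumes "\<And>s. s \<in> R \<Longrightarrow> hilbert (p - act s p)"
  shows "hilbert (p - average p)"
proof -
  have "\<forall>w\<in>carrier G. hilbert (p - act w p)"
  proof
    fix w assume "w \<in> carrier G"
    then have "w \<in> generate G R" by (simp add: R_gen)
    then show "hilbert (p - act w p)"
    proof (induction w rule: generate.induct)
      case one then show ?case by (simp add: act_one hilbert_0)
    next
      case (incl h) then show ?case using assms by blast
    next
      case (inv h)
      then have h: "h \<in> carrier G" using R_sub by blast
      have "hilbert (- act (inv h) (p - act h p))"
        using assms[OF inv] h by (intro hilbert_uminus hilbert_act) auto
      then show ?case using h by (simp add: act_diff act_inv)
    next
      case (eng h1 h2)
      then have h: "h1 \<in> carrier G" "h2 \<in> carrier G" using R_gen by auto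
      have "hilbert ((p - act h1 p) + act h1 (p - act h2 p))"
        using eng h by (intro hilbert_add hilbert_act)
      then show ?case using h by (simp add: act_diff act_mult)
    qed
  qed
  then have "hilbert (cst (1 / of_nat (order G)) * (\<Sum>w\<in>carrier G. p - act w p))"
    by (intro hilbert_cst_mult hilbert_sum) blast
  moreover have "cst (1 / of_nat (order G)) * (\<Sum>w\<in>carrier G. p) = p"
    using order_nz by (simp add: fun_eq_iff fun_apply order_def)
  ultimately show ?thesis
    by (simp add: sum_subtractf right_diff_distrib average_def)
qed

text \<open>Divided differences are linear over the invariants and lower the degree of a relation, and
  averaging leads from the \<open>p1 - s p1\<close> back to \<open>p1\<close>.\<close>

lemma chevalley:
  assumes "invariant g1" "invariant g2" "polyfun p1" "homog d p1" "polyfun p2"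
    and "g1 * p1 + g2 * p2 = 0" and "\<nexists>h. invariant h \<and> g1 = h * g2"
  shows "hilbert p1"
  using assms(3-6)
proof (induction d arbitrary: p1 p2)
  case 0
  define a where "a = p1 0"
  have p1: "p1 = cst a" using homog_0_const[OF \<open>homog 0 p1\<close>] by (simp add: a_def)
  have "a = 0"
  proof (rule ccontr)
    assume a: "a \<noteq> 0"
    \<comment> \<open>Averaging turns the cofactor \<open>p2\<close> into an invariant, so that a
      nonzero constant \<open>a\<close> could be divided out and would make \<open>g1\<close> an
      invariant multiple of \<open>g2\<close>.\<close>
    have "average (g1 * p1 + g2 * p2) = 0" using 0 by (simp add: average_0)
    then have "g1 * cst a = - g2 * average p2"
      using assms(1,2)
      by (simp add: average_add average_mult_invariant p1 average_invariant invariant_cst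
          eq_neg_iff_add_eq_0)
    then have "g1 * cst a * cst (inverse a) = cst (inverse a) * (- g2 * average p2)" by simp
    then have "g1 = (- cst (inverse a) * average p2) * g2"
      using a by (simp add: mult.assoc cst_1 flip: cst_mult)
    moreover have "invariant (- cst (inverse a) * average p2)"
      using 0 by (intro invariant_mult invariant_uminus invariant_cst invariant_average)
    ultimately show False using assms(7) by blast
  qed
  then show ?case by (simp add: p1 hilbert_0 cst_0)
next
  case (Suc d)
  have "hilbert (p1 - act s p1)" if s: "s \<in> R" for s
  proof -
    have "dd s (g1 * p1 + g2 * p2) = g1 * dd s p1 + g2 * dd s p2"
      using Suc.prems(1,3) assms(1,2) s
      by (simp add: dd_add dd_invariant_mult invariantD polyfun_mult)
    then have eq: "g1 * dd s p1 + g2 * dd s p2 = 0"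
      using Suc.prems(4) dd_cst[OF s, of 0] by (simp add: cst_0)
    have "homog d (dd s p1)"
      using dd_homog[OF s Suc.prems(1,2)] by (auto simp: homog_zero)
    then have "hilbert (dd s p1)"
      using Suc.IH[OF _ _ _ eq] Suc.prems s polyfun_dd by blast
    then show ?thesis using dd_eq[OF s Suc.prems(1)] by (simp add: hilbert_mult polyfun_lf)
  qed
  then have "hilbert (p1 - average p1)" by (rule hilbert_average_diff)
  \<comment> \<open>The average is invariant; having positive degree, \<open>p1\<close> vanishes at
    the origin, and so does its average.\<close>
  moreover have "hilbert (average p1 * 1)"
    using Suc.prems by (intro hilbert_gen invariant_average polyfun_1)
      (auto simp: average_at_0 homog_Suc_at_0)
  ultimately show ?case using hilbert_add by fastforce
qed

text \<open>A linear form \<open>x\<close> is a root of the product of the \<open>T - w x\<close>, whose coefficients are invariants.\<close>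

lemma hilbert_lf_power: "hilbert (lf x ^ order G)"
proof -
  \<comment> \<open>Up to sign, the elementary symmetric functions of the translates of
    \<open>lf x\<close>. Indexing by subsets of the group counts coinciding translates with
    multiplicity.\<close>
  define e where "e k = (\<Sum>X\<in>{X \<in> Pow (carrier G). card X = k}. \<Prod>w\<in>X. - act w (lf x))" for k
  have P: "finite (Pow (carrier G))" using fin by simp
  have e_inv: "invariant (e k)" for k
  proof -
    have "act y (e k) = e k" if y: "y \<in> carrier G" for y
    proof -
      have inj: "inj_on ((\<otimes>) y) X" if "X \<subseteq> carrier G" "y \<in> carrier G" for X y
        using that by (intro inj_onI) (metis Units_l_cancel Units_eq subsetD)
      have im: "(\<otimes>) (inv y) ` (\<otimes>) y ` X = X" if "X \<subseteq> carrier G" "y \<in> carrier G" for X y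
      proof -
        have "inv y \<otimes> (y \<otimes> w) = w" if "w \<in> X" for w
          using that \<open>X \<subseteq> carrier G\<close> \<open>y \<in> carrier G\<close> by (simp add: subsetD flip: m_assoc)
        then show ?thesis by (simp add: image_image)
      qed
      let ?S = "{X \<in> Pow (carrier G). card X = k}"
      have S: "(\<otimes>) y ` X \<in> ?S" if "X \<in> ?S" "y \<in> carrier G" for X y
        using that inj[of X y] by (auto simp: card_image)
      have "act y (e k) = (\<Sum>X\<in>?S. \<Prod>w\<in>X. - act (y \<otimes> w) (lf x))"
        unfolding e_def act_sum act_prod
        by (intro sum.cong refl prod.cong) (use y in \<open>auto simp: act_uminus act_mult\<close>)
      also have "\<dots> = (\<Sum>X\<in>?S. \<Prod>w\<in>X. - act w (lf x))"
      proof (rule sum.reindex_bij_witness[where j = "(`) ((\<otimes>) y)" and i = "(`) ((\<otimes>) (inv y))"])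
        fix X assume X: "X \<in> ?S"
        show "(\<otimes>) (inv y) ` (\<otimes>) y ` X = X" using im[of X y] X y by simp
        show "(\<otimes>) y ` (\<otimes>) (inv y) ` X = X" using im[of X "inv y"] X y by simp
        show "(\<otimes>) y ` X \<in> ?S" using S X y by blast
        show "(\<otimes>) (inv y) ` X \<in> ?S" using S[of X "inv y"] X y by simp
        show "(\<Prod>w\<in>(\<otimes>) y ` X. - act w (lf x)) = (\<Prod>w\<in>X. - act (y \<otimes> w) (lf x))"
          using X y by (simp add: prod.reindex inj)
      qed
      also have "\<dots> = e k" by (simp add: e_def)
      finally show ?thesis .
    qed
    moreover have "polyfun (e k)"
      unfolding e_def by (intro polyfun_sum polyfun_prod polyfun_uminus polyfun_act polyfun_lf)
    ultimately show ?thesis by (simp add: invariant_def)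
  qed
  have e_0: "e k 0 = 0" if "k > 0" for k
  proof -
    have "(\<Prod>w\<in>X. - act w (lf x)) 0 = 0" if "X \<subseteq> carrier G" "card X = k" for X
    proof -
      have "finite X" "X \<noteq> {}" using that \<open>k > 0\<close> by (auto simp: card_gt_0_iff)
      then show ?thesis by (auto simp: fun_apply act_def lf_apply pairing_0_left)
    qed
    then show ?thesis unfolding e_def by (auto simp: fun_apply intro!: sum.neutral)
  qed
  \<comment> \<open>The factor belonging to the identity is \<open>- lf x + lf x\<close>.\<close>
  have "0 = (\<Prod>w\<in>carrier G. - act w (lf x) + lf x)"
    using fin act_one by (intro prod_zero[symmetric]) (auto intro!: bexI[of _ \<one>])
  also have "\<dots> = (\<Sum>X\<in>Pow (carrier G). (\<Prod>w\<in>X. - act w (lf x)) * lf x ^ card (carrier G - X))"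
    using prod_add[OF fin, of "\<lambda>w. - act w (lf x)" "\<lambda>_. lf x"] by (simp only: prod_constant)
  also have "\<dots> = (\<Sum>X\<in>Pow (carrier G). (\<Prod>w\<in>X. - act w (lf x)) * lf x ^ (order G - card X))"
    using fin by (intro sum.cong) (auto simp: card_Diff_subset finite_subset order_def)
  also have "\<dots> = (\<Sum>k\<in>{..order G}. \<Sum>X\<in>{X \<in> Pow (carrier G). card X = k}.
      (\<Prod>w\<in>X. - act w (lf x)) * lf x ^ (order G - card X))"
    using fin by (intro sum.group[symmetric]) (auto simp: order_def card_mono)
  also have "\<dots> = (\<Sum>k\<in>{..order G}. e k * lf x ^ (order G - k))"
    by (simp add: e_def sum_distrib_right)
  also have "\<dots> = e 0 * lf x ^ order G + (\<Sum>k\<in>{..order G} - {0}. e k * lf x ^ (order G - k))"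
    by (subst sum.remove[of _ 0]) auto
  also have "e 0 = 1"
  proof -
    have "{X \<in> Pow (carrier G). card X = 0} = {{}}" using fin by (auto dest: finite_subset)
    then show ?thesis by (simp add: e_def)
  qed
  finally have "lf x ^ order G = - (\<Sum>k\<in>{..order G} - {0}. e k * lf x ^ (order G - k))"
    by (simp add: eq_neg_iff_add_eq_0)
  moreover have "hilbert \<dots>"
    by (intro hilbert_uminus hilbert_sum hilbert_gen e_inv e_0 polyfun_power polyfun_lf) auto
  ultimately show ?thesis by simp
qed

end

context reflection_action
begin

subsection \<open>The socle of the coinvariant algebra\<close>

lemma count_mon: "mon ws = (\<Prod>i\<in>UNIV. lf (axis i 1) ^ count_list ws i)"
proof (induction ws)
  case (Cons j ws)
  have "(\<Prod>i\<in>UNIV. lf (axis i 1) ^ count_list (j # ws) i) =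
    (\<Prod>i\<in>UNIV. (if i = j then lf (axis i 1) else 1) * lf (axis i 1) ^ count_list ws i)"
    by (intro prod.cong) auto
  then show ?case by (simp add: mon_simps Cons prod.distrib)
qed (simp add: mon_simps)

text \<open>Pigeonhole: in a word of this length some coordinate occurs at least
  \<open>order G\<close> times, and that power of it already lies in the Hilbert ideal.\<close>

lemma hilbert_mon: "length ws \<ge> CARD('n) * order G \<Longrightarrow> hilbert (mon ws)" for ws :: "'n list"
proof -
  assume len: "length ws \<ge> CARD('n) * order G"
  have "\<exists>i. count_list ws i \<ge> order G"
  proof (rule ccontr)
    assume "\<not> ?thesis"
    then have "count_list ws i < order G" for i by (meson not_le)
    then have "(\<Sum>i\<in>UNIV. count_list ws i) < (\<Sum>i\<in>(UNIV :: 'n set). order G)"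
      by (intro sum_strict_mono) auto
    moreover have "(\<Sum>i\<in>UNIV. count_list ws i) = length ws"
      using sum_count_set[of ws UNIV] by simp
    ultimately show False using len by simp
  qed
  then obtain i where i: "count_list ws i \<ge> order G" by blast
  define k where "k = count_list ws i - order G"
  have "mon ws = lf (axis i 1) ^ count_list ws i * (\<Prod>j\<in>UNIV - {i}. lf (axis j 1) ^ count_list ws j)"
    unfolding count_mon by (simp add: prod.remove)
  also have "count_list ws i = k + order G" using i by (simp add: k_def)
  finally have "mon ws =
      (lf (axis i 1) ^ k * (\<Prod>j\<in>UNIV - {i}. lf (axis j 1) ^ count_list ws j)) * lf (axis i 1) ^ order G"
    by (simp add: power_add ac_simps)
  then show ?thesis
    by (simp only:) (intro hilbert_mult hilbert_lf_power polyfun_intros)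
qed

lemma hilbert_large_degree:
  assumes "polyfun f" "homog d f" "d \<ge> CARD('n) * order G"
  shows "hilbert f"
  using homog_in_span_mon[OF assms(1,2)]
proof (induction rule: cfun.span_induct_alt)
  case base show ?case by (rule hilbert_0)
next
  case (step a f g)
  then show ?case using assms(3) by (auto intro!: hilbert_add hilbert_cst_mult hilbert_mon)
qed

text \<open>Representatives of the socle of the coinvariant algebra, the part killed by all linear
  forms; elements of the Hilbert ideal count among them.\<close>

definition socle :: "(complex ^ 'n \<Rightarrow> complex) \<Rightarrow> bool" where
  "socle f \<longleftrightarrow> polyfun f \<and> (\<forall>x. hilbert (lf x * f))"

text \<open>Take a homogeneous multiplier \<open>g\<close> of the largest degree with
  \<open>f * g\<close> outside the Hilbert ideal; a further linear factor then leads into it. The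
  degree is bounded because the ideal contains everything homogeneous of large degree.\<close>

lemma exists_socle_multiple:
  assumes f: "polyfun f" "homog d f" "\<not> hilbert f"
  shows "\<exists>g e. polyfun g \<and> homog e g \<and> socle (f * g) \<and> \<not> hilbert (f * g)"
proof -
  define P where "P e \<longleftrightarrow> (\<exists>g. polyfun g \<and> homog e g \<and> \<not> hilbert (f * g))" for e
  have "P 0" unfolding P_def using f homog_cst[of 1] by (intro exI[of _ 1]) (auto simp: polyfun_1 cst_1)
  moreover have "e \<le> CARD('n) * order G" if "P e" for e
  proof (rule ccontr)
    assume e: "\<not> e \<le> CARD('n) * order G"
    obtain g where g: "polyfun g" "homog e g" "\<not> hilbert (f * g)" using \<open>P e\<close> by (auto simp: P_def)
    have "hilbert (f * g)"
      by (rule hilbert_large_degree[of _ "d + e"]) (use f g e in \<open>auto intro: polyfun_mult homog_mult\<close>)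
    then show False using g by simp
  qed
  ultimately obtain e where e: "P e" "\<And>k. P k \<Longrightarrow> k \<le> e"
    using ex_has_greatest_nat[of P 0 "\<lambda>x. x" "Suc (CARD('n) * order G)"] by (metis le_imp_less_Suc)
  obtain g where g: "polyfun g" "homog e g" "\<not> hilbert (f * g)" using e(1) by (auto simp: P_def)
  have "hilbert (lf x * (f * g))" for x
  proof (rule ccontr)
    assume "\<not> hilbert (lf x * (f * g))"
    then have "\<not> hilbert (f * (lf x * g))" by (simp add: mult.left_commute)
    then have "P (1 + e)" unfolding P_def
      using g homog_mult[OF homog_lf g(2)] by (intro exI[of _ "lf x * g"]) (auto intro: polyfun_intros)
    then show False using e(2) by fastforce
  qed
  then show ?thesis using f g by (intro exI[of _ g] exI[of _ e]) (auto simp: socle_def polyfun_mult)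
qed

text \<open>The eigenvalue of \<open>s\<close> on its own root form, see \<open>act_l\<close>. It is
  the one eigenvalue of \<open>s\<close> that may differ from 1.\<close>

definition lam :: "'a \<Rightarrow> complex" where
  "lam s = 1 - pairing (u s) (l s)"

lemma act_l: "s \<in> R \<Longrightarrow> act s (lf (l s)) = cst (lam s) * lf (l s)"
  by (simp add: act_lf lam_def fun_eq_iff fun_apply algebra_simps)

lemma lam_nz: "s \<in> R \<Longrightarrow> lam s \<noteq> 0"
  using act_l[of s] act_inj[of s "lf (l s)"] lf_l_nz[of s] R_sub by (auto simp: cst_0)

text \<open>The divided difference preserves the Hilbert ideal, as it is linear over the invariants.
  Applied to \<open>lf (l s) * f\<close>, which lies in the ideal, it yields
  \<open>f - cst (lam s) * act s f\<close>.\<close>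

lemma socle_act:
  assumes s: "s \<in> R" and f: "socle f"
  shows "hilbert (act s f - cst (inverse (lam s)) * f)"
proof -
  have pf: "polyfun f" and lf: "hilbert (lf (l s) * f)" using f by (auto simp: socle_def)
  have "lf (l s) * f - act s (lf (l s) * f) = lf (l s) * dd s (lf (l s) * f)"
    using s pf by (intro dd_eq) (auto intro: polyfun_intros)
  moreover have "dd s (lf (l s) * f) = f - cst (lam s) * act s f"
  proof (rule dd_eqI[OF s])
    show "lf (l s) * f - act s (lf (l s) * f) = lf (l s) * (f - cst (lam s) * act s f)"
      using s by (simp add: act_times act_l algebra_simps)
  qed (use pf in \<open>auto intro!: polyfun_intros polyfun_act\<close>)
  moreover have "hilbert g \<Longrightarrow> hilbert (dd s g)" for g
  proof (induction rule: hilbert.induct)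
    case hilbert_0 then show ?case using dd_cst[OF s, of 0] by (simp add: cst_0 hilbert.hilbert_0)
  next
    case (hilbert_step f g p)
    then show ?case
      by (simp add: dd_add[OF s] dd_invariant_mult[OF s] polyfun_hilbert invariantD polyfun_mult
          hilbert.hilbert_step polyfun_dd[OF s])
  qed
  ultimately have "hilbert (f - cst (lam s) * act s f)" using lf by metis
  then have "hilbert (cst (- inverse (lam s)) * (f - cst (lam s) * act s f))" by (rule hilbert_cst_mult)
  moreover have "cst (- inverse (lam s)) * (f - cst (lam s) * act s f) = act s f - cst (inverse (lam s)) * f"
    using lam_nz[OF s] by (simp add: fun_eq_iff fun_apply algebra_simps)
  ultimately show ?thesis by simp
qed

text \<open>A single scalar serves all socle elements at once, because the scalar found in
  \<open>socle_act\<close> depends on the reflection alone. Any socle element outside the Hilbert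
  ideal determines it: \<open>chi_unique\<close>.\<close>

definition chi :: "'a \<Rightarrow> complex" where
  "chi w = (SOME a. a \<noteq> 0 \<and> (\<forall>f. socle f \<longrightarrow> hilbert (act w f - cst a * f)))"

lemma chi_exists:
  assumes "w \<in> carrier G"
  shows "\<exists>a. a \<noteq> 0 \<and> (\<forall>f. socle f \<longrightarrow> hilbert (act w f - cst a * f))"
proof -
  have "w \<in> generate G R" using assms by (simp add: R_gen)
  then show ?thesis
  proof (induction w rule: generate.induct)
    case one then show ?case by (intro exI[of _ 1]) (simp add: act_one cst_1 hilbert_0)
  next
    case (incl h)
    then show ?case using socle_act lam_nz by (intro exI[of _ "inverse (lam h)"]) auto
  next
    case (inv h)
    have h: "h \<in> carrier G" using inv R_sub by blast
    have "hilbert (act (inv h) f - cst (lam h) * f)" if f: "socle f" for f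
    proof -
      have "hilbert (cst (- lam h) * act (inv h) (act h f - cst (inverse (lam h)) * f))"
        using socle_act[OF inv f] h by (intro hilbert_cst_mult hilbert_act) auto
      moreover have "cst (- lam h) * act (inv h) (act h f - cst (inverse (lam h)) * f) =
          act (inv h) f - cst (lam h) * f"
        using lam_nz[OF inv] h
        by (simp add: act_diff act_times act_cst act_inv fun_eq_iff fun_apply algebra_simps)
      ultimately show ?thesis by simp
    qed
    then show ?case using lam_nz[OF inv] by blast
  next
    case (eng h1 h2)
    then have h: "h1 \<in> carrier G" "h2 \<in> carrier G" using R_gen by auto
    obtain a b where a: "a \<noteq> 0" "\<And>f. socle f \<Longrightarrow> hilbert (act h1 f - cst a * f)"
      and b: "b \<noteq> 0" "\<And>f. socle f \<Longrightarrow> hilbert (act h2 f - cst b * f)" using eng.IH by blast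
    have "hilbert (act (h1 \<otimes> h2) f - cst (a * b) * f)" if f: "socle f" for f
    proof -
      have "hilbert (act h1 (act h2 f - cst b * f) + cst b * (act h1 f - cst a * f))"
        using a(2)[OF f] b(2)[OF f] h by (intro hilbert_add hilbert_cst_mult hilbert_act)
      then show ?thesis
        using h by (simp add: act_mult act_diff act_times act_cst cst_mult algebra_simps)
    qed
    then show ?case using a(1) b(1) by (intro exI[of _ "a * b"]) auto
  qed
qed

lemma chi_nz: "w \<in> carrier G \<Longrightarrow> chi w \<noteq> 0"
  and chi_socle: "w \<in> carrier G \<Longrightarrow> socle f \<Longrightarrow> hilbert (act w f - cst (chi w) * f)"
  using someI_ex[OF chi_exists[of w]] by (auto simp: chi_def)

lemma one_not_hilbert: "\<not> hilbert 1"
  using hilbert_at_0[of 1] by (auto simp: fun_apply)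

lemma socle_exists: "\<exists>f e. homog e f \<and> socle f \<and> \<not> hilbert f"
  using exists_socle_multiple[of 1 0] one_not_hilbert homog_cst[of 1] by (auto simp: cst_1 polyfun_1)

lemma chi_unique:
  assumes "socle f" "\<not> hilbert f" "hilbert (act w f - cst a * f)" "w \<in> carrier G"
  shows "chi w = a"
proof -
  have "hilbert ((act w f - cst a * f) - (act w f - cst (chi w) * f))"
    using hilbert_diff[OF assms(3) chi_socle[OF assms(4,1)]] .
  moreover have "(act w f - cst a * f) - (act w f - cst (chi w) * f) = cst (chi w - a) * f"
    by (simp add: fun_eq_iff fun_apply algebra_simps)
  ultimately have "hilbert (cst (chi w - a) * f)" by simp
  then show ?thesis using hilbert_cst_cancel assms(2) by fastforce
qed

lemma chi_mult:
  assumes "x \<in> carrier G" "y \<in> carrier G"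
  shows "chi (x \<otimes> y) = chi x * chi y"
proof -
  obtain f where f: "socle f" "\<not> hilbert f" using socle_exists by blast
  have "hilbert (act x (act y f - cst (chi y) * f) + cst (chi y) * (act x f - cst (chi x) * f))"
    using assms f chi_socle by (intro hilbert_add hilbert_cst_mult hilbert_act) auto
  then have "hilbert (act (x \<otimes> y) f - cst (chi x * chi y) * f)"
    using assms by (simp add: act_mult act_diff act_times act_cst cst_mult algebra_simps)
  then show ?thesis using chi_unique f assms by simp
qed

lemma chi_one: "chi \<one> = 1"
proof -
  obtain f where f: "socle f" "\<not> hilbert f" using socle_exists by blast
  then show ?thesis by (intro chi_unique[of f]) (auto simp: act_one cst_1 hilbert_0)
qed

lemma chi_R: "s \<in> R \<Longrightarrow> chi s = inverse (lam s)"
proof -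
  assume s: "s \<in> R"
  obtain f where f: "socle f" "\<not> hilbert f" using socle_exists by blast
  then show ?thesis using s R_sub socle_act by (intro chi_unique[of f]) auto
qed

subsection \<open>Semi-invariants\<close>

text \<open>The projection to the \<open>chi\<close>-semi-invariants, multiplied by the order of the
  group.\<close>

definition alt :: "(complex ^ 'n \<Rightarrow> complex) \<Rightarrow> complex ^ 'n \<Rightarrow> complex" where
  "alt f = (\<Sum>w\<in>carrier G. cst (inverse (chi w)) * act w f)"

definition semi_invariant :: "(complex ^ 'n \<Rightarrow> complex) \<Rightarrow> bool" where
  "semi_invariant f \<longleftrightarrow> polyfun f \<and> (\<forall>w\<in>carrier G. act w f = cst (chi w) * f)"

lemma polyfun_alt: "polyfun f \<Longrightarrow> polyfun (alt f)"
  unfolding alt_def by (intro polyfun_intros polyfun_act)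

lemma homog_alt: "homog d f \<Longrightarrow> homog d (alt f)"
  unfolding alt_def by (intro homog_sum homog_cst_mult homog_act)

lemma alt_add: "alt (f + g) = alt f + alt g"
  by (simp add: alt_def act_add sum.distrib algebra_simps)

lemma alt_invariant_mult: "invariant g \<Longrightarrow> alt (g * f) = g * alt f"
  by (simp add: alt_def act_times invariantD sum_distrib_left mult.left_commute)

lemma alt_act:
  assumes x: "x \<in> carrier G" shows "alt (act x f) = cst (chi x) * alt f"
proof -
  have "alt (act x f) = (\<Sum>w\<in>carrier G. cst (chi x) * (cst (inverse (chi (w \<otimes> x))) * act (w \<otimes> x) f))"
    unfolding alt_def
  proof (intro sum.cong refl)
    fix w assume w: "w \<in> carrier G"
    then show "cst (inverse (chi w)) * act w (act x f) =
        cst (chi x) * (cst (inverse (chi (w \<otimes> x))) * act (w \<otimes> x) f)"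
      using x chi_nz[OF x] by (simp add: chi_mult act_mult fun_eq_iff fun_apply)
  qed
  also have "\<dots> = cst (chi x) * alt f"
    unfolding alt_def sum_distrib_left[symmetric]
    using sum.reindex_bij_betw[OF bij_mult'[OF x], of "\<lambda>w. cst (inverse (chi w)) * act w f"] by simp
  finally show ?thesis .
qed

lemma act_alt:
  assumes x: "x \<in> carrier G" shows "act x (alt f) = cst (chi x) * alt f"
proof -
  have "act x (alt f) = (\<Sum>w\<in>carrier G. cst (chi x) * (cst (inverse (chi (x \<otimes> w))) * act (x \<otimes> w) f))"
    unfolding alt_def act_sum
  proof (intro sum.cong refl)
    fix w assume w: "w \<in> carrier G"
    then show "act x (cst (inverse (chi w)) * act w f) =
        cst (chi x) * (cst (inverse (chi (x \<otimes> w))) * act (x \<otimes> w) f)"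
      using x chi_nz[OF x] by (simp add: chi_mult act_mult act_times act_cst fun_eq_iff fun_apply)
  qed
  also have "\<dots> = cst (chi x) * alt f"
    unfolding alt_def sum_distrib_left[symmetric]
    using sum.reindex_bij_betw[OF bij_mult[OF x], of "\<lambda>w. cst (inverse (chi w)) * act w f"] by simp
  finally show ?thesis .
qed

lemma semi_invariant_alt: "polyfun f \<Longrightarrow> semi_invariant (alt f)"
  by (simp add: semi_invariant_def polyfun_alt act_alt)

text \<open>Modulo the Hilbert ideal \<open>w\<close> acts on \<open>f\<close> by
  \<open>chi w\<close>, so each summand of \<open>alt f\<close> contributes one copy of
  \<open>f\<close>. Hence a socle element outside the ideal gives a semi-invariant outside
  it.\<close>

lemma alt_socle:
  assumes f: "socle f" shows "hilbert (alt f - cst (of_nat (order G)) * f)"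
proof -
  have "alt f - cst (of_nat (order G)) * f =
      (\<Sum>w\<in>carrier G. cst (inverse (chi w)) * (act w f - cst (chi w) * f))"
  proof -
    have "(\<Sum>w\<in>carrier G. cst (inverse (chi w)) * (act w f - cst (chi w) * f)) =
        (\<Sum>w\<in>carrier G. cst (inverse (chi w)) * act w f - f)"
      by (intro sum.cong refl) (use chi_nz in \<open>simp add: fun_eq_iff fun_apply algebra_simps\<close>)
    then show ?thesis by (simp add: sum_subtractf alt_def order_def fun_eq_iff fun_apply)
  qed
  then show ?thesis using f by (simp only:) (intro hilbert_sum hilbert_cst_mult chi_socle)
qed

lemma alt_socle_not_hilbert: "socle f \<Longrightarrow> \<not> hilbert f \<Longrightarrow> \<not> hilbert (alt f)"
proof
  assume f: "socle f" "\<not> hilbert f" "hilbert (alt f)"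
  have "hilbert (alt f - (alt f - cst (of_nat (order G)) * f))"
    using hilbert_diff[OF f(3) alt_socle[OF f(1)]] .
  then have "hilbert (cst (of_nat (order G)) * f)" by simp
  then show False using f(2) hilbert_cst_cancel order_nz by blast
qed

text \<open>The function and its degree are chosen together, so that the recorded degree belongs to
  the chosen function.\<close>

definition Delta_deg :: "(complex ^ 'n \<Rightarrow> complex) \<times> nat" where
  "Delta_deg = (SOME x. semi_invariant (fst x) \<and> homog (snd x) (fst x) \<and> \<not> hilbert (fst x))"

definition Delta where "Delta = fst Delta_deg"
definition top_degree where "top_degree = snd Delta_deg"

lemma semi_invariant_Delta: "semi_invariant Delta"
  and homog_Delta: "homog top_degree Delta"
  and Delta_not_hilbert: "\<not> hilbert Delta"
proof -
  obtain f e where f: "homog e f" "socle f" "\<not> hilbert f" using socle_exists by blast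
  then have "\<exists>x. semi_invariant (fst x) \<and> homog (snd x) (fst x) \<and> \<not> hilbert (fst x)"
    using alt_socle_not_hilbert semi_invariant_alt homog_alt
    by (intro exI[of _ "(alt f, e)"]) (auto simp: socle_def)
  from someI_ex[OF this] show "semi_invariant Delta" "homog top_degree Delta" "\<not> hilbert Delta"
    by (simp_all add: Delta_deg_def Delta_def top_degree_def)
qed

lemma Delta_nz: "Delta \<noteq> 0" using Delta_not_hilbert hilbert_0 by auto

lemma polyfun_Delta: "polyfun Delta" using semi_invariant_Delta by (simp add: semi_invariant_def)

lemma act_Delta: "w \<in> carrier G \<Longrightarrow> act w Delta = cst (chi w) * Delta"
  using semi_invariant_Delta by (simp add: semi_invariant_def)

text \<open>\<open>F / Delta\<close> is a quotient \<open>b / a\<close> of invariants, as one sees on expanding by the norm of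
  \<open>Delta\<close>; so \<open>b Delta = a F\<close>, and Chevalley's lemma makes \<open>b\<close> a multiple of \<open>a\<close>.\<close>

lemma semi_invariant_multiple:
  assumes F: "semi_invariant F"
  shows "\<exists>h. invariant h \<and> F = h * Delta"
proof -
  define a where "a = (\<Prod>w\<in>carrier G. act w Delta)"
  \<comment> \<open>\<open>F\<close> times the norm \<open>a\<close> of \<open>Delta\<close> without
    its factor at the identity, so that \<open>b * Delta = a * F\<close>. As \<open>F\<close> and
    \<open>Delta\<close> have the same character, \<open>b\<close> is invariant.\<close>
  define b where "b = F * (\<Prod>w\<in>carrier G - {\<one>}. act w Delta)"
  have pF: "polyfun F" using F by (simp add: semi_invariant_def)
  have pa: "polyfun a" and pb: "polyfun b"
    unfolding a_def b_def by (intro polyfun_intros polyfun_act pF polyfun_Delta)+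
  have ab: "b * Delta = a * F"
    unfolding a_def b_def using fin by (simp add: prod.remove[of _ \<one>] act_one ac_simps)
  have a_nz: "a \<noteq> 0"
  proof
    assume "a = 0"
    then obtain w where "w \<in> carrier G" "act w Delta = 0"
      using polyfun_prod_eq_0[OF fin, of "\<lambda>w. act w Delta"] polyfun_act[OF polyfun_Delta]
      by (auto simp: a_def)
    then show False using act_inj Delta_nz by blast
  qed
  have a_inv: "invariant a"
  proof -
    have "act x a = a" if x: "x \<in> carrier G" for x
    proof -
      have "act x a = (\<Prod>w\<in>carrier G. act (x \<otimes> w) Delta)"
        unfolding a_def act_prod by (intro prod.cong) (auto simp: x act_mult)
      also have "\<dots> = a" unfolding a_def using prod.reindex_bij_betw[OF bij_mult[OF x]] .
      finally show ?thesis .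
    qed
    then show ?thesis using pa by (simp add: invariant_def)
  qed
  have b_inv: "invariant b"
  proof -
    have "act x b = b" if x: "x \<in> carrier G" for x
    proof -
      have "act x (b * Delta) = act x (a * F)" by (simp add: ab)
      then have "cst (chi x) * (act x b * Delta) = cst (chi x) * (a * F)"
        using x F a_inv by (simp add: act_times act_Delta semi_invariant_def invariantD ac_simps)
      then have "act x b * Delta = a * F"
        using chi_nz[OF x] by (simp add: fun_eq_iff fun_apply)
      then have "act x b * Delta = b * Delta" by (simp add: ab)
      then show ?thesis
        using polyfun_mult_cancel[OF polyfun_act[OF pb] pb polyfun_Delta Delta_nz] by blast
    qed
    then show ?thesis using pb by (simp add: invariant_def)
  qed
  have "\<exists>h. invariant h \<and> b = h * a"
  proof (rule ccontr)
    assume "\<not> ?thesis"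
    moreover have "b * Delta + a * (- F) = 0" using ab by simp
    ultimately have "hilbert Delta"
      using chevalley[OF b_inv a_inv polyfun_Delta homog_Delta polyfun_uminus[OF pF]] by blast
    then show False using Delta_not_hilbert by simp
  qed
  then obtain h where h: "invariant h" "b = h * a" by blast
  have "(h * Delta) * a = F * a" using ab h(2) by (simp add: ac_simps)
  then have "h * Delta = F"
    using polyfun_mult_cancel[OF _ pF pa a_nz] h(1) polyfun_Delta by (simp add: invariantD polyfun_mult)
  then show ?thesis using h(1) by blast
qed

definition Phi :: "(complex ^ 'n \<Rightarrow> complex) \<Rightarrow> complex ^ 'n \<Rightarrow> complex" where
  "Phi f = (SOME h. invariant h \<and> alt f = h * Delta)"

lemma invariant_Phi: "polyfun f \<Longrightarrow> invariant (Phi f)"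
  and Phi_Delta: "polyfun f \<Longrightarrow> alt f = Phi f * Delta"
  using someI_ex[OF semi_invariant_multiple[OF semi_invariant_alt], of f] by (auto simp: Phi_def)

lemma Phi_eqI:
  assumes "polyfun f" "invariant h" "alt f = h * Delta" shows "Phi f = h"
  using polyfun_mult_cancel[OF _ _ polyfun_Delta Delta_nz] assms invariant_Phi Phi_Delta
  by (metis invariantD(1))

lemma Phi_add: "polyfun f \<Longrightarrow> polyfun g \<Longrightarrow> Phi (f + g) = Phi f + Phi g"
  by (rule Phi_eqI)
     (auto simp: alt_add Phi_Delta[symmetric] distrib_right invariant_Phi intro: polyfun_add invariant_add)

lemma Phi_invariant_mult: "invariant g \<Longrightarrow> polyfun f \<Longrightarrow> Phi (g * f) = g * Phi f"
  by (rule Phi_eqI)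
     (auto simp: alt_invariant_mult Phi_Delta[symmetric] mult.assoc invariantD
           intro: polyfun_mult invariant_mult invariant_Phi)

lemma Phi_0: "Phi 0 = 0"
  using Phi_invariant_mult[OF invariant_0 polyfun_0] by simp

lemma Phi_act: "w \<in> carrier G \<Longrightarrow> polyfun f \<Longrightarrow> Phi (act w f) = cst (chi w) * Phi f"
  by (rule Phi_eqI)
     (auto simp: alt_act Phi_Delta[symmetric] mult.assoc
           intro: polyfun_act invariant_mult invariant_Phi invariant_cst)

lemma Phi_diff: "polyfun f \<Longrightarrow> polyfun g \<Longrightarrow> Phi (f - g) = Phi f - Phi g"
  using Phi_add[of "f - g" g] by (simp add: polyfun_diff)

lemma Phi_sum: "(\<And>i. i \<in> I \<Longrightarrow> polyfun (f i)) \<Longrightarrow> Phi (\<Sum>i\<in>I. f i) = (\<Sum>i\<in>I. Phi (f i))"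
  by (induction I rule: infinite_finite_induct) (auto simp: Phi_0 Phi_add polyfun_sum)

lemma Phi_homog:
  assumes "polyfun f" "homog d f"
  shows "Phi f = 0 \<or> (top_degree \<le> d \<and> homog (d - top_degree) (Phi f))"
  using homog_quotient[OF _ polyfun_Delta homog_Delta Delta_nz, of "Phi f" d] assms
    invariantD(1)[OF invariant_Phi] homog_alt[of d f] by (simp add: Phi_Delta)

text \<open>If \<open>Phi (f * g)\<close> vanished at the origin for a socle multiple
  \<open>f * g\<close> outside the Hilbert ideal, then
  \<open>alt (f * g) = Phi (f * g) * Delta\<close> would lie in the ideal. So it has a nonzero
  constant term; being homogeneous, it is constant and can be scaled to 1.\<close>

lemma Phi_dual_exists:
  assumes f: "polyfun f" "homog d f" "\<not> hilbert f"
  shows "\<exists>g. polyfun g \<and> d \<le> top_degree \<and> homog (top_degree - d) g \<and> Phi (f * g) = 1"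
proof -
  obtain g e where g: "polyfun g" "homog e g" "socle (f * g)" "\<not> hilbert (f * g)"
    using exists_socle_multiple[OF f] by blast
  have pfg: "polyfun (f * g)" using f g by (simp add: polyfun_mult)
  have "\<not> hilbert (Phi (f * g) * Delta)"
    using alt_socle_not_hilbert[OF g(3,4)] by (simp add: Phi_Delta[OF pfg])
  then have nz: "Phi (f * g) 0 \<noteq> 0" using hilbert_gen[OF invariant_Phi[OF pfg] _ polyfun_Delta] by blast
  then have h: "top_degree \<le> d + e" "homog (d + e - top_degree) (Phi (f * g))"
    using Phi_homog[OF pfg homog_mult[OF f(2) g(2)]] by (auto simp: fun_apply)
  then have de: "d + e = top_degree" using homog_Suc_at_0 nz by force
  define a where "a = Phi (f * g) 0"
  have a: "Phi (f * g) = cst a" using h homog_0_const de by (simp add: a_def)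
  have "Phi (f * (cst (inverse a) * g)) = cst (inverse a) * Phi (f * g)"
    using Phi_invariant_mult[OF invariant_cst pfg] by (simp add: mult.left_commute)
  also have "\<dots> = 1" using nz by (simp add: a a_def[symmetric] cst_1 cst_apply flip: cst_mult)
  finally have "Phi (f * (cst (inverse a) * g)) = 1" .
  moreover have "e = top_degree - d" using de by simp
  ultimately show ?thesis
    using g de homog_cst_mult[OF g(2)] by (intro exI[of _ "cst (inverse a) * g"])
      (auto intro: polyfun_intros)
qed

subsection \<open>Dual bases over the invariants\<close>

text \<open>A partial pair of dual bases. Complementary degrees make \<open>Phi (b i * b' i)\<close>
  a scalar, and the bound on \<open>dg\<close> serves both the finiteness in
  \<open>dual_system_bound\<close> and the vanishing of \<open>Phi\<close> on divided
  differences.\<close>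

definition dual_system ::
  "nat \<Rightarrow> (nat \<Rightarrow> complex ^ 'n \<Rightarrow> complex) \<Rightarrow> (nat \<Rightarrow> complex ^ 'n \<Rightarrow> complex) \<Rightarrow> (nat \<Rightarrow> nat) \<Rightarrow> bool"
where
  "dual_system k b b' dg \<longleftrightarrow>
    (\<forall>i<k. polyfun (b i) \<and> polyfun (b' i) \<and> dg i \<le> top_degree \<and>
       homog (dg i) (b i) \<and> homog (top_degree - dg i) (b' i)) \<and>
    (\<forall>i<k. \<forall>j<k. Phi (b i * b' j) = (if i = j then 1 else 0))"

text \<open>The \<open>b i\<close> are linearly independent over the scalars, as pairing a relation
  with \<open>b' j\<close> isolates one coefficient; and their degrees are at most
  \<open>top_degree\<close>, which leaves a space of finite dimension.\<close>

lemma dual_system_bound: 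
  "\<exists>K. \<forall>k b b' dg. dual_system k b b' dg \<longrightarrow> k \<le> K"
proof (intro exI allI impI)
  fix k b b' dg assume ds: "dual_system k b b' dg"
  let ?M = "mon ` {ws :: 'n list. set ws \<subseteq> UNIV \<and> length ws \<le> top_degree}"
  have finM: "finite ?M" by (intro finite_imageI finite_lists_length_le) auto
  have inj: "inj_on b {..<k}"
    using ds unfolding dual_system_def inj_on_def
    by (metis (no_types, lifting) lessThan_iff zero_neq_one)
  have sub: "b ` {..<k} \<subseteq> cfun.span ?M"
  proof
    fix f assume "f \<in> b ` {..<k}"
    then obtain i where i: "i < k" "f = b i" by auto
    then have "f \<in> cfun.span (mon ` {ws. length ws = dg i})"
      using ds homog_in_span_mon[of f "dg i"] by (auto simp: dual_system_def)
    moreover have "dg i \<le> top_degree" using ds i by (auto simp: dual_system_def)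
    then have "mon ` {ws :: 'n list. length ws = dg i} \<subseteq> ?M" by auto
    ultimately show "f \<in> cfun.span ?M" using cfun.span_mono by blast
  qed
  have "cfun.independent (b ` {..<k})"
  proof (rule cfun.independent_if_scalars_zero)
    fix a f assume eq: "(\<Sum>x\<in>b ` {..<k}. cst (a x) * x) = 0" and f: "f \<in> b ` {..<k}"
    then obtain j where j: "j < k" "f = b j" by auto
    have "0 = Phi ((\<Sum>x\<in>b ` {..<k}. cst (a x) * x) * b' j)" by (simp add: eq Phi_0)
    also have "(\<Sum>x\<in>b ` {..<k}. cst (a x) * x) * b' j = (\<Sum>i<k. cst (a (b i)) * (b i * b' j))"
      using inj by (simp add: sum.reindex sum_distrib_right mult.assoc)
    also have "Phi \<dots> = (\<Sum>i<k. Phi (cst (a (b i)) * (b i * b' j)))"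
      using ds j unfolding dual_system_def by (intro Phi_sum polyfun_mult polyfun_cst) auto
    also have "\<dots> = (\<Sum>i<k. cst (a (b i)) * Phi (b i * b' j))"
      using ds j unfolding dual_system_def
      by (intro sum.cong refl Phi_invariant_mult invariant_cst polyfun_mult) auto
    also have "\<dots> = (\<Sum>i<k. if i = j then cst (a (b i)) else 0)"
      using ds j unfolding dual_system_def by (intro sum.cong) auto
    also have "\<dots> = cst (a f)" using j by simp
    finally show "a f = 0" by (metis cst_apply zero_fun_apply)
  qed simp
  from cfun.independent_span_bound[OF finM this sub]
  show "k \<le> card ?M" using inj by (simp add: card_image)
qed

text \<open>A dual system of maximal length spans: in the lowest degree where \<open>f - E f\<close>
  could be nonzero, this remainder is orthogonal to all \<open>b' i\<close>, lies outside the
  Hilbert ideal, and would extend the system. The clause on divided differences is stated here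
  because its proof uses the degrees of the \<open>b i\<close>.\<close>

lemma dual_bases_exist:
  "\<exists>k :: nat. \<exists>b b'. (\<forall>i<k. polyfun (b i) \<and> polyfun (b' i)) \<and>
    (\<forall>i<k. \<forall>j<k. Phi (b i * b' j) = (if i = j then 1 else 0)) \<and>
    (\<forall>f. polyfun f \<longrightarrow> f = (\<Sum>i<k. Phi (f * b' i) * b i)) \<and>
    (\<forall>f. \<forall>s\<in>R. polyfun f \<longrightarrow> Phi (dd s f) = 0)"
proof -
  define P where "P k \<longleftrightarrow> (\<exists>b b' dg. dual_system k b b' dg)" for k
  have "P 0" by (auto simp: P_def dual_system_def)
  moreover obtain K where "\<And>k. P k \<Longrightarrow> k \<le> K" using dual_system_bound unfolding P_def by blast
  ultimately obtain k where k: "P k" "\<And>j. P j \<Longrightarrow> j \<le> k"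
    using ex_has_greatest_nat[of P 0 "\<lambda>x. x" "Suc K"] by (metis le_imp_less_Suc)
  obtain b b' dg where ds: "dual_system k b b' dg" using k(1) by (auto simp: P_def)
  have b: "polyfun (b i)" "polyfun (b' i)" "dg i \<le> top_degree" "homog (dg i) (b i)"
    "homog (top_degree - dg i) (b' i)" if "i < k" for i
    using ds that by (auto simp: dual_system_def)
  have bb: "Phi (b i * b' j) = (if i = j then 1 else 0)" if "i < k" "j < k" for i j
    using ds that by (auto simp: dual_system_def)
  define E where "E f = (\<Sum>i<k. Phi (f * b' i) * b i)" for f
  have pE: "polyfun (E f)" if "polyfun f" for f
    unfolding E_def using that b by (intro polyfun_sum polyfun_mult invariantD(1)[OF invariant_Phi]) auto
  have E_add: "E (f + g) = E f + E g" if "polyfun f" "polyfun g" for f g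
    unfolding E_def using that b
    by (simp add: distrib_right Phi_add polyfun_mult sum.distrib)
  have E_inv: "E (g * f) = g * E f" if "polyfun f" "invariant g" for f g
    unfolding E_def using that b
    by (simp add: mult.assoc Phi_invariant_mult polyfun_mult sum_distrib_left)
  have E_dual: "Phi (E f * b' j) = Phi (f * b' j)" if "polyfun f" "j < k" for f j
  proof -
    have "Phi (E f * b' j) = (\<Sum>i<k. Phi (Phi (f * b' i) * (b i * b' j)))"
      unfolding E_def sum_distrib_right mult.assoc
      using that b by (intro Phi_sum polyfun_mult invariantD(1)[OF invariant_Phi]) auto
    also have "\<dots> = (\<Sum>i<k. Phi (f * b' i) * Phi (b i * b' j))"
      using that b by (intro sum.cong refl Phi_invariant_mult invariant_Phi polyfun_mult) auto
    also have "\<dots> = (\<Sum>i<k. if i = j then Phi (f * b' i) else 0)"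
      using that bb by (intro sum.cong) auto
    also have "\<dots> = Phi (f * b' j)" using that by simp
    finally show ?thesis .
  qed
  have homog_E: "homog d (E f)" if f: "polyfun f" "homog d f" for f d
    unfolding E_def
  proof (rule homog_sum)
    fix i assume "i \<in> {..<k}"
    then have i: "i < k" by simp
    have "Phi (f * b' i) = 0 \<or>
        (top_degree \<le> d + (top_degree - dg i) \<and>
         homog (d + (top_degree - dg i) - top_degree) (Phi (f * b' i)))"
      using f b[OF i] by (intro Phi_homog polyfun_mult homog_mult)
    then show "homog d (Phi (f * b' i) * b i)"
    proof
      assume "Phi (f * b' i) = 0" then show ?thesis by (simp add: homog_zero)
    next
      assume *: "top_degree \<le> d + (top_degree - dg i) \<and>
         homog (d + (top_degree - dg i) - top_degree) (Phi (f * b' i))"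
      then have "d + (top_degree - dg i) - top_degree + dg i = d" using b(3)[OF i] by linarith
      then show ?thesis using homog_mult[OF conjunct2[OF *] b(4)[OF i]] by simp
    qed
  qed
  have homog_span: "E f = f" if "polyfun f" "homog d f" for f d
    using that
  proof (induction d arbitrary: f rule: less_induct)
    case (less d)
    show ?case
    proof (rule ccontr)
      assume neq: "E f \<noteq> f"
      define f1 where "f1 = f - E f"
      have pf1: "polyfun f1" and hf1: "homog d f1"
        using less.prems pE homog_E by (auto simp: f1_def intro: polyfun_diff homog_diff)
      have Phi_f1: "Phi (f1 * b' j) = 0" if "j < k" for j
        using E_dual[OF less.prems(1) that] less.prems b that pE
        by (simp add: f1_def left_diff_distrib Phi_diff polyfun_mult)
      have E_f1: "E f1 = 0" by (simp add: E_def Phi_f1)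
      have "\<not> hilbert f1"
      proof
        assume h: "hilbert f1"
        \<comment> \<open>In degree \<open>d\<close>, a product of \<open>p\<close> with an
          invariant vanishing at the origin involves only components of \<open>p\<close> of degree
          below \<open>d\<close>, on which \<open>E\<close> is already the identity. Components are
          taken since the generators of the ideal are not assumed homogeneous.\<close>
        have "E (comp d g) = comp d g" if "hilbert g" for g
          using that
        proof (induction rule: hilbert.induct)
          case hilbert_0
          have "comp d (0 :: complex ^ 'n \<Rightarrow> complex) = 0" using comp_homog[OF homog_zero] by simp
          then show ?case by (simp add: E_def Phi_0)
        next
          case (hilbert_step f g p)
          have pg: "polyfun g" using hilbert_step by (simp add: invariantD)
          have "E (comp i g * comp (d - i) p) = comp i g * comp (d - i) p" if "i \<le> d" for i
          proof (cases "i = 0")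
            case True
            then show ?thesis using comp_0[OF pg] hilbert_step(3) by (simp add: cst_0 E_def Phi_0)
          next
            case False
            then have "E (comp (d - i) p) = comp (d - i) p"
              using that hilbert_step(4) by (intro less.IH[of "d - i"] polyfun_comp homog_comp) auto
            then show ?thesis
              using hilbert_step by (simp add: E_inv polyfun_comp invariant_comp)
          qed
          moreover have "E (sum f I) = (\<Sum>i\<in>I. E (f i))" if "\<And>i. i \<in> I \<Longrightarrow> polyfun (f i)"
            for f :: "nat \<Rightarrow> _" and I
            using that
          proof (induction I rule: infinite_finite_induct)
            case (insert i I)
            then show ?case by (simp add: E_add polyfun_sum)
          qed (auto simp: E_def Phi_0)
          ultimately have "E (comp d (g * p)) = comp d (g * p)"
            using hilbert_step(4) pg by (simp add: comp_mult polyfun_mult polyfun_comp)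
          then show ?case
            using hilbert_step pg polyfun_hilbert[OF hilbert_step(1)]
            by (simp add: comp_add polyfun_mult E_add polyfun_comp)
        qed
        from this[OF h] have "E f1 = f1" by (simp add: comp_homog[OF hf1])
        then show False using E_f1 neq by (simp add: f1_def)
      qed
      then obtain g where g: "polyfun g" "d \<le> top_degree" "homog (top_degree - d) g" "Phi (f1 * g) = 1"
        using Phi_dual_exists[OF pf1 hf1] by blast
      \<comment> \<open>Gram-Schmidt: \<open>g\<close> is made orthogonal to the \<open>b j\<close>.
        Its pairing with \<open>f1\<close> stays 1, as \<open>f1\<close> is orthogonal to the
        \<open>b' j\<close>.\<close>
      define g1 where "g1 = g - (\<Sum>j<k. Phi (b j * g) * b' j)"
      have ps: "polyfun (Phi (b j * g) * b' j)" if "j < k" for j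
        using b[OF that] g by (intro polyfun_mult invariantD(1)[OF invariant_Phi])
      have pg1: "polyfun g1" unfolding g1_def using g ps by (intro polyfun_diff polyfun_sum) auto
      have hg1: "homog (top_degree - d) g1"
        unfolding g1_def
      proof (rule homog_diff[OF g(3) homog_sum])
        fix j assume "j \<in> {..<k}"
        then have j: "j < k" by simp
        have "Phi (b j * g) = 0 \<or> (top_degree \<le> dg j + (top_degree - d) \<and>
            homog (dg j + (top_degree - d) - top_degree) (Phi (b j * g)))"
          using g b[OF j] by (intro Phi_homog polyfun_mult homog_mult)
        then show "homog (top_degree - d) (Phi (b j * g) * b' j)"
        proof
          assume "Phi (b j * g) = 0" then show ?thesis by (simp add: homog_zero)
        next
          assume *: "top_degree \<le> dg j + (top_degree - d) \<and>
            homog (dg j + (top_degree - d) - top_degree) (Phi (b j * g))"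
          then have "dg j + (top_degree - d) - top_degree + (top_degree - dg j) = top_degree - d"
            using b(3)[OF j] g(2) by linarith
          then show ?thesis using homog_mult[OF conjunct2[OF *] b(5)[OF j]] by simp
        qed
      qed
      have Phi_g1: "Phi (h * g1) = Phi (h * g) - (\<Sum>j<k. Phi (b j * g) * Phi (h * b' j))"
        if "polyfun h" for h
      proof -
        have p: "polyfun (Phi (b j * g) * (h * b' j))" if "j < k" for j
          using \<open>polyfun h\<close> that g b by (intro polyfun_mult invariantD(1)[OF invariant_Phi]) auto
        have e: "h * g1 = h * g - (\<Sum>j<k. Phi (b j * g) * (h * b' j))"
          unfolding g1_def right_diff_distrib sum_distrib_left by (simp only: mult.left_commute)
        have "Phi (h * g1) = Phi (h * g) - Phi (\<Sum>j<k. Phi (b j * g) * (h * b' j))"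
          unfolding e by (intro Phi_diff polyfun_mult[OF that g(1)] polyfun_sum p) auto
        moreover have "Phi (\<Sum>j<k. Phi (b j * g) * (h * b' j)) =
            (\<Sum>j<k. Phi (Phi (b j * g) * (h * b' j)))"
          using p by (intro Phi_sum) auto
        moreover have "\<dots> = (\<Sum>j<k. Phi (b j * g) * Phi (h * b' j))"
          using that g b by (intro sum.cong refl Phi_invariant_mult polyfun_mult invariant_Phi) auto
        ultimately show ?thesis by simp
      qed
      have 1: "Phi (b i * g1) = 0" if "i < k" for i
      proof -
        have "(\<Sum>j<k. Phi (b j * g) * Phi (b i * b' j)) = (\<Sum>j<k. if j = i then Phi (b j * g) else 0)"
          using that bb by (intro sum.cong) auto
        then show ?thesis using that b by (simp add: Phi_g1)
      qed
      have 2: "Phi (f1 * g1) = 1" using g pf1 by (simp add: Phi_g1 Phi_f1)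
      have "dual_system (Suc k) (b(k := f1)) (b'(k := g1)) (dg(k := d))"
        unfolding dual_system_def
      proof (intro conjI allI impI)
        fix i assume "i < Suc k"
        then consider "i < k" | "i = k" by linarith
        then show "polyfun ((b(k := f1)) i)" "polyfun ((b'(k := g1)) i)"
          "(dg(k := d)) i \<le> top_degree" "homog ((dg(k := d)) i) ((b(k := f1)) i)"
          "homog (top_degree - (dg(k := d)) i) ((b'(k := g1)) i)"
          by (cases; use b pf1 hf1 pg1 hg1 g(2) in simp)+
      next
        fix i j assume "i < Suc k" "j < Suc k"
        then consider "i < k" "j < k" | "i = k" "j < k" | "i < k" "j = k" | "i = k" "j = k" by linarith
        then show "Phi ((b(k := f1)) i * (b'(k := g1)) j) = (if i = j then 1 else 0)"
          by cases (use bb 1 2 Phi_f1 in simp_all)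
      qed
      then have "P (Suc k)" unfolding P_def by blast
      then show False using k(2) by fastforce
    qed
  qed
  have span: "E f = f" if "polyfun f" for f
    using that
  proof (induction rule: polyfun_induct_homog)
    case (homog d g) then show ?case using homog_span by blast
  next
    case (add g h) then show ?case by (simp add: E_add)
  qed
  have "Phi (dd s f) = 0" if f: "polyfun f" and s: "s \<in> R" for f s
  proof -
    \<comment> \<open>\<open>dd s\<close> lowers the degree of \<open>b i\<close> below
      \<open>top_degree\<close>, where \<open>Phi\<close> vanishes. Linearity over the invariants
      then gives the general case.\<close>
    have "Phi (dd s (b i)) = 0" if i: "i < k" for i
    proof (rule ccontr)
      assume nz: "Phi (dd s (b i)) \<noteq> 0"
      then have "1 \<le> dg i" "homog (dg i - 1) (dd s (b i))"
        using dd_homog[OF s b(1,4)[OF i]] by (auto simp: Phi_0)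
      then show False using Phi_homog[OF polyfun_dd[OF s b(1)[OF i]]] nz b(3)[OF i] by force
    qed
    note Phi_b = this
    have pP: "polyfun (Phi (f * b' i) * b i)" if "i < k" for i
      using that f b by (intro polyfun_mult invariantD(1)[OF invariant_Phi])
    have dd_sum: "dd s (\<Sum>i\<in>I. g i) = (\<Sum>i\<in>I. dd s (g i))" if "\<And>i. i \<in> I \<Longrightarrow> polyfun (g i)"
      for g :: "nat \<Rightarrow> _" and I
      using that
    proof (induction I rule: infinite_finite_induct)
      case (insert i I)
      then show ?case by (simp add: dd_add[OF s] polyfun_sum)
    qed (use dd_cst[OF s, of 0] in \<open>auto simp: cst_0\<close>)
    have "dd s (E f) = (\<Sum>i<k. dd s (Phi (f * b' i) * b i))"
      unfolding E_def by (rule dd_sum) (use pP in auto)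
    also have "\<dots> = (\<Sum>i<k. Phi (f * b' i) * dd s (b i))"
      using f b by (intro sum.cong refl dd_invariant_mult s invariant_Phi polyfun_mult) auto
    finally have "Phi (dd s f) = Phi (\<Sum>i<k. Phi (f * b' i) * dd s (b i))"
      using span[OF f] by simp
    also have "\<dots> = (\<Sum>i<k. Phi (Phi (f * b' i) * dd s (b i)))"
      using f b s by (intro Phi_sum polyfun_mult invariantD(1)[OF invariant_Phi] polyfun_dd) auto
    also have "\<dots> = (\<Sum>i<k. Phi (f * b' i) * Phi (dd s (b i)))"
      using f b s by (intro sum.cong refl Phi_invariant_mult invariant_Phi polyfun_mult polyfun_dd) auto
    also have "\<dots> = 0" by (simp add: Phi_b)
    finally show ?thesis .
  qed
  moreover have "\<forall>i<k. polyfun (b i) \<and> polyfun (b' i)" using b by simp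
  moreover have "\<forall>i<k. \<forall>j<k. Phi (b i * b' j) = (if i = j then 1 else 0)" using bb by simp
  moreover have "\<forall>f. polyfun f \<longrightarrow> f = (\<Sum>i<k. Phi (f * b' i) * b i)"
    using span unfolding E_def by (metis (no_types))
  ultimately show ?thesis by blast
qed

end

section \<open>Free algebras and the symmetric algebra\<close>

text \<open>Additive extension of a rule for single terms. The rule receives the coefficient as
  well, which lets relabelling, evaluation, restriction to generators and the action on the module
  all be instances.\<close>

definition lext :: "('g list \<Rightarrow> complex \<Rightarrow> 'b :: comm_monoid_add) \<Rightarrow> 'g free \<Rightarrow> 'b" where
  "lext \<phi> p = (\<Sum>w\<in>Poly_Mapping.keys p. \<phi> w (Poly_Mapping.lookup p w))"

lemma lext_add:
  assumes "\<And>w. \<phi> w 0 = 0" "\<And>w a b. \<phi> w (a + b) = \<phi> w a + \<phi> w b"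
  shows "lext \<phi> (p + q) = lext \<phi> p + lext \<phi> q"
  unfolding lext_def using setsum_keys_plus_distrib[of \<phi>] assms by blast

lemma lext_single: "\<phi> w 0 = 0 \<Longrightarrow> lext \<phi> (Poly_Mapping.single w a) = \<phi> w a"
  by (cases "a = 0") (auto simp: lext_def)

lemma single_mult: "Poly_Mapping.single w a * Poly_Mapping.single w' b = Poly_Mapping.single (w @ w') (a * b)"
  for a b :: complex
  by (simp add: mult_single plus_list_def)

lemma scalar_1: "scalar 1 = 1"
  by (simp add: scalar_def zero_list_def flip: single_one)

lemma scalar_0: "scalar 0 = 0" and scalar_add: "scalar (a + b) = scalar a + scalar b"
  and scalar_mult: "scalar (a * b) = scalar a * scalar b" and scalar_minus: "scalar (- a) = - scalar a"
  by (simp_all add: scalar_def single_add single_mult single_uminus)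

lemma free_induct [case_names single add]:
  assumes "\<And>w a. P (Poly_Mapping.single w a)" "\<And>p q. P p \<Longrightarrow> P q \<Longrightarrow> P (p + q)"
  shows "P (p :: 'g free)"
proof (induction p rule: update_induct)
  case const then show ?case using assms(1)[of "[]" 0] by simp
next
  case (update p w a)
  then have "Poly_Mapping.update w a p = p + Poly_Mapping.single w a"
    by (intro poly_mapping_eqI) (auto simp: lookup_update lookup_add lookup_single in_keys_iff when_def)
  then show ?case using update assms by simp
qed

lemma scalar_central: "scalar a * p = p * scalar a"
  by (induction p rule: free_induct) (simp_all add: scalar_def single_mult algebra_simps)

lemma single_Cons: "Poly_Mapping.single (g # w) a = gen g * Poly_Mapping.single w a"
  by (simp add: gen_def single_mult)

lemma free_gen_induct [case_names scalar gen add mult]: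
  assumes "\<And>a. P (scalar a)" "\<And>g. P (gen g)" "\<And>p q. P p \<Longrightarrow> P q \<Longrightarrow> P (p + q)"
    "\<And>p q. P p \<Longrightarrow> P q \<Longrightarrow> P (p * q)"
  shows "P (p :: 'g free)"
proof (induction p rule: free_induct)
  case (single w a)
  show ?case
  proof (induction w)
    case Nil then show ?case using assms(1)[of a] by (simp add: scalar_def)
  next
    case (Cons g w) then show ?case using assms(2,4) by (simp add: single_Cons)
  qed
qed (use assms in auto)

lemma lext_mult:
  fixes \<phi> :: "'g list \<Rightarrow> complex \<Rightarrow> 'b :: semiring_0"
  assumes "\<And>w. \<phi> w 0 = 0" "\<And>w a b. \<phi> w (a + b) = \<phi> w a + \<phi> w b"
    and "\<And>w w' a b. \<phi> (w @ w') (a * b) = \<phi> w a * \<phi> w' b"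
  shows "lext \<phi> (p * q) = lext \<phi> p * lext \<phi> q"
proof (induction p rule: free_induct)
  case (single w a)
  show ?case
  proof (induction q rule: free_induct)
    case (single w' b) then show ?case by (simp add: single_mult lext_single assms)
  next
    case (add p q) then show ?case by (simp add: lext_add assms distrib_left)
  qed
next
  case (add p p') then show ?case by (simp add: lext_add assms distrib_right)
qed

lemma relabel_lext: "relabel f = lext (\<lambda>w. Poly_Mapping.single (map f w))"
  by (simp add: fun_eq_iff relabel_def lext_def)

lemma relabel_add: "relabel f (p + q) = relabel f p + relabel f q"
  and relabel_mult: "relabel f (p * q) = relabel f p * relabel f q"
  and relabel_single: "relabel f (Poly_Mapping.single w a) = Poly_Mapping.single (map f w) a"
  unfolding relabel_lext by (auto intro!: lext_add lext_mult lext_single simp: single_add single_mult)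

lemma relabel_gen: "relabel f (gen x) = gen (f x)"
  and relabel_scalar: "relabel f (scalar a) = scalar a"
  by (simp_all add: gen_def scalar_def relabel_single)

lemma relabel_0: "relabel f 0 = 0" and relabel_1: "relabel f 1 = 1"
  using relabel_scalar[of f 0] relabel_scalar[of f 1] by (simp_all add: scalar_0 scalar_1)

lemma relabel_uminus: "relabel f (- p) = - relabel f p"
  using relabel_add[of f p "- p"] by (simp add: relabel_0 eq_neg_iff_add_eq_0 add.commute)

lemma relabel_diff: "relabel f (p - q) = relabel f p - relabel f q"
  using relabel_add[of f p "- q"] by (simp add: relabel_uminus)

lemma relabel_relabel: "relabel f (relabel g p) = relabel (\<lambda>x. f (g x)) p"
  by (induction p rule: free_gen_induct)
     (simp_all add: relabel_gen relabel_scalar relabel_add relabel_mult)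

lemma relabel_id: "relabel (\<lambda>x. x) p = p"
  by (induction p rule: free_gen_induct)
     (simp_all add: relabel_gen relabel_scalar relabel_add relabel_mult)

text \<open>Two-sided ideals of a type-class ring, for calculation with the ordinary ring
  simplification; \<open>genideal_free_subset\<close> and \<open>is_ideal_genideal\<close> connect
  them with the ideals of \<open>free_algebra\<close>.\<close>

definition is_ideal :: "'r :: ring_1 set \<Rightarrow> bool" where
  "is_ideal I \<longleftrightarrow> 0 \<in> I \<and> (\<forall>a\<in>I. \<forall>b\<in>I. a + b \<in> I) \<and> (\<forall>a\<in>I. \<forall>x. x * a \<in> I \<and> a * x \<in> I)"

context
  fixes I :: "'r :: ring_1 set"
  assumes I: "is_ideal I"
begin

lemma ideal_0: "0 \<in> I" using I by (simp add: is_ideal_def)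
lemma ideal_add: "a \<in> I \<Longrightarrow> b \<in> I \<Longrightarrow> a + b \<in> I" using I by (simp add: is_ideal_def)
lemma ideal_lmult: "a \<in> I \<Longrightarrow> x * a \<in> I" using I by (simp add: is_ideal_def)
lemma ideal_rmult: "a \<in> I \<Longrightarrow> a * x \<in> I" using I by (simp add: is_ideal_def)
lemma ideal_uminus: "a \<in> I \<Longrightarrow> - a \<in> I" using ideal_lmult[of a "-1"] by simp
lemma ideal_diff: "a \<in> I \<Longrightarrow> b \<in> I \<Longrightarrow> a - b \<in> I"
  using ideal_add[of a "- b"] ideal_uminus by simp
end

lemma carrier_free_algebra: "p \<in> carrier (free_algebra G) \<longleftrightarrow> (\<forall>w \<in> Poly_Mapping.keys p. set w \<subseteq> G)"
  and mult_free_algebra: "p \<otimes>\<^bsub>free_algebra G\<^esub> q = p * q"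
  and add_free_algebra: "p \<oplus>\<^bsub>free_algebra G\<^esub> q = p + q"
  and one_free_algebra: "\<one>\<^bsub>free_algebra G\<^esub> = 1"
  and zero_free_algebra: "\<zero>\<^bsub>free_algebra G\<^esub> = 0"
  by (simp_all add: free_algebra_def)

lemmas free_algebra_simps = mult_free_algebra add_free_algebra one_free_algebra zero_free_algebra

lemma a_inv_free_algebra:
  assumes "p \<in> carrier (free_algebra G)" shows "\<ominus>\<^bsub>free_algebra G\<^esub> p = - p"
proof -
  interpret ring "free_algebra G" by (rule ring_free_algebra)
  have "- p \<in> carrier (free_algebra G)" using assms by (simp add: carrier_free_algebra)
  then show ?thesis
    using assms by (intro minus_equality) (simp_all add: free_algebra_simps)
qed

lemma ideal_Int_carrier:
  assumes "is_ideal I"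
  shows "ideal (I \<inter> carrier (free_algebra G)) (free_algebra G)"
proof -
  interpret ring "free_algebra G" by (rule ring_free_algebra)
  show ?thesis
  proof (rule idealI)
    show "subgroup (I \<inter> carrier (free_algebra G)) (add_monoid (free_algebra G))"
    proof
      fix x assume "x \<in> I \<inter> carrier (free_algebra G)"
      then show "inv\<^bsub>add_monoid (free_algebra G)\<^esub> x \<in> I \<inter> carrier (free_algebra G)"
        using a_inv_free_algebra[of x G] a_inv_closed[of x] ideal_uminus[OF assms, of x]
        by (simp add: a_inv_def)
    next
      fix x y assume "x \<in> I \<inter> carrier (free_algebra G)" "y \<in> I \<inter> carrier (free_algebra G)"
      then show "x \<otimes>\<^bsub>add_monoid (free_algebra G)\<^esub> y \<in> I \<inter> carrier (free_algebra G)"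
        using add.m_closed[of x y] ideal_add[OF assms, of x y] by (simp add: add_free_algebra)
    qed (use ideal_0[OF assms] zero_closed in \<open>auto simp: zero_free_algebra\<close>)
  next
    fix a x assume "a \<in> I \<inter> carrier (free_algebra G)" "x \<in> carrier (free_algebra G)"
    then show "x \<otimes>\<^bsub>free_algebra G\<^esub> a \<in> I \<inter> carrier (free_algebra G)"
      "a \<otimes>\<^bsub>free_algebra G\<^esub> x \<in> I \<inter> carrier (free_algebra G)"
      using m_closed[of x a] m_closed[of a x] ideal_lmult[OF assms] ideal_rmult[OF assms]
      by (auto simp: mult_free_algebra)
  qed (rule ring_free_algebra)
qed

lemma genideal_free_subset:
  assumes "is_ideal I" "S \<subseteq> I" "S \<subseteq> carrier (free_algebra G)"
  shows "genideal (free_algebra G) S \<subseteq> I"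
  using ring.genideal_minimal[OF ring_free_algebra ideal_Int_carrier[OF assms(1)], of S G] assms by blast

lemma is_ideal_genideal: "is_ideal (genideal (free_algebra UNIV) S)"
  and genideal_free_gen: "S \<subseteq> genideal (free_algebra UNIV) S"
proof -
  have U: "carrier (free_algebra UNIV) = (UNIV :: 'a free set)"
    by (auto simp: carrier_free_algebra)
  interpret ideal "genideal (free_algebra UNIV) S" "free_algebra UNIV"
    by (rule ring.genideal_ideal[OF ring_free_algebra]) (simp add: U)
  show "is_ideal (genideal (free_algebra UNIV) S)"
    unfolding is_ideal_def
    using zero_closed a_closed I_l_closed I_r_closed additive_subgroup.zero_closed
    by (auto simp: free_algebra_simps U additive_subgroup.a_closed[OF additive_subgroup_axioms, unfolded add_free_algebra]
        additive_subgroup.zero_closed[OF additive_subgroup_axioms, unfolded zero_free_algebra])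
  show "S \<subseteq> genideal (free_algebra UNIV) S"
    using ring.genideal_self[OF ring_free_algebra, of S UNIV] by (simp add: U)
qed

lemma is_ideal_symmetric_ideal: "is_ideal symmetric_ideal"
  and symmetric_ideal_gen: "linear_relators id \<union> commutator_relators id \<subseteq> symmetric_ideal"
  unfolding symmetric_ideal_def using is_ideal_genideal genideal_free_gen by blast+

section \<open>Tensors evaluated as polynomial functions\<close>

definition ev :: "(complex ^ 'n) free \<Rightarrow> complex ^ 'n \<Rightarrow> complex" where
  "ev = lext (\<lambda>w a. cst a * prod_list (map lf w))"

lemma ev_add: "ev (p + q) = ev p + ev q"
  unfolding ev_def by (rule lext_add) (simp_all add: cst_0 cst_add distrib_right)

lemma ev_mult: "ev (p * q) = ev p * ev q"
  unfolding ev_def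
proof (rule lext_mult)
  fix w w' :: "(complex ^ 'n) list" and a b :: complex
  show "cst (a * b) * prod_list (map lf (w @ w')) =
      cst a * prod_list (map lf w) * (cst b * prod_list (map lf w'))"
    unfolding map_append prod_list.append cst_mult by (simp only: ac_simps)
qed (simp_all add: cst_0 cst_add distrib_right)

lemma ev_gen: "ev (gen x) = lf x" and ev_scalar: "ev (scalar a) = cst a"
  unfolding ev_def gen_def scalar_def by (simp_all add: lext_single cst_0 cst_1)

lemma ev_uminus: "ev (- p) = - ev p"
proof -
  have "ev (- p) + ev p = 0" using ev_add[of "- p" p, symmetric] ev_scalar[of 0] by (simp add: scalar_0 cst_0)
  then show ?thesis by (simp add: eq_neg_iff_add_eq_0)
qed

lemma ev_diff: "ev (p - q) = ev p - ev q"
  using ev_add[of p "- q"] by (simp add: ev_uminus)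

lemma ev_0: "ev 0 = 0" using ev_scalar[of 0] by (simp add: scalar_0 cst_0)

lemma polyfun_ev: "polyfun (ev p)"
  by (induction p rule: free_gen_induct) (simp_all add: ev_gen ev_scalar ev_add ev_mult polyfun.intros)

lemma ev_surj: "polyfun f \<Longrightarrow> \<exists>p. ev p = f"
proof (induction rule: polyfun.induct)
  case (polyfun_cst a) then show ?case using ev_scalar by blast
next
  case (polyfun_lf x) then show ?case using ev_gen by blast
next
  case (polyfun_add f g) then show ?case using ev_add by metis
next
  case (polyfun_mult f g) then show ?case using ev_mult by metis
qed

definition lift :: "(complex ^ 'n \<Rightarrow> complex) \<Rightarrow> (complex ^ 'n) free" where
  "lift f = (SOME p. ev p = f)"

lemma ev_lift: "polyfun f \<Longrightarrow> ev (lift f) = f"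
  unfolding lift_def using someI_ex[OF ev_surj] .

text \<open>Dedekind's independence of characters, for functions multiplicative under the
  componentwise product of vectors. Subtracting \<open>g a\<close> times the relation at
  \<open>v\<close> from the relation at \<open>a * v\<close> removes \<open>g\<close> and multiplies
  the coefficient of a given \<open>f\<close> by \<open>f a - g a\<close>, nonzero for suitable
  \<open>a\<close>.\<close>

lemma dedekind:
  fixes F :: "(complex ^ 'n \<Rightarrow> complex) set"
  assumes "finite F" "\<And>f. f \<in> F \<Longrightarrow> f \<noteq> 0" "\<And>f v w. f \<in> F \<Longrightarrow> f (v * w) = f v * f w"
    and "\<And>v. (\<Sum>f\<in>F. c f * f v) = 0"
  shows "\<forall>f\<in>F. c f = 0"
  using assms
proof (induction F arbitrary: c)
  case (insert g F)
  have cF: "c f = 0" if f: "f \<in> F" for f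
  proof -
    have "f \<noteq> g" using f insert.hyps by auto
    then obtain a where a: "f a \<noteq> g a" by blast
    have "(\<Sum>f\<in>F. (c f * (f a - g a)) * f v) = 0" for v
    proof -
      have "(\<Sum>f\<in>F. (c f * (f a - g a)) * f v) =
          (\<Sum>f\<in>insert g F. c f * f (a * v)) - g a * (\<Sum>f\<in>insert g F. c f * f v)"
      proof -
        have "(\<Sum>f\<in>F. (c f * (f a - g a)) * f v) = (\<Sum>f\<in>F. c f * f (a * v) - g a * (c f * f v))"
          using insert.prems(2) by (intro sum.cong refl) (simp add: algebra_simps)
        then show ?thesis
          using insert.hyps insert.prems(2)[of g a v]
          by (simp add: sum_subtractf sum_distrib_left distrib_left)
      qed
      then show ?thesis using insert.prems(3) by simp
    qed
    then have "\<forall>f\<in>F. c f * (f a - g a) = 0"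
      using insert.prems by (intro insert.IH) auto
    then show ?thesis using a f by auto
  qed
  obtain v where v: "g v \<noteq> 0" using insert.prems(1)[of g] by (auto simp: fun_eq_iff fun_apply)
  have "c g * g v = 0" using insert.prems(3)[of v] insert.hyps cF by simp
  then show ?case using cF v by auto
qed simp

text \<open>The exponent of the coordinate \<open>i\<close> is read off from the value, a power of
  2, at the vector with entry 2 at \<open>i\<close> and 1 elsewhere.\<close>

lemma mon_eq_imp: "mon xs = mon ys \<Longrightarrow> mset xs = mset ys" for xs ys :: "'n :: finite list"
proof (rule multiset_eqI)
  fix i assume eq: "mon xs = mon ys"
  define v :: "complex ^ 'n" where "v = (\<chi> j. if j = i then 2 else 1)"
  have "mon zs v = 2 ^ count (mset zs) i" for zs
    by (induction zs) (auto simp: mon_def v_def)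
  then have "(2 :: complex) ^ count (mset xs) i = 2 ^ count (mset ys) i" using eq by metis
  then have "of_nat (2 ^ count (mset xs) i) = (of_nat (2 ^ count (mset ys) i) :: complex)" by simp
  then have "(2 :: nat) ^ count (mset xs) i = 2 ^ count (mset ys) i" by (simp only: of_nat_eq_iff)
  then show "count (mset xs) i = count (mset ys) i" by simp
qed

lemma mon_mult_arg: "mon xs (v * w) = mon xs v * mon xs w"
  by (induction xs) (auto simp: mon_def)

definition wgen :: "'n list \<Rightarrow> (complex ^ 'n) free" where
  "wgen xs = prod_list (map (\<lambda>i. gen (axis i 1)) xs)"

lemma wgen_Cons: "wgen (i # xs) = gen (axis i 1) * wgen xs"
  and wgen_append: "wgen (xs @ ys) = wgen xs * wgen ys"
  by (simp_all add: wgen_def)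

lemma ev_wgen: "ev (wgen xs) = mon xs"
proof (induction xs)
  case Nil then show ?case using ev_scalar[of 1] by (simp add: wgen_def mon_simps scalar_1 cst_1)
next
  case (Cons i xs) then show ?case by (simp add: wgen_Cons ev_mult ev_gen mon_simps)
qed

lemma wgen_commute: "wgen xs * gen (axis i 1) - gen (axis i 1) * wgen xs \<in> symmetric_ideal"
proof (induction xs)
  case Nil then show ?case using ideal_0[OF is_ideal_symmetric_ideal] by (simp add: wgen_def)
next
  case (Cons j xs)
  have "gen (axis j 1) * gen (axis i 1) - gen (axis i 1) * gen (axis j 1) \<in> symmetric_ideal"
    using symmetric_ideal_gen unfolding commutator_relators_def by force
  then have "gen (axis j 1) * (wgen xs * gen (axis i 1) - gen (axis i 1) * wgen xs) +
     (gen (axis j 1) * gen (axis i 1) - gen (axis i 1) * gen (axis j 1)) * wgen xs \<in> symmetric_ideal"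
    using Cons is_ideal_symmetric_ideal by (intro ideal_add ideal_lmult ideal_rmult)
  then show ?case by (simp add: wgen_Cons algebra_simps)
qed

lemma wgen_mset: "mset xs = mset ys \<Longrightarrow> wgen xs - wgen ys \<in> symmetric_ideal"
proof (induction xs arbitrary: ys)
  case Nil then show ?case using ideal_0[OF is_ideal_symmetric_ideal] by simp
next
  case (Cons i xs)
  then have "i \<in> set ys" by (metis list.set_intros(1) mset_eq_setD)
  then obtain as bs where ys: "ys = as @ i # bs" by (meson split_list)
  then have "mset xs = mset (as @ bs)" using Cons.prems by simp
  then have "wgen xs - wgen (as @ bs) \<in> symmetric_ideal" by (rule Cons.IH)
  then have "gen (axis i 1) * (wgen xs - wgen (as @ bs)) \<in> symmetric_ideal"
    by (rule ideal_lmult[OF is_ideal_symmetric_ideal])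
  from ideal_diff[OF is_ideal_symmetric_ideal this
      ideal_rmult[OF is_ideal_symmetric_ideal wgen_commute[of as i]], of "wgen bs"]
  show ?case by (simp add: ys wgen_Cons wgen_append algebra_simps)
qed

text \<open>Each letter is expanded in the standard basis by the linear relators. The resulting
  words are neither sorted nor collected; that is left to \<open>symmetric_ideal_eq\<close>.\<close>

lemma symmetric_normal_form:
  "\<exists>L. p - (\<Sum>(a, xs)\<leftarrow>L. scalar a * wgen xs) \<in> symmetric_ideal"
proof -
  let ?N = "\<lambda>L. \<Sum>(a, xs)\<leftarrow>L. scalar a * wgen xs"
  let ?X = "\<lambda>p. \<exists>L. p - ?N L \<in> symmetric_ideal"
  note S = is_ideal_symmetric_ideal
  have 1: "?X (p + q)" if "?X p" "?X q" for p q
  proof -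
    obtain L M where "p - ?N L \<in> symmetric_ideal" "q - ?N M \<in> symmetric_ideal" using \<open>?X p\<close> \<open>?X q\<close> by blast
    then have "(p - ?N L) + (q - ?N M) \<in> symmetric_ideal" by (rule ideal_add[OF S])
    then show ?thesis by (intro exI[of _ "L @ M"]) (simp add: algebra_simps)
  qed
  have 2: "?X (scalar b * gen (axis i 1) * p)" if "?X p" for p b i
  proof -
    obtain L where L: "p - ?N L \<in> symmetric_ideal" using \<open>?X p\<close> by blast
    have "scalar b * gen (axis i 1) * ?N L = ?N (map (\<lambda>(a, xs). (b * a, i # xs)) L)"
    proof (induction L)
      case (Cons x L)
      have "gen (axis i 1) * (scalar (fst x) * wgen (snd x)) = scalar (fst x) * (gen (axis i 1) * wgen (snd x))"
        by (metis mult.assoc scalar_central)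
      then show ?case
        using Cons by (simp add: split_beta distrib_left scalar_mult wgen_Cons mult.assoc)
    qed simp
    then show ?thesis using ideal_lmult[OF S L, of "scalar b * gen (axis i 1)"]
      by (intro exI[of _ "map (\<lambda>(a, xs). (b * a, i # xs)) L"]) (simp only: right_diff_distrib)
  qed
  have 3: "?X p" if "p - q \<in> symmetric_ideal" "?X q" for p q
  proof -
    obtain L where L: "q - ?N L \<in> symmetric_ideal" using \<open>?X q\<close> by blast
    then have "(p - q) + (q - ?N L) \<in> symmetric_ideal" using that by (intro ideal_add[OF S])
    then show ?thesis by (intro exI[of _ L]) simp
  qed
  have zero: "?X 0" by (rule exI[of _ "[]"]) (simp add: ideal_0[OF S])
  have lin: "gen x - (\<Sum>i\<in>UNIV. scalar (x $ i) * gen (axis i 1)) \<in> symmetric_ideal" for x :: "complex ^ 'a"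
  proof -
    have add: "gen (x + y) - (gen x + gen y) \<in> symmetric_ideal" for x y :: "complex ^ 'a"
      using symmetric_ideal_gen unfolding linear_relators_def by force
    have sc: "gen (a *s x) - scalar a * gen x \<in> symmetric_ideal" for a and x :: "complex ^ 'a"
      using symmetric_ideal_gen unfolding linear_relators_def by force
    have z: "gen (0 :: complex ^ 'a) \<in> symmetric_ideal" using sc[of 0 0] by (simp add: scalar_0)
    have "gen (\<Sum>i\<in>I. x $ i *s axis i 1) - (\<Sum>i\<in>I. scalar (x $ i) * gen (axis i 1)) \<in> symmetric_ideal"
      if "finite I" for I :: "'a set"
      using that
    proof (induction I)
      case empty then show ?case using z by simp
    next
      case (insert i I)
      have "(gen (x $ i *s axis i 1 + (\<Sum>i\<in>I. x $ i *s axis i 1)) -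
          (gen (x $ i *s axis i 1) + gen (\<Sum>i\<in>I. x $ i *s axis i 1))) +
        ((gen (x $ i *s axis i 1) - scalar (x $ i) * gen (axis i 1)) +
         (gen (\<Sum>i\<in>I. x $ i *s axis i 1) - (\<Sum>i\<in>I. scalar (x $ i) * gen (axis i 1)))) \<in> symmetric_ideal"
        using insert add sc by (intro ideal_add[OF S])
      then show ?case using insert.hyps by (simp add: algebra_simps)
    qed
    from this[of UNIV] show ?thesis by (simp add: basis_expansion)
  qed
  show ?thesis
  proof (induction p rule: free_induct)
    case (single w a)
    show ?case
    proof (induction w)
      case Nil show ?case
        by (rule exI[of _ "[(a, [])]"]) (simp add: wgen_def scalar_def ideal_0[OF S])
    next
      case (Cons x w)
      have "?X (\<Sum>i\<in>I. scalar (x $ i) * gen (axis i 1) * Poly_Mapping.single w a)" if "finite I" for I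
        using that
      proof (induction I)
        case empty then show ?case using zero by simp
      next
        case (insert i I)
        show ?case
          unfolding sum.insert[OF insert.hyps] by (rule 1[OF 2[OF Cons] insert.IH])
      qed
      then have "?X ((\<Sum>i\<in>UNIV. scalar (x $ i) * gen (axis i 1)) * Poly_Mapping.single w a)"
        by (simp only: sum_distrib_right finite)
      then show ?case
        using ideal_rmult[OF S lin[of x], of "Poly_Mapping.single w a"]
        by (intro 3[of "Poly_Mapping.single (x # w) a"]) (auto simp: single_Cons left_diff_distrib)
    qed
  qed (rule 1)
qed

lemma symmetric_ideal_subset: "symmetric_ideal \<subseteq> {p. ev p = 0}"
proof -
  have "is_ideal {p :: (complex ^ 'n) free. ev p = 0}"
    by (auto simp: is_ideal_def ev_add ev_mult ev_0)
  moreover have "linear_relators id \<union> commutator_relators id \<subseteq> {p :: (complex ^ 'n) free. ev p = 0}"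
    by (auto simp: linear_relators_def commutator_relators_def ev_diff ev_add ev_mult ev_gen ev_scalar
        lf_add lf_scale)
  ultimately show "symmetric_ideal \<subseteq> {p :: (complex ^ 'n) free. ev p = 0}"
    unfolding symmetric_ideal_def by (rule genideal_free_subset) (auto simp: carrier_free_algebra)
qed

text \<open>A tensor is reduced to a combination of one chosen word for each monomial function;
  words with equal functions agree modulo the ideal, because their letters agree up to order. If the
  tensor evaluates to zero, independence of the monomials makes all coefficients vanish.\<close>

lemma symmetric_ideal_eq: "symmetric_ideal = {p. ev p = 0}"
proof (rule equalityI[OF symmetric_ideal_subset])
  note S = is_ideal_symmetric_ideal
  show "{p :: (complex ^ 'n) free. ev p = 0} \<subseteq> symmetric_ideal"
  proof
    fix p :: "(complex ^ 'n) free" assume "p \<in> {p. ev p = 0}"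
    then have p: "ev p = 0" by simp
    define rep :: "(complex ^ 'n \<Rightarrow> complex) \<Rightarrow> 'n list" where "rep f = (SOME xs. mon xs = f)" for f
    have rep: "mon (rep (mon xs)) = mon xs" for xs unfolding rep_def by (rule someI) simp
    obtain L where L: "p - (\<Sum>(a, xs)\<leftarrow>L. scalar a * wgen xs) \<in> symmetric_ideal"
      using symmetric_normal_form by blast
    have "\<exists>F c. finite F \<and> F \<subseteq> range mon \<and>
      (\<Sum>(a, xs)\<leftarrow>L. scalar a * wgen xs) - (\<Sum>f\<in>F. scalar (c f) * wgen (rep f)) \<in> symmetric_ideal"
    proof (induction L)
      case Nil show ?case by (rule exI[of _ "{}"]) (simp add: ideal_0[OF S])
    next
      case (Cons x L)
      obtain a xs where x: "x = (a, xs)" by (cases x)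
      obtain F c where F: "finite F" "F \<subseteq> range mon"
        "(\<Sum>(a, xs)\<leftarrow>L. scalar a * wgen xs) - (\<Sum>f\<in>F. scalar (c f) * wgen (rep f)) \<in> symmetric_ideal"
        using Cons by blast
      let ?m = "mon xs"
      \<comment> \<open>The new coefficient is added if the monomial already occurs; outside
        \<open>F\<close> the value of \<open>c\<close> is arbitrary and counts as zero.\<close>
      define c' where "c' = c(?m := a + (if ?m \<in> F then c ?m else 0))"
      have "(\<Sum>f\<in>insert ?m F. scalar (c' f) * wgen (rep f)) =
          scalar (c' ?m) * wgen (rep ?m) + (\<Sum>f\<in>F - {?m}. scalar (c f) * wgen (rep f))"
        using F(1) by (subst sum.insert_remove) (auto simp: c'_def intro!: sum.cong)
      also have "\<dots> = scalar a * wgen (rep ?m) + (\<Sum>f\<in>F. scalar (c f) * wgen (rep f))"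
        using F(1) by (cases "?m \<in> F") (simp_all add: c'_def scalar_add distrib_right sum.remove[of F ?m])
      finally have eq: "(\<Sum>f\<in>insert ?m F. scalar (c' f) * wgen (rep f)) =
          scalar a * wgen (rep ?m) + (\<Sum>f\<in>F. scalar (c f) * wgen (rep f))" .
      have "scalar a * (wgen xs - wgen (rep ?m)) +
        ((\<Sum>(a, xs)\<leftarrow>L. scalar a * wgen xs) - (\<Sum>f\<in>F. scalar (c f) * wgen (rep f))) \<in> symmetric_ideal"
        using F(3) by (intro ideal_add[OF S] ideal_lmult[OF S] wgen_mset mon_eq_imp) (simp_all add: rep)
      then show ?case
        using F eq by (intro exI[of _ "insert ?m F"] exI[of _ c']) (simp add: x algebra_simps)
    qed
    then obtain F c where F: "finite F" "F \<subseteq> range mon" and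
      Fc: "(\<Sum>(a, xs)\<leftarrow>L. scalar a * wgen xs) - (\<Sum>f\<in>F. scalar (c f) * wgen (rep f)) \<in> symmetric_ideal"
      by blast
    have pF: "p - (\<Sum>f\<in>F. scalar (c f) * wgen (rep f)) \<in> symmetric_ideal"
      using ideal_add[OF S L Fc] by simp
    then have "ev p = ev (\<Sum>f\<in>F. scalar (c f) * wgen (rep f))"
      using symmetric_ideal_subset by (force simp: ev_diff)
    also have "\<dots> = (\<Sum>f\<in>F. ev (scalar (c f) * wgen (rep f)))"
      using F(1) by (induction F) (simp_all add: ev_0 ev_add)
    also have "\<dots> = (\<Sum>f\<in>F. cst (c f) * f)"
      using F(2) rep by (intro sum.cong refl) (auto simp: ev_mult ev_scalar ev_wgen)
    finally have "(\<Sum>f\<in>F. cst (c f) * f) = 0" using p by simp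
    then have "(\<Sum>f\<in>F. c f * f v) = 0" for v
      by (simp add: fun_eq_iff fun_apply)
    moreover have "f \<noteq> 0" if f: "f \<in> F" for f
    proof -
      obtain xs where "f = mon xs" using f F(2) by blast
      moreover have "mon xs (\<chi> i. 1) = 1" by (induction xs) (auto simp: mon_def)
      ultimately show ?thesis by (metis zero_fun_apply zero_neq_one)
    qed
    moreover have "f (v * w) = f v * f w" if "f \<in> F" for f v w
      using that F(2) mon_mult_arg by blast
    ultimately have "\<forall>f\<in>F. c f = 0" using dedekind[OF F(1)] by blast
    then have "(\<Sum>f\<in>F. scalar (c f) * wgen (rep f)) = 0" by (simp add: scalar_0)
    then show "p \<in> symmetric_ideal" using pF by simp
  qed
qed

text \<open>The tensors whose relabelling falls into \<open>J\<close> form an ideal containing the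
  relators of the symmetric algebra, hence all tensors that evaluate to zero.\<close>

lemma relabel_symmetric_ideal:
  fixes \<iota> :: "complex ^ 'n \<Rightarrow> 'g"
  assumes J: "is_ideal J" and sub: "linear_relators \<iota> \<union> commutator_relators \<iota> \<subseteq> J"
    and p: "ev p = 0"
  shows "relabel \<iota> p \<in> J"
proof -
  let ?I = "{p. relabel \<iota> p \<in> J}"
  have "is_ideal ?I"
    by (auto simp: is_ideal_def relabel_0 relabel_add relabel_mult ideal_0[OF J] ideal_add[OF J]
        ideal_lmult[OF J] ideal_rmult[OF J])
  moreover have "linear_relators id \<union> commutator_relators id \<subseteq> ?I"
  proof
    fix x :: "(complex ^ 'n) free" assume "x \<in> linear_relators id \<union> commutator_relators id"
    then have "relabel \<iota> x \<in> linear_relators \<iota> \<union> commutator_relators \<iota>"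
      unfolding linear_relators_def commutator_relators_def
      by (elim UnE CollectE exE conjE; hypsubst)
         (simp_all add: relabel_diff relabel_add relabel_mult relabel_gen relabel_scalar, blast+)
    then show "x \<in> ?I" using sub by blast
  qed
  ultimately have "symmetric_ideal \<subseteq> ?I"
    unfolding symmetric_ideal_def by (rule genideal_free_subset) (auto simp: carrier_free_algebra)
  then show ?thesis using p by (auto simp: symmetric_ideal_eq)
qed

lemma symmetric_coset:
  "symmetric_ideal +>\<^bsub>free_algebra UNIV\<^esub> p = {q. ev q = ev p}"
proof -
  have "symmetric_ideal +>\<^bsub>free_algebra UNIV\<^esub> p = {h + p | h. ev h = 0}"
    by (auto simp: a_r_coset_def' symmetric_ideal_eq add_free_algebra)
  also have "\<dots> = {q. ev q = ev p}"
  proof (intro equalityI subsetI)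
    fix q assume "q \<in> {q. ev q = ev p}"
    then show "q \<in> {h + p | h. ev h = 0}"
      by (intro CollectI exI[of _ "q - p"]) (simp add: ev_diff)
  qed (auto simp: ev_add)
  finally show ?thesis .
qed

lemma carrier_symmetric_algebra: "carrier symmetric_algebra = {{q. ev q = ev p} | p. True}"
  unfolding symmetric_algebra_def FactRing_def A_RCOSETS_def'
  by (auto simp: symmetric_coset carrier_free_algebra)

text \<open>The cosets are the fibres of \<open>ev\<close>, on which \<open>\<phi> w\<close> acts by
  substitution into the function. The right inverse \<open>\<psi> w\<close> ensures that relabelling
  hits the whole fibre, so that equality of sets becomes invariance of one function.\<close>

lemma symmetric_invariants_eq:
  assumes \<phi>: "\<And>w x v. w \<in> W \<Longrightarrow> pairing v (\<phi> w x) = pairing (A w *v v) x"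
    and \<psi>: "\<And>w x. w \<in> W \<Longrightarrow> \<phi> w (\<psi> w x) = x"
    and B: "\<And>w. w \<in> W \<Longrightarrow> A w ** B w = mat 1"
  shows "symmetric_invariants W \<phi> =
    {{q. ev q = f} | f. polyfun f \<and> (\<forall>w\<in>W. (\<lambda>v. f (A w *v v)) = f)}"
proof -
  have ev_relabel: "ev (relabel (\<phi> w) q) = (\<lambda>v. ev q (A w *v v))" if "w \<in> W" for w q
  proof (induction q rule: free_gen_induct)
    case (gen x)
    then show ?case using \<phi>[OF that] by (simp add: relabel_gen ev_gen lf_def fun_eq_iff)
  qed (simp_all add: relabel_scalar relabel_add relabel_mult ev_scalar ev_add ev_mult fun_eq_iff fun_apply)
  have eq: "relabel (\<phi> w) ` {q. ev q = f} = {q. ev q = f} \<longleftrightarrow> (\<lambda>v. f (A w *v v)) = f"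
    if w: "w \<in> W" and f: "polyfun f" for w f
  proof
    assume "relabel (\<phi> w) ` {q. ev q = f} = {q. ev q = f}"
    then have "ev (relabel (\<phi> w) (lift f)) = f" using ev_lift[OF f] by blast
    then show "(\<lambda>v. f (A w *v v)) = f" by (simp add: ev_relabel[OF w] ev_lift[OF f])
  next
    assume fixf: "(\<lambda>v. f (A w *v v)) = f"
    show "relabel (\<phi> w) ` {q. ev q = f} = {q. ev q = f}"
    proof (intro equalityI subsetI)
      fix q assume q: "q \<in> {q. ev q = f}"
      have q': "relabel (\<phi> w) (relabel (\<psi> w) q) = q"
        by (simp add: relabel_relabel \<psi>[OF w] relabel_id)
      then have "(\<lambda>v. ev (relabel (\<psi> w) q) (A w *v v)) = f" using ev_relabel[OF w, of "relabel (\<psi> w) q"] q by simp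
      then have "ev (relabel (\<psi> w) q) (A w *v v) = f (A w *v v)" for v
        using fixf by (simp add: fun_eq_iff)
      from this[of "B w *v v" for v] have "ev (relabel (\<psi> w) q) = f"
        by (simp add: fun_eq_iff matrix_vector_mul_assoc B[OF w])
      then show "q \<in> relabel (\<phi> w) ` {q. ev q = f}" using q' by force
    next
      fix q assume "q \<in> relabel (\<phi> w) ` {q. ev q = f}"
      then show "q \<in> {q. ev q = f}" using fixf by (auto simp: ev_relabel[OF w])
    qed
  qed
  show ?thesis
  proof (intro equalityI subsetI)
    fix X assume X: "X \<in> symmetric_invariants W \<phi>"
    then obtain p where p: "X = {q. ev q = ev p}"
      by (auto simp: symmetric_invariants_def carrier_symmetric_algebra)
    then show "X \<in> {{q. ev q = f} | f. polyfun f \<and> (\<forall>w\<in>W. (\<lambda>v. f (A w *v v)) = f)}"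
      using X eq polyfun_ev by (auto simp: symmetric_invariants_def intro!: exI[of _ "ev p"])
  next
    fix X assume "X \<in> {{q. ev q = f} | f. polyfun f \<and> (\<forall>w\<in>W. (\<lambda>v. f (A w *v v)) = f)}"
    then obtain f where f: "X = {q. ev q = f}" "polyfun f" "\<forall>w\<in>W. (\<lambda>v. f (A w *v v)) = f" by blast
    then show "X \<in> symmetric_invariants W \<phi>"
      using eq ev_lift[OF f(2)] by (auto simp: symmetric_invariants_def carrier_symmetric_algebra
          intro!: exI[of _ "lift f"])
  qed
qed

section \<open>Congruence modulo an ideal\<close>

text \<open>Congruence modulo an ideal replaces the quotient ring during the computations, since
  maps that involve a choice, such as \<open>emb\<close>, are additive and multiplicative only up to
  the ideal.\<close>

locale ring_cong =
  fixes J :: "'r :: ring_1 set"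
  assumes J: "is_ideal J"
begin

definition cong :: "'r \<Rightarrow> 'r \<Rightarrow> bool" (infix "\<doteq>" 50) where
  "p \<doteq> q \<longleftrightarrow> p - q \<in> J"

lemma cong_refl [simp, intro]: "p \<doteq> p"
  by (simp add: cong_def ideal_0[OF J])

lemma cong_sym: "p \<doteq> q \<Longrightarrow> q \<doteq> p"
  using ideal_uminus[OF J, of "p - q"] by (simp add: cong_def)

lemma cong_trans [trans]: "p \<doteq> q \<Longrightarrow> q \<doteq> r \<Longrightarrow> p \<doteq> r"
  using ideal_add[OF J, of "p - q" "q - r"] by (simp add: cong_def)

lemma cong_eq_trans [trans]: "p \<doteq> q \<Longrightarrow> q = r \<Longrightarrow> p \<doteq> r"
  and eq_cong_trans [trans]: "p = q \<Longrightarrow> q \<doteq> r \<Longrightarrow> p \<doteq> r" by simp_all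

lemma cong_add: "p \<doteq> q \<Longrightarrow> p' \<doteq> q' \<Longrightarrow> p + p' \<doteq> q + q'"
  using ideal_add[OF J, of "p - q" "p' - q'"] by (simp add: cong_def algebra_simps)

lemma cong_uminus: "p \<doteq> q \<Longrightarrow> - p \<doteq> - q"
  using ideal_uminus[OF J, of "p - q"] by (simp add: cong_def)

lemma cong_diff: "p \<doteq> q \<Longrightarrow> p' \<doteq> q' \<Longrightarrow> p - p' \<doteq> q - q'"
  using cong_add[of p q "- p'" "- q'"] cong_uminus[of p' q'] by simp

lemma cong_mult: "p \<doteq> q \<Longrightarrow> p' \<doteq> q' \<Longrightarrow> p * p' \<doteq> q * q'"
  using ideal_add[OF J ideal_rmult[OF J, of "p - q" p'] ideal_lmult[OF J, of "p' - q'" q]]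
  by (simp add: cong_def algebra_simps)

lemma cong_lmult: "p \<doteq> q \<Longrightarrow> r * p \<doteq> r * q" and cong_rmult: "p \<doteq> q \<Longrightarrow> p * r \<doteq> q * r"
  by (simp_all add: cong_mult)

lemma cong_sum: "(\<And>i. i \<in> I \<Longrightarrow> f i \<doteq> g i) \<Longrightarrow> (\<Sum>i\<in>I. f i) \<doteq> (\<Sum>i\<in>I. g i)"
  by (induction I rule: infinite_finite_induct) (auto intro: cong_add)

lemma cong_diff_0: "p \<doteq> q \<longleftrightarrow> p - q \<doteq> 0"
  by (simp add: cong_def)

end

text \<open>The assumption \<open>conj\<close> speaks of the linear function
  \<open>act w (lf x)\<close> and of no formula for the action on vectors, so that the locale fits
  both columns and rows.\<close>

locale rep_action = reflection_action G A R l u + ring_cong J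
  for G :: "('a, 'm) monoid_scheme" (structure) and A :: "'a \<Rightarrow> complex ^ 'n ^ 'n" and R l u
    and J :: "'g free set" +
  fixes \<iota> :: "complex ^ 'n \<Rightarrow> 'g" and \<gamma> :: "'a \<Rightarrow> 'g free"
  assumes relators: "linear_relators \<iota> \<union> commutator_relators \<iota> \<subseteq> J"
    and conj: "w \<in> carrier G \<Longrightarrow> act w (lf x) = lf y \<Longrightarrow> \<gamma> w * gen (\<iota> x) \<doteq> gen (\<iota> y) * \<gamma> w"
begin

definition emb :: "(complex ^ 'n \<Rightarrow> complex) \<Rightarrow> 'g free" where
  "emb f = relabel \<iota> (lift f)"

lemma emb_ev: "emb (ev p) \<doteq> relabel \<iota> p"
proof -
  have "ev (lift (ev p) - p) = 0" by (simp add: ev_diff ev_lift polyfun_ev)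
  from relabel_symmetric_ideal[OF J relators this] show ?thesis
    by (simp add: cong_def emb_def relabel_diff)
qed

lemma emb_add: "polyfun f \<Longrightarrow> polyfun g \<Longrightarrow> emb (f + g) \<doteq> emb f + emb g"
  using emb_ev[of "lift f + lift g"] by (simp add: ev_add ev_lift relabel_add flip: emb_def)

lemma emb_mult: "polyfun f \<Longrightarrow> polyfun g \<Longrightarrow> emb (f * g) \<doteq> emb f * emb g"
  using emb_ev[of "lift f * lift g"] by (simp add: ev_mult ev_lift relabel_mult flip: emb_def)

lemma emb_cst: "emb (cst a) \<doteq> scalar a"
  using emb_ev[of "scalar a"] by (simp add: ev_scalar relabel_scalar)

lemma emb_lf: "emb (lf x) \<doteq> gen (\<iota> x)"
  using emb_ev[of "gen x"] by (simp add: ev_gen relabel_gen)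

lemma emb_0: "emb 0 \<doteq> 0" and emb_1: "emb 1 \<doteq> 1"
  using emb_cst[of 0] emb_cst[of 1] by (simp_all add: scalar_0 scalar_1 cst_0 cst_1)

lemma emb_cst_mult: "polyfun f \<Longrightarrow> emb (cst a * f) \<doteq> scalar a * emb f"
  using cong_trans[OF emb_mult[OF polyfun_cst] cong_rmult[OF emb_cst]] .

lemma emb_uminus: "polyfun f \<Longrightarrow> emb (- f) \<doteq> - emb f"
  using emb_cst_mult[of f "-1"] by (simp add: cst_minus cst_1 scalar_minus scalar_1)

lemma emb_commute: "polyfun f \<Longrightarrow> polyfun g \<Longrightarrow> emb f * emb g \<doteq> emb g * emb f"
  using emb_mult[of f g] emb_mult[of g f] by (metis cong_sym cong_trans mult.commute)

lemma emb_sum: "(\<And>i. i \<in> I \<Longrightarrow> polyfun (f i)) \<Longrightarrow> emb (\<Sum>i\<in>I. f i) \<doteq> (\<Sum>i\<in>I. emb (f i))"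
proof (induction I rule: infinite_finite_induct)
  case (insert i I)
  then show ?case
    using cong_trans[OF emb_add cong_add[OF cong_refl]] by (simp add: polyfun_sum)
qed (simp_all add: emb_0)

lemma gamma_emb:
  assumes w: "w \<in> carrier G" and f: "polyfun f"
  shows "\<gamma> w * emb f \<doteq> emb (act w f) * \<gamma> w"
  using f
proof (induction rule: polyfun.induct)
  case (polyfun_cst a)
  have "\<gamma> w * emb (cst a) \<doteq> \<gamma> w * scalar a" by (intro cong_lmult emb_cst)
  also have "\<gamma> w * scalar a = scalar a * \<gamma> w" by (simp add: scalar_central)
  also have "scalar a * \<gamma> w \<doteq> emb (cst a) * \<gamma> w" by (intro cong_rmult cong_sym[OF emb_cst])
  finally show ?case by (simp add: act_cst)
next
  case (polyfun_lf x)
  have "act w (lf x) = lf (x v* A w)"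
    by (simp add: act_def lf_def fun_eq_iff pairing_commute[of _ x] pairing_commute[of _ "x v* A w"]
        pairing_matrix)
  then obtain y where y: "act w (lf x) = lf y" by blast
  have "\<gamma> w * emb (lf x) \<doteq> \<gamma> w * gen (\<iota> x)" by (intro cong_lmult emb_lf)
  also have "\<gamma> w * gen (\<iota> x) \<doteq> gen (\<iota> y) * \<gamma> w" using conj w y by blast
  also have "gen (\<iota> y) * \<gamma> w \<doteq> emb (lf y) * \<gamma> w" by (intro cong_rmult cong_sym[OF emb_lf])
  finally show ?case by (simp add: y)
next
  case (polyfun_add f g)
  have "\<gamma> w * emb (f + g) \<doteq> \<gamma> w * (emb f + emb g)" using polyfun_add by (intro cong_lmult emb_add)
  also have "\<dots> = \<gamma> w * emb f + \<gamma> w * emb g" by (simp add: distrib_left)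
  also have "\<dots> \<doteq> emb (act w f) * \<gamma> w + emb (act w g) * \<gamma> w" using polyfun_add by (intro cong_add) auto
  also have "\<dots> = (emb (act w f) + emb (act w g)) * \<gamma> w" by (simp add: distrib_right)
  also have "\<dots> \<doteq> emb (act w (f + g)) * \<gamma> w"
    unfolding act_add using polyfun_add by (intro cong_rmult cong_sym[OF emb_add] polyfun_act)
  finally show ?case .
next
  case (polyfun_mult f g)
  have "\<gamma> w * emb (f * g) \<doteq> \<gamma> w * (emb f * emb g)" using polyfun_mult by (intro cong_lmult emb_mult)
  also have "\<dots> = (\<gamma> w * emb f) * emb g" by (simp add: mult.assoc)
  also have "\<dots> \<doteq> (emb (act w f) * \<gamma> w) * emb g" using polyfun_mult by (intro cong_rmult) auto
  also have "\<dots> = emb (act w f) * (\<gamma> w * emb g)" by (simp add: mult.assoc)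
  also have "\<dots> \<doteq> emb (act w f) * (emb (act w g) * \<gamma> w)" using polyfun_mult by (intro cong_lmult) auto
  also have "\<dots> = (emb (act w f) * emb (act w g)) * \<gamma> w" by (simp add: mult.assoc)
  also have "\<dots> \<doteq> emb (act w (f * g)) * \<gamma> w"
    unfolding act_times using polyfun_mult by (intro cong_rmult cong_sym[OF emb_mult] polyfun_act)
  finally show ?case .
qed

text \<open>The left side is a derivation in \<open>f\<close>. On the right the twisted Leibniz rule
  of \<open>dd s\<close> matches it, as \<open>\<gamma> s * emb g\<close> becomes
  \<open>emb (act s g) * \<gamma> s\<close>; so it is enough that both sides agree on scalars and
  linear forms.\<close>

lemma commutator:
  assumes b: "\<And>x. gen (\<iota> x) * b - b * gen (\<iota> x) \<doteq> (\<Sum>s\<in>R. scalar (k s * pairing (u s) x) * \<gamma> s)"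
    and f: "polyfun f"
  shows "emb f * b - b * emb f \<doteq> (\<Sum>s\<in>R. scalar (k s) * emb (dd s f) * \<gamma> s)"
  using f
proof (induction rule: polyfun.induct)
  case (polyfun_cst a)
  have "emb (cst a) * b - b * emb (cst a) \<doteq> scalar a * b - b * scalar a"
    by (intro cong_diff cong_lmult cong_rmult emb_cst)
  also have "\<dots> = (\<Sum>s\<in>R. scalar (k s) * 0 * \<gamma> s)" by (simp add: scalar_central)
  also have "\<dots> \<doteq> (\<Sum>s\<in>R. scalar (k s) * emb (dd s (cst a)) * \<gamma> s)"
    by (intro cong_sum cong_rmult cong_lmult) (simp add: dd_cst cong_sym[OF emb_0])
  finally show ?case .
next
  case (polyfun_lf x)
  have "emb (lf x) * b - b * emb (lf x) \<doteq> gen (\<iota> x) * b - b * gen (\<iota> x)"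
    by (intro cong_diff cong_lmult cong_rmult emb_lf)
  also have "\<dots> \<doteq> (\<Sum>s\<in>R. scalar (k s) * scalar (pairing (u s) x) * \<gamma> s)"
    using b[of x] by (simp add: scalar_mult)
  also have "\<dots> \<doteq> (\<Sum>s\<in>R. scalar (k s) * emb (dd s (lf x)) * \<gamma> s)"
    by (intro cong_sum cong_rmult cong_lmult) (simp add: dd_lf cong_sym[OF emb_cst])
  finally show ?case .
next
  case (polyfun_add f g)
  have "emb (f + g) * b - b * emb (f + g) \<doteq> (emb f + emb g) * b - b * (emb f + emb g)"
    using polyfun_add.hyps by (intro cong_diff cong_lmult cong_rmult emb_add)
  also have "\<dots> = (emb f * b - b * emb f) + (emb g * b - b * emb g)" by (simp add: algebra_simps)
  also have "\<dots> \<doteq> (\<Sum>s\<in>R. scalar (k s) * emb (dd s f) * \<gamma> s) + (\<Sum>s\<in>R. scalar (k s) * emb (dd s g) * \<gamma> s)"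
    using polyfun_add.IH by (rule cong_add)
  also have "\<dots> = (\<Sum>s\<in>R. scalar (k s) * (emb (dd s f) + emb (dd s g)) * \<gamma> s)"
    by (simp add: algebra_simps sum.distrib)
  also have "\<dots> \<doteq> (\<Sum>s\<in>R. scalar (k s) * emb (dd s (f + g)) * \<gamma> s)"
    using polyfun_add.hyps
    by (intro cong_sum cong_rmult cong_lmult) (simp add: dd_add cong_sym[OF emb_add] polyfun_dd)
  finally show ?case .
next
  case (polyfun_mult f g)
  note pf = polyfun_mult.hyps
  have "emb (f * g) * b - b * emb (f * g) \<doteq> (emb f * emb g) * b - b * (emb f * emb g)"
    using pf by (intro cong_diff cong_lmult cong_rmult emb_mult)
  also have "\<dots> = emb f * (emb g * b - b * emb g) + (emb f * b - b * emb f) * emb g"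
    by (simp add: algebra_simps)
  also have "\<dots> \<doteq> emb f * (\<Sum>s\<in>R. scalar (k s) * emb (dd s g) * \<gamma> s) +
      (\<Sum>s\<in>R. scalar (k s) * emb (dd s f) * \<gamma> s) * emb g"
    using polyfun_mult.IH by (intro cong_add cong_lmult cong_rmult)
  also have "\<dots> = (\<Sum>s\<in>R. scalar (k s) * (emb f * emb (dd s g)) * \<gamma> s +
      scalar (k s) * emb (dd s f) * (\<gamma> s * emb g))"
  proof -
    have "emb f * (scalar (k s) * emb (dd s g) * \<gamma> s) = scalar (k s) * (emb f * emb (dd s g)) * \<gamma> s" for s
      by (metis mult.assoc scalar_central)
    then show ?thesis by (simp add: sum_distrib_left sum_distrib_right sum.distrib mult.assoc)
  qed
  also have "\<dots> \<doteq> (\<Sum>s\<in>R. scalar (k s) * (emb (f * dd s g)) * \<gamma> s +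
      scalar (k s) * emb (dd s f) * (emb (act s g) * \<gamma> s))"
    using pf R_sub
    by (intro cong_sum cong_add cong_rmult[OF cong_lmult] cong_lmult cong_sym[OF emb_mult] gamma_emb
        polyfun_dd) auto
  also have "\<dots> = (\<Sum>s\<in>R. scalar (k s) * (emb (f * dd s g) + emb (dd s f) * emb (act s g)) * \<gamma> s)"
    by (simp add: algebra_simps)
  also have "\<dots> \<doteq> (\<Sum>s\<in>R. scalar (k s) * (emb (f * dd s g) + emb (dd s f * act s g)) * \<gamma> s)"
    using pf
    by (intro cong_sum cong_rmult[OF cong_lmult] cong_add cong_refl cong_sym[OF emb_mult] polyfun_dd
        polyfun_act) auto
  also have "\<dots> \<doteq> (\<Sum>s\<in>R. scalar (k s) * emb (dd s (f * g)) * \<gamma> s)"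
  proof (intro cong_sum cong_rmult[OF cong_lmult])
    fix s assume s: "s \<in> R"
    show "emb (f * dd s g) + emb (dd s f * act s g) \<doteq> emb (dd s (f * g))"
      unfolding dd_mult[OF s pf] using s pf
      by (intro cong_sym[OF emb_add] polyfun.polyfun_mult polyfun_dd polyfun_act)
  qed
  finally show ?case .
qed

lemma emb_invariant_commute:
  assumes b: "\<And>x. gen (\<iota> x) * b - b * gen (\<iota> x) \<doteq> (\<Sum>s\<in>R. scalar (k s * pairing (u s) x) * \<gamma> s)"
    and f: "invariant f"
  shows "emb f * b \<doteq> b * emb f"
proof -
  have "emb f * b - b * emb f \<doteq> (\<Sum>s\<in>R. scalar (k s) * emb (dd s f) * \<gamma> s)"
    using commutator[OF b] f by (simp add: invariantD)
  also have "\<dots> \<doteq> (\<Sum>s\<in>R. scalar (k s) * 0 * \<gamma> s)"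
    by (intro cong_sum cong_rmult[OF cong_lmult]) (simp add: dd_invariant f emb_0)
  also have "\<dots> = 0" by simp
  finally show ?thesis by (simp add: cong_diff_0[of "emb f * b"])
qed

end

section \<open>Restriction to the words in a set of generators\<close>

text \<open>The generator type has a letter for every matrix. Deleting the words with letters
  outside \<open>G\<close> is an algebra map onto the carrier, along which ideals of the carrier
  pull back to ideals of the whole type.\<close>

definition res :: "'g set \<Rightarrow> 'g free \<Rightarrow> 'g free" where
  "res G = lext (\<lambda>w a. if set w \<subseteq> G then Poly_Mapping.single w a else 0)"

lemma res_add: "res G (p + q) = res G p + res G q"
  unfolding res_def by (rule lext_add) (auto simp: single_add)

lemma res_mult: "res G (p * q) = res G p * res G q"
  unfolding res_def by (rule lext_mult) (auto simp: single_add single_mult)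

lemma res_gen: "res G (gen g) = (if g \<in> G then gen g else 0)"
  and res_scalar: "res G (scalar a) = scalar a"
  by (simp_all add: res_def gen_def scalar_def lext_single)

lemma res_0: "res G 0 = 0" and res_1: "res G 1 = 1"
  using res_scalar[of G 0] res_scalar[of G 1] by (simp_all add: scalar_0 scalar_1)

lemma res_diff: "res G (p - q) = res G p - res G q"
  using res_add[of G "p - q" q] by simp

lemma res_carrier: "res G p \<in> carrier (free_algebra G)"
proof -
  have "Poly_Mapping.keys (res G p) \<subseteq> {w. set w \<subseteq> G}"
    unfolding res_def lext_def by (rule order_trans[OF keys_sum]) (auto split: if_splits)
  then show ?thesis by (auto simp: carrier_free_algebra)
qed

lemma res_id: "p \<in> carrier (free_algebra G) \<Longrightarrow> res G p = p"
proof -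
  assume "p \<in> carrier (free_algebra G)"
  then have "res G p = (\<Sum>w\<in>Poly_Mapping.keys p. Poly_Mapping.single w (Poly_Mapping.lookup p w))"
    unfolding res_def lext_def by (intro sum.cong) (auto simp: carrier_free_algebra)
  also have "\<dots> = p"
    by (intro poly_mapping_eqI) (simp add: lookup_sum lookup_single when_def in_keys_iff)
  finally show ?thesis .
qed

section \<open>Complex reflections\<close>

lemma matrix_inv_unique:
  fixes A B :: "complex ^ 'n ^ 'n"
  assumes "A ** B = mat 1" "B ** A = mat 1" shows "matrix_inv A = B"
proof -
  have "invertible A" using assms by (auto simp: invertible_def)
  then have "matrix_inv A ** A = mat 1"
    using someI_ex[of "\<lambda>B. A ** B = mat 1 \<and> B ** A = mat 1"] by (auto simp: matrix_inv_def invertible_def)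
  then have "matrix_inv A ** A ** B = B" by simp
  then show ?thesis using assms(1) by (simp flip: matrix_mul_assoc)
qed

lemma group_GL: "group GL"
proof (rule groupI)
  fix x :: "complex ^ 'n ^ 'n" assume "x \<in> carrier GL"
  then obtain y where "x ** y = mat 1" "y ** x = mat 1" by (auto simp: GL_def invertible_def)
  then show "\<exists>y\<in>carrier GL. y \<otimes>\<^bsub>GL\<^esub> x = \<one>\<^bsub>GL\<^esub>"
    by (intro bexI[of _ y]) (auto simp: GL_def invertible_def)
qed (auto simp: GL_def matrix_mul_assoc invertible_mult invertible_def[of "mat 1"])

text \<open>The vectors \<open>a $ i *s axis j 1 - a $ j *s axis i 1\<close> pair to zero with
  \<open>a\<close>; pairing them with \<open>b\<close> gives the vanishing of the two by two
  minors.\<close>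

lemma pairing_zero_multiple:
  assumes "\<And>y. pairing y a = 0 \<Longrightarrow> pairing y b = 0" "b \<noteq> 0"
  shows "\<exists>k. k \<noteq> 0 \<and> a = k *s b"
proof -
  have "a \<noteq> 0"
  proof
    assume "a = 0"
    then have "pairing y b = 0" for y using assms(1) by (simp add: pairing_0_right)
    then show False using pairing_eq_0_imp assms(2) by blast
  qed
  then obtain i where i: "a $ i \<noteq> 0" unfolding vec_eq_iff by auto
  have ax: "pairing (axis k 1) v = v $ k" for k v
    using pairing_axis[of v k] by (simp add: pairing_commute)
  have b: "a $ i * b $ j = a $ j * b $ i" for j
  proof -
    let ?y = "a $ i *s axis j 1 - a $ j *s axis i 1"
    have "pairing ?y a = 0" by (simp add: pairing_diff_left pairing_scale_left ax)
    then have "pairing ?y b = 0" by (rule assms(1))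
    then show ?thesis by (simp add: pairing_diff_left pairing_scale_left ax)
  qed
  have bi: "b $ i \<noteq> 0"
  proof
    assume "b $ i = 0"
    then have "b $ j = 0" for j using b[of j] i by simp
    then have "b = 0" unfolding vec_eq_iff by simp
    then show False using assms(2) by simp
  qed
  define k where "k = a $ i / b $ i"
  have "a $ j = k * b $ j" for j
    using b[of j] bi by (simp add: k_def divide_simps mult.commute)
  then have "a = k *s b" unfolding vec_eq_iff by simp
  moreover have "k \<noteq> 0" using i bi by (simp add: k_def)
  ultimately show ?thesis by blast
qed

section \<open>The reflection group: inverses, root data and conjugation\<close>

locale cherednik =
  fixes W :: "(complex ^ 'n ^ 'n) set"
    and c :: "complex ^ 'n ^ 'n \<Rightarrow> complex"
    and \<alpha> \<alpha>' :: "complex ^ 'n ^ 'n \<Rightarrow> complex ^ 'n"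
  assumes irr: "irreducible_complex_reflection_group W"
    and c_conj: "\<forall>w \<in> W. \<forall>s \<in> reflections W. c (w ** s ** matrix_inv w) = c s"
    and roots: "roots_and_coroots W \<alpha> \<alpha>'"
begin

abbreviation "R \<equiv> reflections W"
abbreviation "GW \<equiv> GL\<lparr>carrier := W\<rparr>"

lemma finite_W: "finite W" and subgroup_W: "subgroup W GL" and gen_W: "generate GL R = W"
  using irr by (auto simp: irreducible_complex_reflection_group_def)

lemma group_GW: "group GW"
  using subgroup.subgroup_is_group[OF subgroup_W group_GL] .

lemma W_one: "mat 1 \<in> W" and W_mult: "w \<in> W \<Longrightarrow> w' \<in> W \<Longrightarrow> w ** w' \<in> W"
  using subgroup.one_closed[OF subgroup_W] subgroup.m_closed[OF subgroup_W] by (simp_all add: GL_def)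

lemma W_inv: "w \<in> W \<Longrightarrow> matrix_inv w \<in> W"
  and inv_right: "w \<in> W \<Longrightarrow> w ** matrix_inv w = mat 1"
  and inv_left: "w \<in> W \<Longrightarrow> matrix_inv w ** w = mat 1"
proof -
  assume w: "w \<in> W"
  interpret group GW by (rule group_GW)
  have 1: "inv\<^bsub>GW\<^esub> w \<in> W" "w ** inv\<^bsub>GW\<^esub> w = mat 1" "inv\<^bsub>GW\<^esub> w ** w = mat 1"
    using w inv_closed[of w] r_inv[of w] l_inv[of w] by (simp_all add: GL_def)
  then have "matrix_inv w = inv\<^bsub>GW\<^esub> w" using matrix_inv_unique by blast
  then show "matrix_inv w \<in> W" "w ** matrix_inv w = mat 1" "matrix_inv w ** w = mat 1"
    using 1 by simp_all
qed

lemma inv_right': "w \<in> W \<Longrightarrow> w *v (matrix_inv w *v v) = v"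
  and inv_left': "w \<in> W \<Longrightarrow> matrix_inv w *v (w *v v) = v"
  by (simp_all add: matrix_vector_mul_assoc inv_right inv_left)

lemma inv_mult: "w \<in> W \<Longrightarrow> w' \<in> W \<Longrightarrow> matrix_inv (w ** w') = matrix_inv w' ** matrix_inv w"
proof (rule matrix_inv_unique)
  assume w: "w \<in> W" "w' \<in> W"
  have "w ** w' ** (matrix_inv w' ** matrix_inv w) = w ** (w' ** matrix_inv w') ** matrix_inv w"
    by (simp only: matrix_mul_assoc)
  then show "w ** w' ** (matrix_inv w' ** matrix_inv w) = mat 1" using w by (simp add: inv_right)
  have "matrix_inv w' ** matrix_inv w ** (w ** w') = matrix_inv w' ** (matrix_inv w ** w) ** w'"
    by (simp only: matrix_mul_assoc)
  then show "matrix_inv w' ** matrix_inv w ** (w ** w') = mat 1" using w by (simp add: inv_left)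
qed

lemma inv_one: "matrix_inv (mat 1 :: complex ^ 'n ^ 'n) = mat 1"
  by (rule matrix_inv_unique) simp_all

lemma inv_inv: "w \<in> W \<Longrightarrow> matrix_inv (matrix_inv w) = w"
  by (rule matrix_inv_unique) (simp_all add: inv_left inv_right)

lemma R_W: "s \<in> R \<Longrightarrow> s \<in> W" by (simp add: reflections_def)

lemma finite_R: "finite R"
  using finite_W by (rule rev_finite_subset) (auto simp: reflections_def)

lemma root_pairing: "s \<in> R \<Longrightarrow> pairing (\<alpha> s) (\<alpha>' s) = 2"
  using roots by (simp add: roots_and_coroots_def)

lemma root_nz: "s \<in> R \<Longrightarrow> \<alpha> s \<noteq> 0" and coroot_nz: "s \<in> R \<Longrightarrow> \<alpha>' s \<noteq> 0"
  using root_pairing[of s] by (auto simp: pairing_0_left pairing_0_right)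

lemma pairing_dual_act: "pairing (dual_act w y) x = pairing y (matrix_inv w *v x)"
  by (simp add: dual_act_def pairing_matrix)

text \<open>The fixed space lies in the kernel of \<open>\<alpha> s\<close> and has at least its
  dimension, so they agree and \<open>1 - s\<close> factors through \<open>\<alpha> s\<close>. Its
  image is the line of \<open>\<alpha>' s\<close>, since a functional that kills the image is fixed
  by \<open>s\<close> and therefore kills \<open>\<alpha>' s\<close>.\<close>

lemma reflection_form:
  assumes s: "s \<in> R"
  shows "\<exists>k. k \<noteq> 0 \<and> (\<forall>v. s *v v = v - (k * pairing (\<alpha> s) v) *s \<alpha>' s)"
proof -
  let ?F = "{v. s *v v = v}" and ?K = "{v. pairing (\<alpha> s) v = 0}"
  have subF: "vec.subspace ?F"
    by (auto simp: vec.subspace_def matrix_vector_right_distrib vector_scalar_commute)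
  have subK: "vec.subspace ?K"
    by (auto simp: vec.subspace_def pairing_add_right pairing_scale_right pairing_0_right)
  have FK: "?F \<subseteq> ?K" using roots s by (auto simp: roots_and_coroots_def)
  have "\<alpha>' s \<notin> ?K" using root_pairing[OF s] by simp
  then have "?K \<subset> UNIV" by blast
  moreover have "vec.span ?K = ?K" using subK by (simp only: vec.span_eq_iff)
  ultimately have "vec.span ?K \<subset> vec.span UNIV" by (simp only: vec.span_UNIV)
  then have "vec.dim ?K < vec.dim (UNIV :: (complex ^ 'n) set)"
    by (rule vec.dim_psubset)
  then have "vec.dim ?K < CARD('n)" by (simp only: vec_dim_card)
  then have "vec.dim ?K \<le> vec.dim ?F" using s by (simp add: reflections_def)
  then have eq: "?F = ?K" using vec.subspace_dim_equal[OF subF subK FK] by simp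
  define \<beta> where "\<beta> = \<alpha>' s - s *v \<alpha>' s"
  have sv: "s *v v = v - (pairing (\<alpha> s) v / 2) *s \<beta>" for v
  proof -
    have "v - (pairing (\<alpha> s) v / 2) *s \<alpha>' s \<in> ?K"
      using root_pairing[OF s] by (simp add: pairing_diff_right pairing_scale_right)
    then have "v - (pairing (\<alpha> s) v / 2) *s \<alpha>' s \<in> ?F" using eq by simp
    then have "s *v v - (pairing (\<alpha> s) v / 2) *s (s *v \<alpha>' s) = v - (pairing (\<alpha> s) v / 2) *s \<alpha>' s"
      by (simp add: matrix_vector_mult_diff_distrib vector_scalar_commute)
    then show ?thesis by (simp add: \<beta>_def vector_ssub_ldistrib algebra_simps)
  qed
  have "\<exists>k. k \<noteq> 0 \<and> \<beta> = k *s \<alpha>' s"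
  proof (rule pairing_zero_multiple[OF _ coroot_nz[OF s]])
    fix y assume y: "pairing y \<beta> = 0"
    have "pairing y (s *v v) = pairing y v" for v
      by (simp add: sv pairing_diff_right pairing_scale_right y)
    from this[of "matrix_inv s *v v" for v] have "pairing (dual_act s y) v = pairing y v" for v
      by (simp add: pairing_dual_act inv_right'[OF R_W[OF s]])
    then have "pairing v (dual_act s y - y) = 0" for v
      by (simp add: pairing_diff_right pairing_commute[of v])
    then have "dual_act s y = y" using pairing_eq_0_imp[of "dual_act s y - y"] by simp
    then show "pairing y (\<alpha>' s) = 0" using roots s by (simp add: roots_and_coroots_def)
  qed
  then obtain k where "k \<noteq> 0" "\<beta> = k *s \<alpha>' s" by blast
  then show ?thesis
    by (intro exI[of _ "k / 2"]) (simp add: sv vector_smult_assoc mult.commute)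
qed

text \<open>Half of one minus the nontrivial eigenvalue of \<open>s\<close>, see
  \<open>refl_coroot\<close>; it is 1 for reflections of order two.\<close>

definition kap :: "complex ^ 'n ^ 'n \<Rightarrow> complex" where
  "kap s = (SOME k. k \<noteq> 0 \<and> (\<forall>v. s *v v = v - (k * pairing (\<alpha> s) v) *s \<alpha>' s))"

lemma kap_nz: "s \<in> R \<Longrightarrow> kap s \<noteq> 0"
  and refl_eq: "s \<in> R \<Longrightarrow> s *v v = v - (kap s * pairing (\<alpha> s) v) *s \<alpha>' s"
  using someI_ex[OF reflection_form[of s], folded kap_def] by blast+

lemma refl_coroot: "s \<in> R \<Longrightarrow> s *v \<alpha>' s = (1 - 2 * kap s) *s \<alpha>' s"
  by (simp add: refl_eq root_pairing vector_sub_rdistrib mult.commute)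

lemma kap_nz': "s \<in> R \<Longrightarrow> 1 - 2 * kap s \<noteq> 0"
proof
  assume s: "s \<in> R" "1 - 2 * kap s = 0"
  have "s *v \<alpha>' s = 0" unfolding refl_coroot[OF s(1)] s(2) by simp
  then have "\<alpha>' s = 0" using inv_left'[OF R_W[OF s(1)], of "\<alpha>' s"] by simp
  then show False using coroot_nz[OF s(1)] by simp
qed

text \<open>The same quantity for the inverse of \<open>s\<close>, obtained on replacing the
  eigenvalue \<open>1 - 2 * kap s\<close> by its reciprocal.\<close>

definition kap' :: "complex ^ 'n ^ 'n \<Rightarrow> complex" where
  "kap' s = - kap s / (1 - 2 * kap s)"

lemma kap'_nz: "s \<in> R \<Longrightarrow> kap' s \<noteq> 0"
  using kap_nz kap_nz' by (simp add: kap'_def)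

lemma refl_inv_eq: "s \<in> R \<Longrightarrow> matrix_inv s *v v = v - (kap' s * pairing (\<alpha> s) v) *s \<alpha>' s"
proof -
  assume s: "s \<in> R"
  define p where "p = pairing (\<alpha> s) v"
  have k: "kap s * p + kap' s * p * (1 - 2 * kap s) = 0"
    using kap_nz'[OF s] by (simp add: kap'_def)
  have "s *v (v - (kap' s * p) *s \<alpha>' s) = (v - (kap s * p) *s \<alpha>' s) - (kap' s * p) *s ((1 - 2 * kap s) *s \<alpha>' s)"
    unfolding matrix_vector_mult_diff_distrib vector_scalar_commute refl_coroot[OF s]
    by (simp only: refl_eq[OF s, of v] p_def)
  also have "\<dots> = v - (kap s * p + kap' s * p * (1 - 2 * kap s)) *s \<alpha>' s"
    unfolding vector_smult_assoc vector_sadd_rdistrib by (simp only: diff_diff_eq)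
  also have "\<dots> = v" unfolding k by simp
  finally have "matrix_inv s *v v = v - (kap' s * p) *s \<alpha>' s"
    using inv_left'[OF R_W[OF s], of "v - (kap' s * p) *s \<alpha>' s"] by simp
  then show ?thesis by (simp only: p_def)
qed

lemma conj_R: assumes w: "w \<in> W" and s: "s \<in> R" shows "w ** s ** matrix_inv w \<in> R"
proof -
  have t: "(w ** s ** matrix_inv w) *v v = w *v (s *v (matrix_inv w *v v))" for v
    by (simp only: matrix_vector_mul_assoc matrix_mul_assoc)
  have "{v. (w ** s ** matrix_inv w) *v v = v} = (*v) w ` {v. s *v v = v}"
  proof (intro equalityI subsetI)
    fix v assume "v \<in> {v. (w ** s ** matrix_inv w) *v v = v}"
    then have "w *v (s *v (matrix_inv w *v v)) = v" by (simp only: t mem_Collect_eq)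
    then have "s *v (matrix_inv w *v v) = matrix_inv w *v v"
      using inv_left'[OF w, of "s *v (matrix_inv w *v v)"] by simp
    then show "v \<in> (*v) w ` {v. s *v v = v}"
      by (intro image_eqI[of _ _ "matrix_inv w *v v"]) (simp_all add: inv_right'[OF w])
  next
    fix v assume "v \<in> (*v) w ` {v. s *v v = v}"
    then obtain x where "v = w *v x" "s *v x = x" by blast
    then show "v \<in> {v. (w ** s ** matrix_inv w) *v v = v}" by (simp only: t inv_left'[OF w] mem_Collect_eq)
  qed
  moreover have "inj_on ((*v) w) A" for A by (metis inj_onI inv_left'[OF w])
  ultimately have "vec.dim {v. (w ** s ** matrix_inv w) *v v = v} = vec.dim {v. s *v v = v}"
    by (simp add: vec.dim_image_eq matrix_vector_mul_linear_gen)
  then show ?thesis using w s by (simp add: reflections_def W_mult W_inv)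
qed

text \<open>Root and coroot are chosen separately for each reflection, so conjugation matches them
  only up to a factor. Comparing two expressions for the rank-one part of \<open>t\<close> at
  \<open>w *v \<alpha>' s\<close> gives this factor, and then also
  \<open>kap t = kap s\<close>.\<close>

lemma conj_root:
  assumes w: "w \<in> W" and s: "s \<in> R"
  defines "t \<equiv> w ** s ** matrix_inv w"
  shows "kap t = kap s" "\<exists>\<mu>. \<mu> \<noteq> 0 \<and> w *v \<alpha>' s = \<mu> *s \<alpha>' t"
proof -
  have t: "t \<in> R" using conj_R[OF w s] by (simp add: t_def)
  have "t *v v = v - (kap s * pairing (\<alpha> s) (matrix_inv w *v v)) *s (w *v \<alpha>' s)" for v
  proof -
    have "t *v v = w *v (s *v (matrix_inv w *v v))"
      by (simp only: t_def matrix_vector_mul_assoc matrix_mul_assoc)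
    then show ?thesis
      by (simp only: refl_eq[OF s] matrix_vector_mult_diff_distrib vector_scalar_commute inv_right'[OF w])
  qed
  then have eq: "(kap s * pairing (\<alpha> s) (matrix_inv w *v v)) *s (w *v \<alpha>' s) = (kap t * pairing (\<alpha> t) v) *s \<alpha>' t" for v
    using refl_eq[OF t, of v] by simp
  define \<mu> where "\<mu> = kap t * pairing (\<alpha> t) (w *v \<alpha>' s) / (2 * kap s)"
  have e0: "(kap s * 2) *s (w *v \<alpha>' s) = (kap t * pairing (\<alpha> t) (w *v \<alpha>' s)) *s \<alpha>' t"
    using eq[of "w *v \<alpha>' s"] root_pairing[OF s] by (simp add: inv_left'[OF w])
  from arg_cong[OF e0, of "(*s) (1 / (kap s * 2))"]
  have "(1 / (kap s * 2)) *s ((kap s * 2) *s (w *v \<alpha>' s)) = \<mu> *s \<alpha>' t"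
    by (simp only: vector_smult_assoc \<mu>_def) (simp add: mult.commute)
  then have wa: "w *v \<alpha>' s = \<mu> *s \<alpha>' t"
    using kap_nz[OF s] by (simp add: vector_smult_assoc)
  have "w *v \<alpha>' s \<noteq> 0"
    using coroot_nz[OF s] inv_left'[OF w, of "\<alpha>' s"] by (metis matrix_vector_mult_0_right)
  then have mu: "\<mu> \<noteq> 0" using wa by auto
  show "\<exists>\<mu>. \<mu> \<noteq> 0 \<and> w *v \<alpha>' s = \<mu> *s \<alpha>' t" using wa mu by blast
  have "(kap s * 2) *s (\<mu> *s \<alpha>' t) = (kap t * (\<mu> * 2)) *s \<alpha>' t"
    using e0 by (simp only: wa pairing_scale_right root_pairing[OF t])
  then have "(kap s * 2 * \<mu>) *s \<alpha>' t = (kap t * (\<mu> * 2)) *s \<alpha>' t"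
    by (simp only: vector_smult_assoc)
  then have "kap s * 2 * \<mu> = kap t * (\<mu> * 2)" using coroot_nz[OF t] vector_mul_rcancel by blast
  then show "kap t = kap s" using mu by simp
qed

lemma dual_act_refl: "s \<in> R \<Longrightarrow> dual_act s y = y - (kap' s * pairing y (\<alpha>' s)) *s \<alpha> s"
proof -
  assume s: "s \<in> R"
  have "pairing v (dual_act s y - (y - (kap' s * pairing y (\<alpha>' s)) *s \<alpha> s)) = 0" for v
    using s
    by (simp add: pairing_diff_right pairing_scale_right pairing_commute[of v] pairing_dual_act refl_inv_eq)
  then show ?thesis using pairing_eq_0_imp by fastforce
qed

section \<open>The Cherednik algebra as a quotient by a congruence\<close>

text \<open>The ideal pulled back along \<open>res\<close> to all words, so that congruences carry
  no membership side conditions.\<close>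

definition Jx :: "'n cgen free set" where
  "Jx = {p. res (cherednik_gens W) p \<in> cherednik_ideal W c \<alpha> \<alpha>'}"

abbreviation "FA \<equiv> free_algebra (cherednik_gens W)"

lemma ideal_cherednik: "ideal (cherednik_ideal W c \<alpha> \<alpha>') FA"
  unfolding cherednik_ideal_def
  by (intro ring.genideal_ideal ring_free_algebra cherednik_relators_closed subgroup_W)

lemma is_ideal_Jx: "is_ideal Jx"
proof -
  interpret ideal "cherednik_ideal W c \<alpha> \<alpha>'" FA by (rule ideal_cherednik)
  show ?thesis
    unfolding is_ideal_def Jx_def
    using zero_closed a_closed I_l_closed I_r_closed additive_subgroup.zero_closed
      additive_subgroup.a_closed[OF additive_subgroup_axioms] additive_subgroup.zero_closed[OF additive_subgroup_axioms]
    by (auto simp: res_0 res_add res_mult res_carrier free_algebra_simps)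
qed

lemma relator_Jx: "p \<in> cherednik_relators W c \<alpha> \<alpha>' \<Longrightarrow> p \<in> Jx"
proof -
  assume p: "p \<in> cherednik_relators W c \<alpha> \<alpha>'"
  have "p \<in> carrier FA" using p cherednik_relators_closed[OF subgroup_W] by blast
  moreover have "p \<in> cherednik_ideal W c \<alpha> \<alpha>'"
    unfolding cherednik_ideal_def
    using p ring.genideal_self[OF ring_free_algebra cherednik_relators_closed[OF subgroup_W]] by blast
  ultimately show ?thesis by (simp add: Jx_def res_id)
qed

sublocale ring_cong Jx by standard (rule is_ideal_Jx)

notation cong (infix "\<doteq>" 50)

abbreviation gr :: "complex ^ 'n ^ 'n \<Rightarrow> 'n cgen free" where "gr w \<equiv> gen (Grp w)"

lemma gr_one: "gr (mat 1) \<doteq> 1"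
  and gr_mult: "w \<in> W \<Longrightarrow> w' \<in> W \<Longrightarrow> gr w * gr w' \<doteq> gr (w ** w')"
  unfolding cong_def
  by (rule relator_Jx; force simp: cherednik_relators_def group_relators_def)+

text \<open>Such letters are deleted by \<open>res\<close>. Inductions over all letters dispose of
  them in this way.\<close>

lemma gr_not_W: "w \<notin> W \<Longrightarrow> gr w \<doteq> 0"
proof -
  assume "w \<notin> W"
  then have "res (cherednik_gens W) (gr w) = res (cherednik_gens W) 0"
    by (auto simp: res_gen cherednik_gens_def res_0)
  then have "gr w \<in> Jx" using ideal_0[OF is_ideal_Jx] by (simp add: Jx_def)
  then show ?thesis by (simp add: cong_def)
qed

lemma gr_conj:
  assumes w: "w \<in> W" and r: "gr w * p * gr (matrix_inv w) - q \<in> cherednik_relators W c \<alpha> \<alpha>'"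
  shows "gr w * p \<doteq> q * gr w"
proof -
  have "gr w * p = gr w * p * 1" by simp
  also have "gr w * p * 1 \<doteq> gr w * p * (gr (matrix_inv w) * gr w)"
    using gr_mult[OF W_inv[OF w] w] gr_one
    by (intro cong_lmult) (metis cong_sym cong_trans inv_left[OF w])
  also have "\<dots> = (gr w * p * gr (matrix_inv w)) * gr w" by (simp add: mult.assoc)
  also have "\<dots> \<doteq> q * gr w" using relator_Jx[OF r] by (intro cong_rmult) (simp add: cong_def)
  finally show ?thesis .
qed

lemma generate_GW: "generate GW R = W"
  using group.generate_consistent[OF group_GL _ subgroup_W, of R] gen_W
  by (auto simp: reflections_def)

text \<open>An element \<open>x\<close> of \<open>V\<close> is the linear function
  \<open>lf x\<close> on the dual, and \<open>w *v x\<close> then corresponds to substituting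
  \<open>transpose w\<close>. The linear form to divide by is therefore the coroot, and the root
  gives the direction.\<close>

lemma reflection_action_X: "reflection_action GW transpose R \<alpha>' (\<lambda>s. kap s *s \<alpha> s)"
proof (intro reflection_action.intro reflection_action_axioms.intro)
  show "group GW" by (rule group_GW)
  show "transpose (x \<otimes>\<^bsub>GW\<^esub> y) = transpose y ** transpose x" for x y
    by (simp add: GL_def matrix_transpose_mul)
  show "transpose s *v v = v - pairing v (\<alpha>' s) *s (kap s *s \<alpha> s)" if s: "s \<in> R" for s v
  proof -
    have "pairing (transpose s *v v - (v - pairing v (\<alpha>' s) *s (kap s *s \<alpha> s))) z = 0" for z
      using s by (simp add: pairing_diff_left pairing_scale_left refl_eq pairing_diff_right
          pairing_scale_right flip: pairing_matrix)
    then have "pairing z (transpose s *v v - (v - pairing v (\<alpha>' s) *s (kap s *s \<alpha> s))) = 0" for z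
      by (simp add: pairing_commute)
    then show ?thesis using pairing_eq_0_imp by fastforce
  qed
qed (use finite_W generate_GW coroot_nz in \<open>auto simp: GL_def reflections_def\<close>)

text \<open>Here elements of the dual are functions on \<open>V\<close>, and \<open>w\<close> acts
  by substituting its inverse; this is why \<open>kap'\<close> appears and root and coroot change
  places.\<close>

lemma reflection_action_Y: "reflection_action GW matrix_inv R \<alpha> (\<lambda>s. kap' s *s \<alpha>' s)"
proof (intro reflection_action.intro reflection_action_axioms.intro)
  show "group GW" by (rule group_GW)
  show "matrix_inv s *v v = v - pairing v (\<alpha> s) *s (kap' s *s \<alpha>' s)" if s: "s \<in> R" for s v
    using s by (simp add: refl_inv_eq pairing_commute[of v] vector_smult_assoc mult.commute)
qed (use finite_W generate_GW root_nz inv_mult inv_one in \<open>auto simp: GL_def reflections_def\<close>)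

sublocale X: rep_action GW transpose R \<alpha>' "\<lambda>s. kap s *s \<alpha> s" Jx Vec gr
proof (intro rep_action.intro rep_action_axioms.intro reflection_action_X ring_cong_axioms)
  show "linear_relators Vec \<union> commutator_relators Vec \<subseteq> Jx"
    using relator_Jx by (auto simp: cherednik_relators_def)
  fix w x y
  assume w: "w \<in> carrier GW" and eq: "reflection_action.act transpose w (lf x) = lf y"
  have "pairing v (w *v x - y) = 0" for v
  proof -
    have "pairing (transpose w *v v) x = pairing v y"
      using fun_cong[OF eq, of v]
      unfolding reflection_action.act_def[OF reflection_action_X] lf_apply .
    then show ?thesis
      by (simp only: pairing_diff_right pairing_matrix transpose_matrix_vector) simp
  qed
  then have "w *v x - y = 0" by (rule pairing_eq_0_imp)
  then have "y = w *v x" by simp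
  then show "gr w * gen (Vec x) \<doteq> gen (Vec y) * gr w"
    using w by (intro gr_conj) (auto simp: cherednik_relators_def conjugation_relators_def)
qed

sublocale Y: rep_action GW matrix_inv R \<alpha> "\<lambda>s. kap' s *s \<alpha>' s" Jx Covec gr
proof (intro rep_action.intro rep_action_axioms.intro reflection_action_Y ring_cong_axioms)
  show "linear_relators Covec \<union> commutator_relators Covec \<subseteq> Jx"
    using relator_Jx by (auto simp: cherednik_relators_def)
  fix w x y
  assume w: "w \<in> carrier GW" and eq: "reflection_action.act matrix_inv w (lf x) = lf y"
  have "pairing v (dual_act w x - y) = 0" for v
  proof -
    have "pairing (matrix_inv w *v v) x = pairing v y"
      using fun_cong[OF eq, of v]
      unfolding reflection_action.act_def[OF reflection_action_Y] lf_apply .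
    moreover have "pairing v (dual_act w x) = pairing (matrix_inv w *v v) x"
      by (simp only: pairing_commute[of v] pairing_dual_act pairing_commute[of x])
    ultimately show ?thesis by (simp only: pairing_diff_right) simp
  qed
  then have "dual_act w x - y = 0" by (rule pairing_eq_0_imp)
  then have "y = dual_act w x" by simp
  then show "gr w * gen (Covec x) \<doteq> gen (Covec y) * gr w"
    using w by (intro gr_conj) (auto simp: cherednik_relators_def conjugation_relators_def)
qed

lemma commutation:
  "gen (Vec x) * gen (Covec y) - gen (Covec y) * gen (Vec x) \<doteq>
    (\<Sum>s\<in>R. scalar (c s * pairing y (\<alpha>' s) * pairing (\<alpha> s) x) * gr s)"
  unfolding cong_def by (rule relator_Jx) (auto simp: cherednik_relators_def)

text \<open>The factor \<open>kap s\<close> is moved to \<open>\<alpha> s\<close>, the direction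
  prescribed by \<open>reflection_action_X\<close>, so that the coefficients have the form asked for
  in \<open>commutator\<close>. \<open>Covec_Vec\<close> does the same with \<open>kap'\<close> and
  the opposite sign.\<close>

lemma Vec_Covec:
  "gen (Vec x) * gen (Covec y) - gen (Covec y) * gen (Vec x) \<doteq>
    (\<Sum>s\<in>R. scalar ((c s * pairing y (\<alpha>' s) / kap s) * pairing (kap s *s \<alpha> s) x) * gr s)"
proof -
  have "(\<Sum>s\<in>R. scalar (c s * pairing y (\<alpha>' s) * pairing (\<alpha> s) x) * gr s) =
    (\<Sum>s\<in>R. scalar ((c s * pairing y (\<alpha>' s) / kap s) * pairing (kap s *s \<alpha> s) x) * gr s)"
    using kap_nz by (intro sum.cong refl) (simp add: pairing_scale_left mult.assoc)
  then show ?thesis using commutation[of x y] by simp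
qed

lemma Covec_Vec:
  "gen (Covec y) * gen (Vec x) - gen (Vec x) * gen (Covec y) \<doteq>
    (\<Sum>s\<in>R. scalar ((- c s * pairing (\<alpha> s) x / kap' s) * pairing (kap' s *s \<alpha>' s) y) * gr s)"
proof -
  have "- (\<Sum>s\<in>R. scalar (c s * pairing y (\<alpha>' s) * pairing (\<alpha> s) x) * gr s) =
    (\<Sum>s\<in>R. scalar ((- c s * pairing (\<alpha> s) x / kap' s) * pairing (kap' s *s \<alpha>' s) y) * gr s)"
    unfolding sum_negf[symmetric] using kap'_nz
    by (intro sum.cong refl)
       (simp add: pairing_scale_left pairing_commute[of y] scalar_minus ac_simps)
  then show ?thesis using cong_uminus[OF commutation[of x y]] by simp
qed

lemmas X_Covec = X.commutator[OF Vec_Covec]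
lemmas Y_Vec = Y.commutator[OF Covec_Vec]

end

section \<open>The induced module\<close>

text \<open>A function \<open>m\<close> of \<open>y\<close>, \<open>v\<close> and \<open>u\<close> stands for an element of the tensor product of \<open>S(V)\<close>
  (functions of \<open>y\<close>) with the smash product of \<open>S(V*)\<close> (functions of \<open>v\<close>) and the group algebra
  (functions of \<open>u\<close>), that is, of the module induced from the subalgebra generated by the dual of
  \<open>V\<close> and \<open>W\<close>.\<close>

type_synonym 'n mfun = "complex ^ 'n \<Rightarrow> complex ^ 'n \<Rightarrow> complex ^ 'n ^ 'n \<Rightarrow> complex"

text \<open>Polynomial dependence is required in \<open>y\<close> alone, where divided differences
  are taken; in \<open>v\<close> and \<open>u\<close> the operators only multiply and substitute, so
  \<open>h\<close> may be any function.\<close>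

inductive tens :: "('n :: finite) mfun \<Rightarrow> bool" where
  tens_basic: "polyfun f \<Longrightarrow> tens (\<lambda>y v u. f y * h v u)"
| tens_add: "tens m \<Longrightarrow> tens m' \<Longrightarrow> tens (\<lambda>y v u. m y v u + m' y v u)"

lemma tens_scale: "tens m \<Longrightarrow> tens (\<lambda>y v u. a * m y v u)"
proof (induction rule: tens.induct)
  case (tens_basic f h)
  have "tens (\<lambda>y v u. f y * (a * h v u))" by (rule tens.tens_basic[OF tens_basic])
  then show ?case by (simp only: mult.left_commute)
next
  case (tens_add m m')
  from tens.tens_add[OF tens_add.IH] show ?case by (simp only: distrib_left)
qed

lemma tens_mult: "tens m \<Longrightarrow> polyfun g \<Longrightarrow> tens (\<lambda>y v u. g y * m y v u)"
proof (induction rule: tens.induct)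
  case (tens_basic f h)
  have "tens (\<lambda>y v u. (g * f) y * h v u)" by (rule tens.tens_basic[OF polyfun_mult[OF tens_basic(2,1)]])
  then show ?case by (simp only: times_fun_apply mult.assoc)
next
  case (tens_add m m')
  from tens.tens_add[OF tens_add.IH[OF tens_add.prems]] show ?case by (simp only: distrib_left)
qed

lemma tens_diff: "tens m \<Longrightarrow> tens m' \<Longrightarrow> tens (\<lambda>y v u. m y v u - m' y v u)"
  using tens_add[OF _ tens_scale, of m m' "-1"] by simp

lemma tens_zero: "tens (\<lambda>y v u. 0)"
  using tens_basic[OF polyfun_0, of "\<lambda>v u. 0"] by simp

lemma tens_sum: "(\<And>i. i \<in> I \<Longrightarrow> tens (f i)) \<Longrightarrow> tens (\<lambda>y v u. \<Sum>i\<in>I. f i y v u)"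
proof (induction I rule: infinite_finite_induct)
  case (insert i I)
  have "tens (\<lambda>y v u. f i y v u + (\<Sum>i\<in>I. f i y v u))" using insert by (intro tens_add) auto
  then show ?case using insert.hyps by simp
qed (simp_all add: tens_zero)

lemma polyfun_tens: "tens m \<Longrightarrow> polyfun (\<lambda>y. m y v u)"
proof (induction rule: tens.induct)
  case (tens_basic f h)
  have "(\<lambda>y. f y * h v u) = f * cst (h v u)" by (simp add: fun_eq_iff fun_apply)
  then show ?case using polyfun_mult[OF tens_basic polyfun_cst] by (simp only:)
next
  case (tens_add m m')
  have "(\<lambda>y. m y v u + m' y v u) = (\<lambda>y. m y v u) + (\<lambda>y. m' y v u)" by (simp add: fun_eq_iff fun_apply)
  then show ?case using polyfun_add[OF tens_add.IH] by (simp only:)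
qed

section \<open>The action of the generators on the induced module\<close>

context cherednik
begin

text \<open>The divided difference on the factor \<open>S(V)\<close>, combined with the action of
  \<open>s\<close> on the other two factors.\<close>

definition E :: "complex ^ 'n ^ 'n \<Rightarrow> 'n mfun \<Rightarrow> 'n mfun" where
  "E s m = (\<lambda>y v u. X.dd s (\<lambda>y. m y (matrix_inv s *v v) (matrix_inv s ** u)) y)"

text \<open>Elements of \<open>V\<close> multiply, \<open>W\<close> acts on all factors, and a
  covector is carried across \<open>S(V)\<close> at the cost of the divided differences that
  \<open>Vec_Covec\<close> produces. The last clause is a Dunkl operator with multiplication by a
  covector in place of the partial derivative.\<close>

primrec opg :: "'n cgen \<Rightarrow> 'n mfun \<Rightarrow> 'n mfun" where
  "opg (Grp w) m = (\<lambda>y v u. m (transpose w *v y) (matrix_inv w *v v) (matrix_inv w ** u))"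
| "opg (Vec x) m = (\<lambda>y v u. pairing y x * m y v u)"
| "opg (Covec \<eta>) m = (\<lambda>y v u. pairing \<eta> v * m y v u -
     (\<Sum>s\<in>R. c s * pairing \<eta> (\<alpha>' s) / kap s * E s m y v u))"

lemma dd_cst_mult: "s \<in> R \<Longrightarrow> polyfun f \<Longrightarrow> X.dd s (\<lambda>y. a * f y) = (\<lambda>y. a * X.dd s f y)"
  using X.dd_invariant_mult[OF _ X.invariant_cst, of s f a] by (simp only: times_fun_def cst_def)

lemma dd_mult_cst:
  assumes "s \<in> R" "polyfun f" shows "X.dd s (\<lambda>y. f y * a) = (\<lambda>y. X.dd s f y * a)"
proof -
  have "(\<lambda>y. f y * a) = (\<lambda>y. a * f y)" by (rule ext) (rule mult.commute)
  moreover have "(\<lambda>y. X.dd s f y * a) = (\<lambda>y. a * X.dd s f y)" by (rule ext) (rule mult.commute)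
  ultimately show ?thesis using dd_cst_mult[OF assms] by simp
qed

lemma E_basic: "s \<in> R \<Longrightarrow> polyfun f \<Longrightarrow>
    E s (\<lambda>y v u. f y * h v u) = (\<lambda>y v u. X.dd s f y * h (matrix_inv s *v v) (matrix_inv s ** u))"
  unfolding E_def by (simp only: dd_mult_cst)

lemma dd_plus:
  "s \<in> R \<Longrightarrow> polyfun f \<Longrightarrow> polyfun g \<Longrightarrow> X.dd s (\<lambda>y. f y + g y) = (\<lambda>y. X.dd s f y + X.dd s g y)"
  using X.dd_add[of s f g] by (simp only: plus_fun_def)

lemma E_add: "s \<in> R \<Longrightarrow> tens m \<Longrightarrow> tens m' \<Longrightarrow>
    E s (\<lambda>y v u. m y v u + m' y v u) = (\<lambda>y v u. E s m y v u + E s m' y v u)"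
  unfolding E_def by (simp only: dd_plus polyfun_tens)

lemma E_scale: "s \<in> R \<Longrightarrow> tens m \<Longrightarrow> E s (\<lambda>y v u. a * m y v u) = (\<lambda>y v u. a * E s m y v u)"
  unfolding E_def by (simp only: dd_cst_mult polyfun_tens)

lemma tens_E:
  assumes s: "s \<in> R" and m: "tens m" shows "tens (E s m)"
  using m
proof (induction rule: tens.induct)
  case (tens_basic f h)
  show ?case unfolding E_basic[OF s tens_basic] by (rule tens.tens_basic[OF X.polyfun_dd[OF s tens_basic]])
next
  case (tens_add m m')
  show ?case unfolding E_add[OF s tens_add.hyps] by (rule tens.tens_add[OF tens_add.IH])
qed

lemma tens_opg: assumes m: "tens m" shows "tens (opg g m)"
proof (cases g)
  case (Grp w)
  show ?thesis
    using m unfolding Grp opg.simps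
  proof (induction rule: tens.induct)
    case (tens_basic f h)
    from tens.tens_basic[OF polyfun_compose[OF tens_basic, of "transpose w"]]
    show ?case .
  next
    case (tens_add m m')
    from tens.tens_add[OF tens_add.IH] show ?case .
  qed
next
  case (Vec x)
  have "tens (\<lambda>y v u. lf x y * m y v u)" by (rule tens_mult[OF m polyfun_lf])
  then show ?thesis by (simp add: Vec lf_apply)
next
  case (Covec \<eta>)
  have "tens (\<lambda>y v u. pairing \<eta> v * m y v u)"
    using m
  proof (induction rule: tens.induct)
    case (tens_basic f h)
    have "tens (\<lambda>y v u. f y * (pairing \<eta> v * h v u))" by (rule tens.tens_basic[OF tens_basic])
    then show ?case by (simp only: mult.left_commute)
  next
    case (tens_add m m')
    from tens.tens_add[OF tens_add.IH] show ?case by (simp only: distrib_left)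
  qed
  then show ?thesis
    unfolding Covec opg.simps using m by (intro tens_diff tens_sum tens_scale tens_E)
qed

lemma opg_add: "tens m \<Longrightarrow> tens m' \<Longrightarrow>
    opg g (\<lambda>y v u. m y v u + m' y v u) = (\<lambda>y v u. opg g m y v u + opg g m' y v u)"
  by (cases g) (simp_all add: E_add algebra_simps sum.distrib cong: sum.cong)

lemma opg_scale: "tens m \<Longrightarrow> opg g (\<lambda>y v u. a * m y v u) = (\<lambda>y v u. a * opg g m y v u)"
  by (cases g) (simp_all add: E_scale algebra_simps sum_distrib_left cong: sum.cong)

lemma tens_foldr: "tens m \<Longrightarrow> tens (foldr opg w m)"
  by (induction w) (auto intro: tens_opg)

lemma foldr_opg_add: "tens m \<Longrightarrow> tens m' \<Longrightarrow>
    foldr opg w (\<lambda>y v u. m y v u + m' y v u) = (\<lambda>y v u. foldr opg w m y v u + foldr opg w m' y v u)"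
  by (induction w) (simp_all add: opg_add tens_foldr del: opg.simps)

lemma foldr_opg_scale: "tens m \<Longrightarrow>
    foldr opg w (\<lambda>y v u. a * m y v u) = (\<lambda>y v u. a * foldr opg w m y v u)"
  by (induction w) (simp_all add: opg_scale tens_foldr del: opg.simps)

definition actp :: "'n cgen free \<Rightarrow> 'n mfun \<Rightarrow> 'n mfun" where
  "actp p m = lext (\<lambda>w a y v u. a * foldr opg w m y v u) p"

lemma actp_add: "actp (p + q) m = (\<lambda>y v u. actp p m y v u + actp q m y v u)"
proof -
  have "actp (p + q) m = actp p m + actp q m"
    unfolding actp_def by (rule lext_add) (simp_all add: fun_eq_iff fun_apply distrib_right)
  then show ?thesis by (simp add: fun_eq_iff fun_apply)
qed

lemma actp_single: "actp (Poly_Mapping.single w a) m = (\<lambda>y v u. a * foldr opg w m y v u)"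
  unfolding actp_def by (rule lext_single) (simp add: fun_eq_iff fun_apply)

lemma actp_gen: "actp (gen g) m = opg g m" and actp_scalar: "actp (scalar a) m = (\<lambda>y v u. a * m y v u)"
  by (simp_all add: gen_def scalar_def actp_single del: opg.simps)

lemma actp_0: "actp 0 m = (\<lambda>y v u. 0)" and actp_1: "actp 1 m = m"
  using actp_scalar[of 0 m] actp_scalar[of 1 m] by (simp_all add: scalar_0 scalar_1)

lemma tens_actp: "tens m \<Longrightarrow> tens (actp p m)"
proof (induction p rule: free_induct)
  case (single w a) then show ?case by (simp only: actp_single) (intro tens_scale tens_foldr)
next
  case (add p q) then show ?case by (simp only: actp_add) (intro tens_add; simp)
qed

lemma actp_add_right: "tens m \<Longrightarrow> tens m' \<Longrightarrow>
    actp p (\<lambda>y v u. m y v u + m' y v u) = (\<lambda>y v u. actp p m y v u + actp p m' y v u)"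
proof (induction p rule: free_induct)
  case (single w a) then show ?case by (simp only: actp_single foldr_opg_add distrib_left)
next
  case (add p q) then show ?case by (simp add: actp_add ac_simps)
qed

lemma actp_scale_right: "tens m \<Longrightarrow> actp p (\<lambda>y v u. a * m y v u) = (\<lambda>y v u. a * actp p m y v u)"
proof (induction p rule: free_induct)
  case (single w b) then show ?case by (simp only: actp_single foldr_opg_scale mult.left_commute)
next
  case (add p q) then show ?case by (simp add: actp_add distrib_left)
qed

lemma actp_mult: "tens m \<Longrightarrow> actp (p * q) m = actp p (actp q m)"
proof (induction q rule: free_induct)
  case (single w b)
  then show ?case
  proof (induction p rule: free_induct)
    case (single w' a)
    then show ?case
      by (simp only: single_mult actp_single foldr_append foldr_opg_scale tens_foldr mult.assoc o_apply)
  next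
    case (add p q) then show ?case by (simp add: distrib_right actp_add)
  qed
next
  case (add q q')
  then show ?case by (simp add: distrib_left actp_add actp_add_right tens_actp)
qed

lemma actp_diff: "actp (p - q) m = (\<lambda>y v u. actp p m y v u - actp q m y v u)"
  using actp_add[of "p - q" q m] by (simp add: fun_eq_iff)

lemma actp_sum: "actp (\<Sum>i\<in>I. p i) m = (\<lambda>y v u. \<Sum>i\<in>I. actp (p i) m y v u)"
  by (induction I rule: infinite_finite_induct) (simp_all add: actp_0 actp_add)

lemma is_ideal_annihilator: "is_ideal {p. \<forall>m. tens m \<longrightarrow> actp p m = (\<lambda>y v u. 0)}"
proof -
  have "actp p (\<lambda>y v u. 0) = (\<lambda>y v u. 0)" for p
    using actp_scale_right[OF tens_zero, of p 0] by simp
  then show ?thesis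
    by (auto simp: is_ideal_def actp_0 actp_add actp_mult tens_actp)
qed

section \<open>The defining relations hold on the module\<close>

lemma transpose_mult_vec: "transpose (w ** w') *v y = transpose w' *v (transpose w *v y)"
  for w w' :: "complex ^ 'n ^ 'n"
  by (simp only: matrix_transpose_mul matrix_vector_mul_assoc)

lemma opg_Grp_one: "opg (Grp (mat 1)) m = m"
  by (simp add: inv_one transpose_mat)

lemma opg_Grp_mult: "w \<in> W \<Longrightarrow> w' \<in> W \<Longrightarrow> opg (Grp w) (opg (Grp w') m) = opg (Grp (w ** w')) m"
  by (simp only: opg.simps inv_mult transpose_mult_vec matrix_vector_mul_assoc matrix_mul_assoc)

lemma opg_Vec_linear:
  "opg (Vec (x + x')) m = (\<lambda>y v u. opg (Vec x) m y v u + opg (Vec x') m y v u)"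
  "opg (Vec (a *s x)) m = (\<lambda>y v u. a * opg (Vec x) m y v u)"
  by (simp_all only: opg.simps pairing_add_right pairing_scale_right distrib_right mult.assoc)

lemma opg_Covec_linear:
  "opg (Covec (x + x')) m = (\<lambda>y v u. opg (Covec x) m y v u + opg (Covec x') m y v u)"
  "opg (Covec (a *s x)) m = (\<lambda>y v u. a * opg (Covec x) m y v u)"
  unfolding opg.simps pairing_add_left pairing_scale_left
  by (simp_all add: fun_eq_iff algebra_simps add_divide_distrib sum.distrib sum_distrib_left)

lemma opg_Vec_commute: "opg (Vec x) (opg (Vec x') m) = opg (Vec x') (opg (Vec x) m)"
  by (simp add: mult.left_commute)

lemma opg_Grp_Vec: "opg (Grp w) (opg (Vec x) m) = opg (Vec (w *v x)) (opg (Grp w) m)"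
  by (simp only: opg.simps pairing_matrix transpose_matrix_vector)

text \<open>Conjugation by \<open>w\<close> carries the divided difference of \<open>s\<close> to
  that of the conjugate reflection, up to the factor by which the two chosen root forms
  differ.\<close>

lemma dd_conj:
  assumes w: "w \<in> W" and s: "s \<in> R" and f: "polyfun f" and mu: "w *v \<alpha>' s = \<mu> *s \<alpha>' (w ** s ** matrix_inv w)"
  shows "X.dd (w ** s ** matrix_inv w) (X.act w f) = cst \<mu> * X.act w (X.dd s f)"
proof (rule X.dd_eqI[OF conj_R[OF w s] X.polyfun_act[OF f]])
  let ?t = "w ** s ** matrix_inv w"
  have tw: "?t ** w = w ** s"
    using inv_left[OF w] by (simp flip: matrix_mul_assoc)
  have mult: "X.act (a ** b) f = X.act a (X.act b f)" if "a \<in> W" "b \<in> W" for a b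
    using X.act_mult[of a b f] that by (simp add: GL_def)
  have "X.act ?t (X.act w f) = X.act w (X.act s f)"
    using mult[of ?t w] mult[of w s] w s R_W conj_R[OF w s] tw by auto
  then have "X.act w f - X.act ?t (X.act w f) = X.act w (f - X.act s f)" by (simp only: X.act_diff)
  also have "\<dots> = X.act w (lf (\<alpha>' s)) * X.act w (X.dd s f)"
    by (simp only: X.dd_eq[OF s f] X.act_times)
  also have "X.act w (lf (\<alpha>' s)) = lf (w *v \<alpha>' s)"
    by (simp only: X.act_def lf_def pairing_matrix transpose_matrix_vector)
  also have "\<dots> = cst \<mu> * lf (\<alpha>' ?t)" by (simp only: mu lf_scale)
  finally show "X.act w f - X.act ?t (X.act w f) = lf (\<alpha>' ?t) * (cst \<mu> * X.act w (X.dd s f))"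
    by (simp only: ac_simps)
qed (intro polyfun_mult polyfun_cst X.polyfun_act X.polyfun_dd s f)

lemma bij_conj: "w \<in> W \<Longrightarrow> bij_betw (\<lambda>s. w ** s ** matrix_inv w) R R"
proof (rule bij_betwI[where g = "\<lambda>s. matrix_inv w ** s ** w"])
  assume w: "w \<in> W"
  show "(\<lambda>s. w ** s ** matrix_inv w) \<in> R \<rightarrow> R" using conj_R[OF w] by blast
  show "(\<lambda>s. matrix_inv w ** s ** w) \<in> R \<rightarrow> R" using conj_R[OF W_inv[OF w]] by (simp add: inv_inv[OF w])
  fix s
  have "matrix_inv w ** (w ** s ** matrix_inv w) ** w = (matrix_inv w ** w) ** s ** (matrix_inv w ** w)"
    by (simp only: matrix_mul_assoc)
  then show "matrix_inv w ** (w ** s ** matrix_inv w) ** w = s" by (simp only: inv_left[OF w] matrix_mul_lid matrix_mul_rid)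
  have "w ** (matrix_inv w ** s ** w) ** matrix_inv w = (w ** matrix_inv w) ** s ** (w ** matrix_inv w)"
    by (simp only: matrix_mul_assoc)
  then show "w ** (matrix_inv w ** s ** w) ** matrix_inv w = s" by (simp only: inv_right[OF w] matrix_mul_lid matrix_mul_rid)
qed

text \<open>The sum is reindexed by conjugation with \<open>w\<close>. The factor from
  \<open>dd_conj\<close> cancels against the one in the pairing with the coroot, while
  \<open>c\<close> and \<open>kap\<close> agree on conjugate reflections.\<close>

lemma opg_Grp_Covec:
  assumes w: "w \<in> W" and m: "tens m"
  shows "opg (Grp w) (opg (Covec \<eta>) m) = opg (Covec (dual_act w \<eta>)) (opg (Grp w) m)"
proof (intro ext)
  fix y v u
  have trm: "c t * pairing (dual_act w \<eta>) (\<alpha>' t) / kap t * E t (opg (Grp w) m) y v u =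
      c s * pairing \<eta> (\<alpha>' s) / kap s * E s m (transpose w *v y) (matrix_inv w *v v) (matrix_inv w ** u)"
    if s: "s \<in> R" and t: "t = w ** s ** matrix_inv w" for s t
  proof -
    obtain \<mu> where mu: "\<mu> \<noteq> 0" "w *v \<alpha>' s = \<mu> *s \<alpha>' t" using conj_root(2)[OF w s] t by blast
    have "matrix_inv w ** matrix_inv t = matrix_inv (t ** w)"
      using inv_mult[of t w] conj_R[OF w s] R_W w t by simp
    also have "t ** w = w ** s" using inv_left[OF w] by (simp add: t flip: matrix_mul_assoc)
    also have "matrix_inv (w ** s) = matrix_inv s ** matrix_inv w" using inv_mult w s R_W by simp
    finally have ti: "matrix_inv w ** matrix_inv t = matrix_inv s ** matrix_inv w" .
    define f where "f = (\<lambda>y. m y (matrix_inv s *v (matrix_inv w *v v)) (matrix_inv s ** (matrix_inv w ** u)))"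
    have f: "polyfun f" unfolding f_def by (rule polyfun_tens[OF m])
    have "E t (opg (Grp w) m) y v u = X.dd t (X.act w f) y"
      by (simp only: E_def opg.simps X.act_def f_def matrix_vector_mul_assoc matrix_mul_assoc ti)
    also have "\<dots> = \<mu> * X.dd s f (transpose w *v y)"
      using dd_conj[OF w s f, of \<mu>] mu(2) by (simp only: t fun_apply X.act_def)
    finally have 1: "E t (opg (Grp w) m) y v u =
        \<mu> * E s m (transpose w *v y) (matrix_inv w *v v) (matrix_inv w ** u)"
      by (simp only: E_def f_def)
    have "pairing \<eta> (\<alpha>' s) = pairing \<eta> (matrix_inv w *v (w *v \<alpha>' s))" by (simp only: inv_left'[OF w])
    also have "\<dots> = \<mu> * pairing (dual_act w \<eta>) (\<alpha>' t)"
      by (simp only: mu(2) vector_scalar_commute pairing_scale_right pairing_dual_act)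
    finally have 2: "pairing \<eta> (\<alpha>' s) = \<mu> * pairing (dual_act w \<eta>) (\<alpha>' t)" .
    have 3: "kap t = kap s" using conj_root(1)[OF w s] t by simp
    have 4: "c t = c s" using c_conj w s t by blast
    show ?thesis unfolding 1 2 3 4 by simp
  qed
  have "(\<Sum>t\<in>R. c t * pairing (dual_act w \<eta>) (\<alpha>' t) / kap t * E t (opg (Grp w) m) y v u) =
    (\<Sum>s\<in>R. c s * pairing \<eta> (\<alpha>' s) / kap s * E s m (transpose w *v y) (matrix_inv w *v v) (matrix_inv w ** u))"
    by (subst sum.reindex_bij_betw[OF bij_conj[OF w], symmetric]) (intro sum.cong refl trm)
  then show "opg (Grp w) (opg (Covec \<eta>) m) y v u = opg (Covec (dual_act w \<eta>)) (opg (Grp w) m) y v u"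
    by (simp only: opg.simps pairing_dual_act)
qed

text \<open>The Leibniz rule for \<open>lf x * f\<close> leaves, beside multiplication by
  \<open>x\<close>, a term in which \<open>s\<close> acts on all three arguments: this is
  \<open>opg (Grp s)\<close>. Its factor \<open>kap s\<close> cancels the denominator in the action
  of covectors.\<close>

lemma opg_Vec_Covec:
  assumes m: "tens m"
  shows "opg (Vec x) (opg (Covec \<eta>) m) y v u = opg (Covec \<eta>) (opg (Vec x) m) y v u +
    (\<Sum>s\<in>R. c s * pairing \<eta> (\<alpha>' s) * pairing (\<alpha> s) x * opg (Grp s) m y v u)"
proof -
  have "E s (opg (Vec x) m) y v u = pairing y x * E s m y v u + kap s * pairing (\<alpha> s) x * opg (Grp s) m y v u"
    if s: "s \<in> R" for s
  proof -
    define f where "f = (\<lambda>y. m y (matrix_inv s *v v) (matrix_inv s ** u))"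
    have f: "polyfun f" unfolding f_def by (rule polyfun_tens[OF m])
    have "E s (opg (Vec x) m) y v u = X.dd s (lf x * f) y"
      by (simp only: E_def opg.simps f_def times_fun_def lf_def)
    also have "\<dots> = lf x y * X.dd s f y + X.dd s (lf x) y * X.act s f y"
      by (simp only: X.dd_mult[OF s polyfun_lf f] fun_apply)
    also have "\<dots> = pairing y x * E s m y v u + kap s * pairing (\<alpha> s) x * opg (Grp s) m y v u"
      by (simp only: X.dd_lf[OF s] cst_apply lf_apply E_def opg.simps X.act_def f_def pairing_scale_left)
    finally show ?thesis .
  qed
  then have "(\<Sum>s\<in>R. c s * pairing \<eta> (\<alpha>' s) / kap s * E s (opg (Vec x) m) y v u) =
     (\<Sum>s\<in>R. pairing y x * (c s * pairing \<eta> (\<alpha>' s) / kap s * E s m y v u) +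
        c s * pairing \<eta> (\<alpha>' s) * pairing (\<alpha> s) x * opg (Grp s) m y v u)"
    using kap_nz by (intro sum.cong refl) (simp add: field_simps del: opg.simps)
  then show ?thesis
    unfolding opg.simps(2,3) sum.distrib sum_distrib_left[symmetric]
    by (simp add: algebra_simps del: opg.simps)
qed

definition Ecomm :: "complex ^ 'n \<Rightarrow> complex ^ 'n \<Rightarrow> 'n mfun \<Rightarrow> 'n mfun" where
  "Ecomm \<eta> \<eta>' m = (\<lambda>y v u. opg (Covec \<eta>) (opg (Covec \<eta>') m) y v u - opg (Covec \<eta>') (opg (Covec \<eta>) m) y v u)"

lemma opg_sum: "finite I \<Longrightarrow> (\<And>i. i \<in> I \<Longrightarrow> tens (f i)) \<Longrightarrow>
    opg g (\<lambda>y v u. \<Sum>i\<in>I. a i * f i y v u) = (\<lambda>y v u. \<Sum>i\<in>I. a i * opg g (f i) y v u)"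
proof (induction I rule: finite_induct)
  case empty
  show ?case using opg_scale[OF tens_zero, of g 0] by simp
next
  case (insert i I)
  have "opg g (\<lambda>y v u. \<Sum>i\<in>insert i I. a i * f i y v u) =
      opg g (\<lambda>y v u. a i * f i y v u + (\<Sum>i\<in>I. a i * f i y v u))"
    using insert.hyps by simp
  also have "\<dots> = (\<lambda>y v u. opg g (\<lambda>y v u. a i * f i y v u) y v u + opg g (\<lambda>y v u. \<Sum>i\<in>I. a i * f i y v u) y v u)"
    using insert.prems by (intro opg_add tens_scale tens_sum) auto
  finally show ?case using insert by (simp add: opg_scale del: opg.simps)
qed

text \<open>Carrying \<open>x\<close> out of both covectors leaves terms that are symmetric in
  \<open>\<eta>\<close> and \<open>\<eta>'\<close> and so disappear from the commutator. Two of the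
  sums are exchanged with each other; the third, from moving \<open>s\<close> past a covector,
  contains the product of both pairings with the coroot.\<close>

lemma Ecomm_Vec:
  assumes m: "tens m"
  shows "Ecomm \<eta> \<eta>' (opg (Vec x) m) = opg (Vec x) (Ecomm \<eta> \<eta>' m)"
proof -
  define a where "a \<eta> s = c s * pairing \<eta> (\<alpha>' s) * pairing (\<alpha> s) x" for \<eta> s
  have VC: "opg (Covec \<eta>) (opg (Vec x) m) = (\<lambda>y v u. opg (Vec x) (opg (Covec \<eta>) m) y v u +
      (\<Sum>s\<in>R. - a \<eta> s * opg (Grp s) m y v u))" if "tens m" for \<eta> m
    using opg_Vec_Covec[OF that, of x \<eta>] by (simp add: fun_eq_iff a_def sum_negf del: opg.simps)
  \<comment> \<open>Exchanging \<open>s\<close> with a covector replaces the covector by its image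
    under \<open>dual_act s\<close>, which differs from it by a multiple of
    \<open>\<alpha> s\<close>.\<close>
  have CG: "opg (Covec \<eta>') (opg (Grp s) m) =
      (\<lambda>y v u. opg (Grp s) (opg (Covec \<eta>') m) y v u +
        kap' s * pairing \<eta>' (\<alpha>' s) * opg (Covec (\<alpha> s)) (opg (Grp s) m) y v u)" if s: "s \<in> R" for s \<eta>'
  proof -
    let ?k = "kap' s * pairing \<eta>' (\<alpha>' s)"
    have "opg (Grp s) (opg (Covec \<eta>') m) = opg (Covec (\<eta>' + (- ?k) *s \<alpha> s)) (opg (Grp s) m)"
      using opg_Grp_Covec[OF R_W[OF s] m, of \<eta>'] by (simp add: dual_act_refl[OF s] vector_smult_lneg del: opg.simps)
    then show ?thesis by (simp only: opg_Covec_linear) (simp add: fun_eq_iff del: opg.simps)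
  qed
  have main: "opg (Covec \<eta>) (opg (Covec \<eta>') (opg (Vec x) m)) y v u =
      opg (Vec x) (opg (Covec \<eta>) (opg (Covec \<eta>') m)) y v u
      - (\<Sum>s\<in>R. a \<eta> s * opg (Grp s) (opg (Covec \<eta>') m) y v u)
      - (\<Sum>s\<in>R. a \<eta>' s * opg (Grp s) (opg (Covec \<eta>) m) y v u)
      - (\<Sum>s\<in>R. a \<eta>' s * (kap' s * pairing \<eta> (\<alpha>' s) * opg (Covec (\<alpha> s)) (opg (Grp s) m) y v u))"
    for \<eta> \<eta>' y v u
  proof -
    have "opg (Covec \<eta>) (opg (Covec \<eta>') (opg (Vec x) m)) =
        opg (Covec \<eta>) (\<lambda>y v u. opg (Vec x) (opg (Covec \<eta>') m) y v u +
          (\<Sum>s\<in>R. - a \<eta>' s * opg (Grp s) m y v u))" by (simp only: VC[OF m])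
    also have "\<dots> = (\<lambda>y v u. opg (Covec \<eta>) (opg (Vec x) (opg (Covec \<eta>') m)) y v u +
        opg (Covec \<eta>) (\<lambda>y v u. \<Sum>s\<in>R. - a \<eta>' s * opg (Grp s) m y v u) y v u)"
      by (intro opg_add tens_opg tens_sum tens_scale m)
    also have "opg (Covec \<eta>) (\<lambda>y v u. \<Sum>s\<in>R. - a \<eta>' s * opg (Grp s) m y v u) =
        (\<lambda>y v u. \<Sum>s\<in>R. - a \<eta>' s * opg (Covec \<eta>) (opg (Grp s) m) y v u)"
      by (intro opg_sum finite_R tens_opg m)
    finally have eq: "opg (Covec \<eta>) (opg (Covec \<eta>') (opg (Vec x) m)) y v u =
        opg (Vec x) (opg (Covec \<eta>) (opg (Covec \<eta>') m)) y v u +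
        (\<Sum>s\<in>R. - a \<eta> s * opg (Grp s) (opg (Covec \<eta>') m) y v u) +
        (\<Sum>s\<in>R. - a \<eta>' s * opg (Covec \<eta>) (opg (Grp s) m) y v u)"
      by (simp only: VC[OF tens_opg[OF m]])
    have "(\<Sum>s\<in>R. - a \<eta>' s * opg (Covec \<eta>) (opg (Grp s) m) y v u) =
      (\<Sum>s\<in>R. - (a \<eta>' s * opg (Grp s) (opg (Covec \<eta>) m) y v u)
        - a \<eta>' s * (kap' s * pairing \<eta> (\<alpha>' s) * opg (Covec (\<alpha> s)) (opg (Grp s) m) y v u))"
    proof (intro sum.cong refl)
      fix s assume "s \<in> R"
      from fun_cong[OF fun_cong[OF fun_cong[OF CG[OF this, of \<eta>]]], of y v u]
      have "opg (Covec \<eta>) (opg (Grp s) m) y v u = opg (Grp s) (opg (Covec \<eta>) m) y v u +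
        kap' s * pairing \<eta> (\<alpha>' s) * opg (Covec (\<alpha> s)) (opg (Grp s) m) y v u" .
      then show "- a \<eta>' s * opg (Covec \<eta>) (opg (Grp s) m) y v u =
          - (a \<eta>' s * opg (Grp s) (opg (Covec \<eta>) m) y v u)
          - a \<eta>' s * (kap' s * pairing \<eta> (\<alpha>' s) * opg (Covec (\<alpha> s)) (opg (Grp s) m) y v u)"
        by (simp only:) (simp only: distrib_left minus_mult_left diff_conv_add_uminus)
    qed
    then show ?thesis unfolding eq by (simp add: sum_negf sum_subtractf del: opg.simps)
  qed
  have sym: "(\<Sum>s\<in>R. a \<eta>' s * (kap' s * pairing \<eta> (\<alpha>' s) * opg (Covec (\<alpha> s)) (opg (Grp s) m) y v u)) =
    (\<Sum>s\<in>R. a \<eta> s * (kap' s * pairing \<eta>' (\<alpha>' s) * opg (Covec (\<alpha> s)) (opg (Grp s) m) y v u))" for y v u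
    by (intro sum.cong refl) (simp add: a_def del: opg.simps)
  show ?thesis
    unfolding Ecomm_def
  proof (intro ext)
    fix y v u
    have V: "opg (Vec x) (\<lambda>y v u. p y v u - q y v u) y v u = opg (Vec x) p y v u - opg (Vec x) q y v u"
      for p q by (simp add: right_diff_distrib)
    show "opg (Covec \<eta>) (opg (Covec \<eta>') (opg (Vec x) m)) y v u -
        opg (Covec \<eta>') (opg (Covec \<eta>) (opg (Vec x) m)) y v u =
      opg (Vec x) (\<lambda>y v u. opg (Covec \<eta>) (opg (Covec \<eta>') m) y v u - opg (Covec \<eta>') (opg (Covec \<eta>) m) y v u) y v u"
      unfolding main V using sym[of y v u] by (simp del: opg.simps)
  qed
qed

lemma Ecomm_add: "tens m \<Longrightarrow> tens m' \<Longrightarrow>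
    Ecomm \<eta> \<eta>' (\<lambda>y v u. m y v u + m' y v u) = (\<lambda>y v u. Ecomm \<eta> \<eta>' m y v u + Ecomm \<eta> \<eta>' m' y v u)"
  unfolding Ecomm_def by (simp only: opg_add tens_opg) (simp add: algebra_simps del: opg.simps)

lemma Ecomm_scale: "tens m \<Longrightarrow> Ecomm \<eta> \<eta>' (\<lambda>y v u. a * m y v u) = (\<lambda>y v u. a * Ecomm \<eta> \<eta>' m y v u)"
  unfolding Ecomm_def by (simp only: opg_scale tens_opg right_diff_distrib)

lemma opg_Covec_const: "opg (Covec \<eta>) (\<lambda>y v u. h v u) = (\<lambda>y v u. pairing \<eta> v * h v u)"
proof -
  have "E s (\<lambda>y v u. h v u) = (\<lambda>y v u. 0)" if s: "s \<in> R" for s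
    using E_basic[OF s polyfun_1, of h] X.dd_cst[OF s, of 1] by (simp add: fun_apply cst_1)
  then show ?thesis by simp
qed

text \<open>The commutator of two covectors is linear over \<open>S(V)\<close> and kills the generators \<open>1 \<otimes> h\<close>.\<close>

lemma opg_Covec_commute:
  assumes "tens m"
  shows "opg (Covec \<eta>) (opg (Covec \<eta>') m) = opg (Covec \<eta>') (opg (Covec \<eta>) m)"
proof -
  have mult: "Ecomm \<eta> \<eta>' (\<lambda>y v u. f y * m y v u) = (\<lambda>y v u. 0)"
    if "polyfun f" "tens m" "Ecomm \<eta> \<eta>' m = (\<lambda>y v u. 0)" for f m
    using that
  proof (induction arbitrary: m rule: polyfun.induct)
    case (polyfun_cst a) then show ?case by (simp only: cst_apply Ecomm_scale mult_zero_right)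
  next
    case (polyfun_lf x)
    then show ?case using Ecomm_Vec[of m \<eta> \<eta>' x] by (simp add: lf_apply)
  next
    case (polyfun_add f g)
    then have "Ecomm \<eta> \<eta>' (\<lambda>y v u. f y * m y v u + g y * m y v u) = (\<lambda>y v u. 0)"
      by (simp only: Ecomm_add tens_mult add_0)
    then show ?case by (simp only: plus_fun_apply distrib_right)
  next
    case (polyfun_mult f g)
    have "Ecomm \<eta> \<eta>' (\<lambda>y v u. f y * (g y * m y v u)) = (\<lambda>y v u. 0)"
      using polyfun_mult by (intro polyfun_mult.IH(1) tens_mult) auto
    then show ?case by (simp only: times_fun_apply mult.assoc)
  qed
  have const: "Ecomm \<eta> \<eta>' (\<lambda>y v u. h v u) = (\<lambda>y v u. 0)" for h
    unfolding Ecomm_def opg_Covec_const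
    by (simp add: mult.left_commute)
  have th: "tens (\<lambda>y v u. h v u)" for h :: "complex ^ 'n \<Rightarrow> complex ^ 'n ^ 'n \<Rightarrow> complex"
    using tens_basic[OF polyfun_1, of h] by (simp add: fun_apply)
  have "Ecomm \<eta> \<eta>' m = (\<lambda>y v u. 0)"
    using assms
  proof (induction rule: tens.induct)
    case (tens_basic f h)
    show ?case by (rule mult[OF tens_basic th const])
  next
    case (tens_add m m')
    then show ?case by (simp only: Ecomm_add add_0)
  qed
  then show ?thesis by (simp add: Ecomm_def fun_eq_iff del: opg.simps)
qed

lemma cherednik_relators_annihilate:
  assumes p: "p \<in> cherednik_relators W c \<alpha> \<alpha>'" and m: "tens m"
  shows "actp p m = (\<lambda>y v u. 0)"
proof -
  have mult: "actp (gen g * gen g') m = opg g (opg g' m)" for g g'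
    using m by (simp only: actp_mult actp_gen)
  have mult3: "actp (gen g * gen g' * gen g'') m = opg g (opg g' (opg g'' m))" for g g' g''
    using m by (simp only: actp_mult actp_gen tens_opg)
  have smult: "actp (scalar a * gen g) m = (\<lambda>y v u. a * opg g m y v u)" for a g
    using m by (simp only: actp_mult actp_gen actp_scalar)
  have inv_cancel: "opg (Grp w) (opg (Grp (matrix_inv w)) m) = m" if "w \<in> W" for w
    using that by (simp only: opg_Grp_mult W_inv inv_right opg_Grp_one)
  show ?thesis
    using p unfolding cherednik_relators_def linear_relators_def group_relators_def
      conjugation_relators_def commutator_relators_def
  proof (elim UnE CollectE exE conjE singletonE; hypsubst)
    fix w x assume w: "w \<in> W"
    show "actp (gr w * gen (Vec x) * gr (matrix_inv w) - gen (Vec (w *v x))) m = (\<lambda>y v u. 0)"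
      using w by (simp only: actp_diff mult3 actp_gen opg_Grp_Vec inv_cancel diff_self)
    show "actp (gr w * gen (Covec x) * gr (matrix_inv w) - gen (Covec (dual_act w x))) m = (\<lambda>y v u. 0)"
      using w by (simp only: actp_diff mult3 actp_gen opg_Grp_Covec tens_opg[OF m] inv_cancel diff_self)
  next
    fix x y
    show "actp (gen (Vec x) * gen (Covec y) - gen (Covec y) * gen (Vec x) -
        (\<Sum>s\<in>R. scalar (c s * pairing y (\<alpha>' s) * pairing (\<alpha> s) x) * gr s)) m = (\<lambda>y v u. 0)"
      unfolding actp_diff actp_sum mult smult opg_Vec_Covec[OF m] by simp
  qed (simp_all only: actp_diff actp_add mult smult actp_gen actp_1 opg_Vec_linear opg_Covec_linear
      opg_Grp_one opg_Grp_mult opg_Vec_commute opg_Covec_commute[OF m] diff_self)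
qed

lemma Jx_annihilates:
  assumes "p \<in> Jx" "tens m" shows "actp (res (cherednik_gens W) p) m = (\<lambda>y v u. 0)"
proof -
  have "cherednik_ideal W c \<alpha> \<alpha>' \<subseteq> {p. \<forall>m. tens m \<longrightarrow> actp p m = (\<lambda>y v u. 0)}"
    unfolding cherednik_ideal_def
    using cherednik_relators_annihilate
    by (intro genideal_free_subset is_ideal_annihilator cherednik_relators_closed subgroup_W) auto
  then show ?thesis using assms by (auto simp: Jx_def)
qed

end

section \<open>Normal forms\<close>

context cherednik
begin

lemma carrier_GW: "w \<in> carrier GW \<longleftrightarrow> w \<in> W" and mult_GW: "w \<otimes>\<^bsub>GW\<^esub> w' = w ** w'"
  and one_GW: "\<one>\<^bsub>GW\<^esub> = mat 1"
  by (simp_all add: GL_def)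

fun valid_term :: "(complex ^ 'n \<Rightarrow> complex) \<times> (complex ^ 'n \<Rightarrow> complex) \<times> (complex ^ 'n ^ 'n) \<Rightarrow> bool" where
  "valid_term (f, g, w) \<longleftrightarrow> polyfun f \<and> polyfun g \<and> w \<in> W"

fun nft where
  "nft (f, g, w) = X.emb f * Y.emb g * gr w"

text \<open>Lists of terms are formal sums: nothing is reduced or collected, and one element has
  many lists. This is why \<open>tr_zero\<close> has to precede the definition of the trace on
  elements.\<close>

definition nf where "nf L = (\<Sum>t\<leftarrow>L. nft t)"

definition valid where "valid L \<longleftrightarrow> (\<forall>t \<in> set L. valid_term t)"

definition normal where "normal p \<longleftrightarrow> (\<exists>L. valid L \<and> p \<doteq> nf L)"

lemma nf_simps: "nf [] = 0" "nf (t # L) = nft t + nf L" "nf (L @ M) = nf L + nf M"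
  by (simp_all add: nf_def)

lemma valid_simps: "valid []" "valid (t # L) \<longleftrightarrow> valid_term t \<and> valid L" "valid (L @ M) \<longleftrightarrow> valid L \<and> valid M"
  by (auto simp: valid_def)

lemma normal_cong: "p \<doteq> q \<Longrightarrow> normal q \<Longrightarrow> normal p"
  unfolding normal_def using cong_trans by blast

lemma normal_0: "normal 0"
  unfolding normal_def by (rule exI[of _ "[]"]) (simp add: nf_simps valid_simps)

lemma normal_add: "normal p \<Longrightarrow> normal q \<Longrightarrow> normal (p + q)"
  unfolding normal_def by (metis cong_add nf_simps(3) valid_simps(3))

lemma normal_basic: "polyfun f \<Longrightarrow> polyfun g \<Longrightarrow> w \<in> W \<Longrightarrow> normal (X.emb f * Y.emb g * gr w)"
  unfolding normal_def by (rule exI[of _ "[(f, g, w)]"]) (simp add: nf_simps valid_simps)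

lemma normal_sum: "(\<And>i. i \<in> I \<Longrightarrow> normal (f i)) \<Longrightarrow> normal (\<Sum>i\<in>I. f i)"
  by (induction I rule: infinite_finite_induct) (auto intro: normal_0 normal_add)

lemma scalar_basic: "polyfun f \<Longrightarrow> scalar a * (X.emb f * Y.emb g * gr w) \<doteq> X.emb (cst a * f) * Y.emb g * gr w"
  using cong_rmult[OF cong_rmult[OF cong_sym[OF X.emb_cst_mult]]] by (simp add: mult.assoc)

lemma Vec_basic:
  assumes f: "polyfun f"
  shows "gen (Vec x) * (X.emb f * Y.emb g * gr w) \<doteq> X.emb (lf x * f) * Y.emb g * gr w"
proof -
  have "gen (Vec x) * X.emb f \<doteq> X.emb (lf x) * X.emb f" by (intro cong_rmult cong_sym[OF X.emb_lf])
  also have "\<dots> \<doteq> X.emb (lf x * f)" using f by (intro cong_sym[OF X.emb_mult] polyfun_lf)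
  finally show ?thesis using cong_rmult[OF cong_rmult] by (simp add: mult.assoc[symmetric])
qed

lemma Grp_basic:
  assumes f: "polyfun f" and g: "polyfun g" and w: "w \<in> W" "w' \<in> W"
  shows "gr w' * (X.emb f * Y.emb g * gr w) \<doteq> X.emb (X.act w' f) * Y.emb (Y.act w' g) * gr (w' ** w)"
proof -
  have "gr w' * (X.emb f * Y.emb g * gr w) = (gr w' * X.emb f) * (Y.emb g * gr w)" by (simp add: mult.assoc)
  also have "\<dots> \<doteq> (X.emb (X.act w' f) * gr w') * (Y.emb g * gr w)"
    using X.gamma_emb[of w' f] f w by (intro cong_rmult) (simp add: carrier_GW)
  also have "\<dots> = X.emb (X.act w' f) * (gr w' * Y.emb g) * gr w" by (simp add: mult.assoc)
  also have "\<dots> \<doteq> X.emb (X.act w' f) * (Y.emb (Y.act w' g) * gr w') * gr w"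
    using Y.gamma_emb[of w' g] g w by (intro cong_rmult cong_lmult) (simp add: carrier_GW)
  also have "\<dots> = X.emb (X.act w' f) * Y.emb (Y.act w' g) * (gr w' * gr w)" by (simp add: mult.assoc)
  also have "\<dots> \<doteq> X.emb (X.act w' f) * Y.emb (Y.act w' g) * gr (w' ** w)"
    using w by (intro cong_lmult gr_mult)
  finally show ?thesis .
qed

definition kx :: "complex ^ 'n \<Rightarrow> complex ^ 'n ^ 'n \<Rightarrow> complex" where
  "kx \<eta> s = c s * pairing \<eta> (\<alpha>' s) / kap s"

definition ky :: "complex ^ 'n \<Rightarrow> complex ^ 'n ^ 'n \<Rightarrow> complex" where
  "ky x s = - c s * pairing (\<alpha> s) x / kap' s"

lemma Covec_basic:
  assumes f: "polyfun f" and g: "polyfun g" and w: "w \<in> W"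
  shows "gen (Covec \<eta>) * (X.emb f * Y.emb g * gr w) \<doteq>
    X.emb f * Y.emb (lf \<eta> * g) * gr w -
    (\<Sum>s\<in>R. scalar (kx \<eta> s) * (X.emb (X.dd s f) * Y.emb (Y.act s g) * gr (s ** w)))"
proof -
  let ?b = "gen (Covec \<eta>)"
  let ?S = "\<Sum>s\<in>R. scalar (kx \<eta> s) * X.emb (X.dd s f) * gr s"
  have "X.emb f * ?b - ?b * X.emb f \<doteq> ?S" using X_Covec[OF f] by (simp add: kx_def)
  then have "X.emb f * ?b - (X.emb f * ?b - ?b * X.emb f) \<doteq> X.emb f * ?b - ?S"
    by (intro cong_diff cong_refl)
  then have 1: "?b * X.emb f \<doteq> X.emb f * ?b - ?S" by simp
  have 2: "?b * Y.emb g \<doteq> Y.emb (lf \<eta> * g)"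
    using cong_trans[OF cong_rmult[OF cong_sym[OF Y.emb_lf]] cong_sym[OF Y.emb_mult[OF polyfun_lf g]]] .
  have "?b * (X.emb f * Y.emb g * gr w) = (?b * X.emb f) * (Y.emb g * gr w)" by (simp add: mult.assoc)
  also have "\<dots> \<doteq> (X.emb f * ?b - ?S) * (Y.emb g * gr w)" by (rule cong_rmult[OF 1])
  also have "\<dots> = X.emb f * (?b * Y.emb g) * gr w -
      (\<Sum>s\<in>R. scalar (kx \<eta> s) * (X.emb (X.dd s f) * (gr s * Y.emb g) * gr w))"
    by (simp add: left_diff_distrib sum_distrib_right mult.assoc)
  also have "\<dots> \<doteq> X.emb f * Y.emb (lf \<eta> * g) * gr w -
      (\<Sum>s\<in>R. scalar (kx \<eta> s) * (X.emb (X.dd s f) * Y.emb (Y.act s g) * gr (s ** w)))"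
  proof (intro cong_diff cong_sum cong_lmult)
    show "X.emb f * (?b * Y.emb g) * gr w \<doteq> X.emb f * Y.emb (lf \<eta> * g) * gr w"
      by (intro cong_rmult cong_lmult 2)
    fix s assume s: "s \<in> R"
    have "X.emb (X.dd s f) * (gr s * Y.emb g) * gr w \<doteq> X.emb (X.dd s f) * (Y.emb (Y.act s g) * gr s) * gr w"
      using Y.gamma_emb[of s g] g R_W[OF s] by (intro cong_rmult cong_lmult) (simp add: carrier_GW)
    also have "\<dots> = X.emb (X.dd s f) * Y.emb (Y.act s g) * (gr s * gr w)" by (simp add: mult.assoc)
    also have "\<dots> \<doteq> X.emb (X.dd s f) * Y.emb (Y.act s g) * gr (s ** w)"
      using w R_W[OF s] by (intro cong_lmult gr_mult)
    finally show "X.emb (X.dd s f) * (gr s * Y.emb g) * gr w \<doteq> \<dots>" .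
  qed
  finally show ?thesis .
qed

lemma normal_scalar_basic:
  "polyfun f \<Longrightarrow> polyfun g \<Longrightarrow> w \<in> W \<Longrightarrow> normal (scalar a * (X.emb f * Y.emb g * gr w))"
  by (rule normal_cong[OF scalar_basic]) (auto intro: normal_basic polyfun_intros)

lemma normal_uminus: "normal p \<Longrightarrow> normal (- p)"
proof -
  assume "normal p"
  then obtain L where L: "valid L" "p \<doteq> nf L" by (auto simp: normal_def)
  have "normal (- nf L)"
    using L(1)
  proof (induction L)
    case (Cons t L)
    obtain f g w where t: "t = (f, g, w)" by (cases t) auto
    have "normal (scalar (- 1) * nft t)" using Cons.prems by (simp add: t valid_simps normal_scalar_basic)
    then have "normal (- nft t)" by (simp add: scalar_minus scalar_1)
    from normal_add[OF this Cons.IH] show ?case using Cons.prems by (simp add: valid_simps nf_simps)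
  qed (simp add: nf_simps normal_0)
  then show ?thesis using cong_uminus[OF L(2)] normal_cong by blast
qed

lemma normal_gen_basic:
  assumes f: "polyfun f" and g: "polyfun g" and w: "w \<in> W"
  shows "normal (gen z * (X.emb f * Y.emb g * gr w))"
proof (cases z)
  case (Grp w')
  show ?thesis
  proof (cases "w' \<in> W")
    case True
    then show ?thesis using f g w unfolding Grp
      by (intro normal_cong[OF Grp_basic] normal_basic X.polyfun_act Y.polyfun_act W_mult)
  next
    case False
    have "gen z * (X.emb f * Y.emb g * gr w) \<doteq> 0 * (X.emb f * Y.emb g * gr w)"
      unfolding Grp by (intro cong_rmult gr_not_W False)
    then show ?thesis using normal_cong normal_0 by simp
  qed
next
  case (Vec x)
  show ?thesis using f g w unfolding Vec
    by (intro normal_cong[OF Vec_basic] normal_basic polyfun_intros)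
next
  case (Covec \<eta>)
  have "normal (X.emb f * Y.emb (lf \<eta> * g) * gr w +
    - (\<Sum>s\<in>R. scalar (kx \<eta> s) * (X.emb (X.dd s f) * Y.emb (Y.act s g) * gr (s ** w))))"
    using f g w R_W
    by (intro normal_add normal_uminus normal_sum normal_basic normal_scalar_basic polyfun_intros
        X.polyfun_dd Y.polyfun_act W_mult)
  then show ?thesis unfolding Covec using normal_cong[OF Covec_basic[OF f g w]] by simp
qed

lemma normal_gen_mult: "normal p \<Longrightarrow> normal (gen z * p)"
proof -
  assume "normal p"
  then obtain L where L: "valid L" "p \<doteq> nf L" by (auto simp: normal_def)
  have "normal (gen z * nf L)"
    using L(1)
  proof (induction L)
    case (Cons t L)
    obtain f g w where t: "t = (f, g, w)" by (cases t) auto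
    have "normal (gen z * nft t)" using Cons.prems by (simp add: t valid_simps normal_gen_basic)
    from normal_add[OF this Cons.IH] show ?case
      using Cons.prems by (simp add: valid_simps nf_simps distrib_left)
  qed (simp add: nf_simps normal_0)
  then show ?thesis using cong_lmult[OF L(2)] normal_cong by blast
qed

lemma scalar_cong_basic: "scalar a \<doteq> X.emb (cst a) * Y.emb 1 * gr (mat 1)"
proof -
  have "X.emb (cst a) * Y.emb 1 * gr (mat 1) \<doteq> scalar a * 1 * 1"
    by (intro cong_mult X.emb_cst Y.emb_1 gr_one)
  then show ?thesis using cong_sym by simp
qed

lemma normal_all: "normal p"
proof (induction p rule: free_induct)
  case (single w a)
  show ?case
  proof (induction w)
    case Nil
    have "normal (scalar a)"
      by (intro normal_cong[OF scalar_cong_basic] normal_basic polyfun_cst polyfun_1 W_one)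
    then show ?case by (simp add: scalar_def)
  next
    case (Cons z w) then show ?case by (simp only: single_Cons normal_gen_mult)
  qed
qed (rule normal_add)

lemma basic_induct [case_names cong zero add basic]:
  assumes "\<And>p q. p \<doteq> q \<Longrightarrow> P q \<Longrightarrow> P p" "P 0" "\<And>p q. P p \<Longrightarrow> P q \<Longrightarrow> P (p + q)"
    and "\<And>f g w. polyfun f \<Longrightarrow> polyfun g \<Longrightarrow> w \<in> W \<Longrightarrow> P (X.emb f * Y.emb g * gr w)"
  shows "P p"
proof -
  obtain L where L: "valid L" "p \<doteq> nf L" using normal_all[of p] by (auto simp: normal_def)
  have "P (nf L)"
    using L(1)
  proof (induction L)
    case (Cons t L)
    obtain f g w where t: "t = (f, g, w)" by (cases t) auto
    have "P (nft t)" using Cons.prems by (simp add: t valid_simps assms(4))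
    then show ?case using assms(3) Cons by (simp add: valid_simps nf_simps)
  qed (simp add: nf_simps assms(2))
  then show ?thesis using assms(1) L(2) by blast
qed

section \<open>Uniqueness of the coefficient of the identity\<close>

text \<open>The generator of the induced module: the constant 1 in \<open>y\<close> and
  \<open>v\<close>, concentrated at the identity in \<open>u\<close>. The normal form
  \<open>(f, g, w)\<close> turns it into \<open>f y * g v\<close> concentrated at
  \<open>u = w\<close>.\<close>

definition unit_mfun :: "'n mfun" where
  "unit_mfun = (\<lambda>y v u. if u = mat 1 then 1 else 0)"

lemma tens_const: "tens (\<lambda>y v u. h v u)"
  using tens_basic[OF polyfun_1, of h] by (simp add: fun_apply)

lemma actp_Vec: "tens m \<Longrightarrow> actp (relabel Vec p) m = (\<lambda>y v u. ev p y * m y v u)"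
proof (induction p arbitrary: m rule: free_gen_induct)
  case (scalar a) then show ?case by (simp only: relabel_scalar actp_scalar ev_scalar cst_apply)
next
  case (gen x) then show ?case by (simp only: relabel_gen actp_gen ev_gen lf_apply opg.simps)
next
  case (add p q) then show ?case by (simp only: relabel_add actp_add ev_add plus_fun_apply distrib_right)
next
  case (mult p q)
  then show ?case
    by (simp only: relabel_mult actp_mult tens_mult[OF mult.prems polyfun_ev] ev_mult times_fun_apply mult.assoc)
qed

lemma actp_Covec: "actp (relabel Covec p) (\<lambda>y v u. h v u) = (\<lambda>y v u. ev p v * h v u)"
proof (induction p arbitrary: h rule: free_gen_induct)
  case (scalar a) then show ?case by (simp only: relabel_scalar actp_scalar ev_scalar cst_apply)
next
  case (gen x)
  show ?case by (simp only: relabel_gen actp_gen ev_gen lf_apply opg_Covec_const) (simp only: pairing_commute)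
next
  case (add p q) then show ?case by (simp only: relabel_add actp_add ev_add plus_fun_apply distrib_right)
next
  case (mult p q)
  show ?case
    by (simp only: relabel_mult actp_mult[OF tens_const] mult.IH ev_mult times_fun_apply mult.assoc)
qed

lemma actp_basic:
  assumes f: "polyfun f" and g: "polyfun g" and w: "w \<in> W"
  shows "actp (X.emb f * Y.emb g * gr w) unit_mfun y v (mat 1) = (if w = mat 1 then f y * g v else 0)"
proof -
  let ?h = "\<lambda>v u. if matrix_inv w ** u = mat 1 then 1 else (0 :: complex)"
  have t: "tens unit_mfun" unfolding unit_mfun_def by (rule tens_const)
  have "actp (X.emb f * Y.emb g * gr w) unit_mfun = actp (X.emb f) (actp (Y.emb g) (\<lambda>y v u. ?h v u))"
    unfolding actp_mult[OF t] actp_mult[OF tens_actp[OF t]] actp_gen opg.simps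
    unfolding unit_mfun_def by (rule actp_mult[OF tens_const])
  also have "actp (Y.emb g) (\<lambda>y v u. ?h v u) = (\<lambda>y v u. g v * ?h v u)"
    unfolding Y.emb_def by (simp only: actp_Covec ev_lift[OF g])
  also have "actp (X.emb f) \<dots> = (\<lambda>y v u. f y * (g v * ?h v u))"
    unfolding X.emb_def using actp_Vec[OF tens_const, of "lift f" "\<lambda>v u. g v * ?h v u"]
    by (simp only: ev_lift[OF f])
  finally have "actp (X.emb f * Y.emb g * gr w) unit_mfun y v (mat 1) = f y * (g v * ?h v (mat 1))" by simp
  moreover have "matrix_inv w = mat 1 \<longleftrightarrow> w = mat 1"
    using inv_one inv_inv[OF w] by metis
  ultimately show ?thesis by simp
qed

lemma res_relabel: "(\<And>x. \<iota> x \<in> G) \<Longrightarrow> res G (relabel \<iota> p) = relabel \<iota> p"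
  by (induction p rule: free_gen_induct)
     (simp_all add: relabel_scalar res_scalar relabel_gen res_gen relabel_add res_add relabel_mult res_mult)

lemma res_nf: "valid L \<Longrightarrow> res (cherednik_gens W) (nf L) = nf L"
proof (induction L)
  case (Cons t L)
  obtain f g w where t: "t = (f, g, w)" by (cases t) auto
  have "res (cherednik_gens W) (X.emb f) = X.emb f" "res (cherednik_gens W) (Y.emb g) = Y.emb g"
    unfolding X.emb_def Y.emb_def by (auto intro!: res_relabel simp: cherednik_gens_def)
  moreover have "Grp w \<in> cherednik_gens W" using Cons.prems by (simp add: t valid_simps cherednik_gens_def)
  ultimately show ?case using Cons by (simp add: nf_simps res_add valid_simps t res_mult res_gen)
qed (simp add: nf_simps res_0)

fun id_coeff where
  "id_coeff (f, g, w) y v = (if w = mat 1 then f y * g v else (0 :: complex))"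

lemma nf_zero_coeff:
  assumes L: "valid L" and z: "nf L \<doteq> 0"
  shows "(\<Sum>t\<leftarrow>L. id_coeff t y v) = 0"
proof -
  have t: "tens unit_mfun" unfolding unit_mfun_def by (rule tens_const)
  have "actp (nf L) unit_mfun y v (mat 1) = (\<Sum>t\<leftarrow>L. id_coeff t y v)"
    using L
  proof (induction L)
    case (Cons t L)
    obtain f g w where t: "t = (f, g, w)" by (cases t) auto
    show ?case using Cons by (simp add: nf_simps actp_add t valid_simps actp_basic)
  qed (simp add: nf_simps actp_0)
  moreover have "actp (nf L) unit_mfun = (\<lambda>y v u. 0)"
    using Jx_annihilates[OF _ t, of "nf L"] z res_nf[OF L] by (simp add: cong_def)
  ultimately show ?thesis by simp
qed

section \<open>From functions of two variables back to the algebra\<close>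

definition zs :: "((complex ^ 'n \<Rightarrow> complex) \<times> (complex ^ 'n \<Rightarrow> complex)) list \<Rightarrow> 'n cgen free" where
  "zs L = (\<Sum>(f, g)\<leftarrow>L. X.emb f * Y.emb g)"

text \<open>An element of a tensor product of function spaces is determined by the function of two
  variables: if some \<open>f y0\<close> is not zero, then the equation at \<open>y0\<close> expresses the partner \<open>g\<close> by the
  other second factors.\<close>

lemma zs_zero:
  assumes "\<forall>(f, g) \<in> set L. polyfun f \<and> polyfun g"
    and "\<And>y v. (\<Sum>(f, g)\<leftarrow>L. f y * g v) = 0"
  shows "zs L \<doteq> 0"
  using assms
proof (induction "length L" arbitrary: L)
  case 0 then show ?case by (simp add: zs_def)
next
  case (Suc n)
  then obtain f g L' where L: "L = (f, g) # L'" by (cases L) auto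
  have pf: "polyfun f" "polyfun g" and pL: "\<forall>(f, g) \<in> set L'. polyfun f \<and> polyfun g"
    using Suc.prems L by auto
  show ?case
  proof (cases "f = 0")
    case True
    have "zs L' \<doteq> 0"
    proof (rule Suc.hyps(1)[OF _ pL])
      show "(\<Sum>(f, g)\<leftarrow>L'. f y * g v) = 0" for y v
        using Suc.prems(2)[of y v] by (simp add: L True fun_apply)
    qed (use Suc.hyps(2) L in simp)
    moreover have "X.emb f * Y.emb g \<doteq> 0 * Y.emb g" unfolding True by (intro cong_rmult X.emb_0)
    ultimately have "X.emb f * Y.emb g + zs L' \<doteq> 0 * Y.emb g + 0" by (intro cong_add)
    then show ?thesis by (simp add: L zs_def)
  next
    case False
    then obtain y0 where y0: "f y0 \<noteq> 0" by (auto simp: fun_eq_iff fun_apply)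
    define a where "a h = h y0 / f y0" for h :: "complex ^ 'n \<Rightarrow> complex"
    \<comment> \<open>The other first factors are reduced by multiples of \<open>f\<close> so as to
      vanish at \<open>y0\<close>. By \<open>gv\<close> this absorbs the term of \<open>f\<close>
      and \<open>g\<close>, leaving one term fewer.\<close>
    define M where "M = map (\<lambda>(h, k). (h - cst (a h) * f, k)) L'"
    have gv: "g v = - (\<Sum>(h, k)\<leftarrow>L'. a h * k v)" for v
    proof -
      have "f y0 * g v + (\<Sum>(h, k)\<leftarrow>L'. h y0 * k v) = 0" using Suc.prems(2)[of y0 v] by (simp add: L)
      moreover have "(\<Sum>(h, k)\<leftarrow>L'. a h * k v) = (\<Sum>(h, k)\<leftarrow>L'. h y0 * k v) / f y0"
        by (induction L') (auto simp: a_def add_divide_distrib)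
      ultimately have "f y0 * (g v + (\<Sum>(h, k)\<leftarrow>L'. a h * k v)) = 0"
        using y0 by (simp add: distrib_left)
      then show ?thesis using y0 by (simp add: eq_neg_iff_add_eq_0)
    qed
    have Mz: "zs M \<doteq> 0"
    proof (rule Suc.hyps(1))
      show "n = length M" using Suc.hyps(2) by (simp add: L M_def)
      show "\<forall>(f, g) \<in> set M. polyfun f \<and> polyfun g"
        using pL pf by (auto simp: M_def intro!: polyfun_intros)
      fix y v
      have "(\<Sum>(h, k)\<leftarrow>M. h y * k v) = (\<Sum>(h, k)\<leftarrow>L'. h y * k v) - f y * (\<Sum>(h, k)\<leftarrow>L'. a h * k v)"
        unfolding M_def by (induction L') (auto simp: fun_apply algebra_simps)
      also have "\<dots> = (\<Sum>(h, k)\<leftarrow>L'. h y * k v) + f y * g v" by (simp add: gv)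
      also have "\<dots> = f y * g v + (\<Sum>(h, k)\<leftarrow>L'. h y * k v)" by (rule add.commute)
      also have "\<dots> = 0" using Suc.prems(2)[of y v] by (simp add: L)
      finally show "(\<Sum>(h, k)\<leftarrow>M. h y * k v) = 0" .
    qed
    \<comment> \<open>Polynomiality of the combined partner is carried through the induction because
      \<open>Y.emb_add\<close> requires it.\<close>
    have Ms: "zs M \<doteq> zs L' + X.emb f * (- Y.emb (\<lambda>v. \<Sum>(h, k)\<leftarrow>L'. a h * k v)) \<and>
      polyfun (\<lambda>v. \<Sum>(h, k)\<leftarrow>L'. a h * k v)"
      using pL unfolding M_def
    proof (induction L')
      case Nil
      have z: "(\<lambda>v :: complex ^ 'n. 0 :: complex) = 0" by (simp add: fun_eq_iff fun_apply)
      have "0 \<doteq> X.emb f * (- Y.emb 0)"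
        using cong_sym[OF cong_lmult[OF cong_uminus[OF Y.emb_0], of "X.emb f"]] by simp
      then show ?case using polyfun_0 by (simp add: zs_def z)
    next
      case (Cons x L')
      obtain h k where x: "x = (h, k)" by (cases x)
      let ?M = "map (\<lambda>(h, k). (h - cst (a h) * f, k)) L'"
      let ?s = "\<lambda>v. \<Sum>(h, k)\<leftarrow>L'. a h * k v"
      have "\<forall>(f, g) \<in> set L'. polyfun f \<and> polyfun g" using Cons.prems by simp
      from Cons.IH[OF this] have ps: "polyfun ?s" and IH: "zs ?M \<doteq> zs L' + X.emb f * (- Y.emb ?s)"
        by blast+
      have hk: "polyfun h" "polyfun k" using Cons.prems by (auto simp: x)
      have s: "(\<lambda>v. \<Sum>(h, k)\<leftarrow>x # L'. a h * k v) = cst (a h) * k + ?s" by (simp add: x fun_eq_iff fun_apply)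
      have "X.emb (h - cst (a h) * f) \<doteq> X.emb h - scalar (a h) * X.emb f"
      proof -
        have "X.emb (h + cst (- a h) * f) \<doteq> X.emb h + X.emb (cst (- a h) * f)"
          using hk pf by (intro X.emb_add polyfun_intros)
        also have "\<dots> \<doteq> X.emb h + scalar (- a h) * X.emb f"
          using pf by (intro cong_add cong_refl X.emb_cst_mult)
        finally show ?thesis by (simp add: scalar_minus cst_minus)
      qed
      then have "X.emb (h - cst (a h) * f) * Y.emb k + zs ?M \<doteq>
          (X.emb h - scalar (a h) * X.emb f) * Y.emb k + (zs L' + X.emb f * (- Y.emb ?s))"
        by (intro cong_add cong_rmult IH)
      also have "\<dots> = (X.emb h * Y.emb k + zs L') + X.emb f * - (scalar (a h) * Y.emb k + Y.emb ?s)"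
      proof -
        have "scalar (a h) * X.emb f * Y.emb k = X.emb f * scalar (a h) * Y.emb k"
          by (simp only: scalar_central[of "a h" "X.emb f"])
        also have "\<dots> = X.emb f * (scalar (a h) * Y.emb k)" by (rule mult.assoc)
        finally have e: "scalar (a h) * X.emb f * Y.emb k = X.emb f * (scalar (a h) * Y.emb k)" .
        show ?thesis
          unfolding left_diff_distrib e by (simp add: right_diff_distrib)
      qed
      also have "\<dots> \<doteq> (X.emb h * Y.emb k + zs L') + X.emb f * - Y.emb (cst (a h) * k + ?s)"
      proof (intro cong_add cong_refl cong_lmult cong_uminus)
        have "Y.emb (cst (a h) * k + ?s) \<doteq> Y.emb (cst (a h) * k) + Y.emb ?s"
          using hk ps by (intro Y.emb_add polyfun_intros)
        also have "\<dots> \<doteq> scalar (a h) * Y.emb k + Y.emb ?s"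
          using hk by (intro cong_add cong_refl Y.emb_cst_mult)
        finally show "scalar (a h) * Y.emb k + Y.emb ?s \<doteq> Y.emb (cst (a h) * k + ?s)" by (rule cong_sym)
      qed
      finally have "zs (map (\<lambda>(h, k). (h - cst (a h) * f, k)) (x # L')) \<doteq>
          zs (x # L') + X.emb f * - Y.emb (cst (a h) * k + ?s)"
        by (simp add: zs_def x)
      moreover have "polyfun (cst (a h) * k + ?s)" using hk ps by (intro polyfun_intros)
      ultimately show ?case unfolding s by blast
    qed
    have "g = - (\<lambda>v. \<Sum>(h, k)\<leftarrow>L'. a h * k v)" by (rule ext) (simp only: gv uminus_apply)
    then have "Y.emb g \<doteq> - Y.emb (\<lambda>v. \<Sum>(h, k)\<leftarrow>L'. a h * k v)"
      using Y.emb_uminus[OF conjunct2[OF Ms]] by (simp only:)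
    then have "X.emb f * Y.emb g + zs L' \<doteq> X.emb f * (- Y.emb (\<lambda>v. \<Sum>(h, k)\<leftarrow>L'. a h * k v)) + zs L'"
      by (intro cong_add cong_lmult cong_refl)
    also have "\<dots> = zs L' + X.emb f * (- Y.emb (\<lambda>v. \<Sum>(h, k)\<leftarrow>L'. a h * k v))" by (rule add.commute)
    also have "\<dots> \<doteq> zs M" by (rule cong_sym[OF conjunct1[OF Ms]])
    also have "\<dots> \<doteq> 0" by (rule Mz)
    finally have "X.emb f * Y.emb g + zs L' \<doteq> 0" .
    then show ?thesis by (simp add: L zs_def)
  qed
qed

end

section \<open>The trace\<close>

context cherednik
begin

fun tr_term where
  "tr_term (f, g, w) = (if w = mat 1 then X.emb (X.Phi f) * Y.emb (Y.Phi g) else 0)"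

definition tr where "tr L = (\<Sum>t\<leftarrow>L. tr_term t)"

lemma tr_simps: "tr [] = 0" "tr (t # L) = tr_term t + tr L" "tr (L @ M) = tr L + tr M"
  by (simp_all add: tr_def)

lemma X_Phi_poly: "polyfun f \<Longrightarrow> polyfun (X.Phi f)" and Y_Phi_poly: "polyfun f \<Longrightarrow> polyfun (Y.Phi f)"
  using X.invariant_Phi Y.invariant_Phi X.invariantD Y.invariantD by blast+

lemma X_Phi_cst: "polyfun f \<Longrightarrow> X.Phi (cst a * f) = cst a * X.Phi f"
  and Y_Phi_cst: "polyfun f \<Longrightarrow> Y.Phi (cst a * f) = cst a * Y.Phi f"
  by (simp_all add: X.Phi_invariant_mult X.invariant_cst Y.Phi_invariant_mult Y.invariant_cst)

lemma X_Phi_sum_list: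
  "\<forall>(a, f) \<in> set L. polyfun f \<Longrightarrow>
    polyfun (\<Sum>(a, f)\<leftarrow>L. cst a * f) \<and> X.Phi (\<Sum>(a, f)\<leftarrow>L. cst a * f) = (\<Sum>(a, f)\<leftarrow>L. cst a * X.Phi f)"
  by (induction L) (auto simp: X.Phi_0 X.Phi_add X_Phi_cst polyfun_intros)

lemma Y_Phi_sum_list:
  "\<forall>(a, f) \<in> set L. polyfun f \<Longrightarrow>
    polyfun (\<Sum>(a, f)\<leftarrow>L. cst a * f) \<and> Y.Phi (\<Sum>(a, f)\<leftarrow>L. cst a * f) = (\<Sum>(a, f)\<leftarrow>L. cst a * Y.Phi f)"
  by (induction L) (auto simp: Y.Phi_0 Y.Phi_add Y_Phi_cst polyfun_intros)

lemma sum_list_cst_apply: "(\<Sum>(a, f)\<leftarrow>L. cst a * h f) v = (\<Sum>(a, f)\<leftarrow>L. a * h f v)"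
  by (induction L) (auto simp: fun_apply)

text \<open>With one variable frozen, its factors become scalar coefficients, and \<open>Phi\<close>
  is linear over scalars. So it can be applied in the second variable for each fixed
  \<open>y\<close>, and then in the first for each fixed \<open>v\<close>.\<close>

lemma Phi_Phi_zero:
  assumes L: "\<forall>(f, g) \<in> set L. polyfun f \<and> polyfun g"
    and z: "\<And>y v. (\<Sum>(f, g)\<leftarrow>L. f y * g v) = 0"
  shows "(\<Sum>(f, g)\<leftarrow>L. X.Phi f y * Y.Phi g v) = 0"
proof -
  have 1: "(\<Sum>(f, g)\<leftarrow>L. f y * Y.Phi g v) = 0" for y v
  proof -
    let ?M = "map (\<lambda>(f, g). (f y, g)) L"
    have M: "\<forall>(a, f) \<in> set ?M. polyfun f" using L by auto
    have "(\<Sum>(a, f)\<leftarrow>?M. cst a * f) = 0"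
    proof
      fix v
      have "(\<Sum>(a, f)\<leftarrow>?M. cst a * f) v = (\<Sum>(f, g)\<leftarrow>L. f y * g v)"
        using sum_list_cst_apply[of "\<lambda>f. f" ?M v] by (simp add: split_def o_def)
      then show "(\<Sum>(a, f)\<leftarrow>?M. cst a * f) v = 0 v" by (simp add: z zero_fun_apply)
    qed
    then have "(\<Sum>(a, f)\<leftarrow>?M. cst a * Y.Phi f) v = 0"
      using Y_Phi_sum_list[OF M] by (simp add: Y.Phi_0 zero_fun_apply)
    then show ?thesis using sum_list_cst_apply[of Y.Phi ?M v] by (simp add: split_def o_def)
  qed
  let ?M = "map (\<lambda>(f, g). (Y.Phi g v, f)) L"
  have M: "\<forall>(a, f) \<in> set ?M. polyfun f" using L by auto
  have "(\<Sum>(a, f)\<leftarrow>?M. cst a * f) = 0"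
  proof
    fix y
    have "(\<Sum>(a, f)\<leftarrow>?M. cst a * f) y = (\<Sum>(f, g)\<leftarrow>L. f y * Y.Phi g v)"
      using sum_list_cst_apply[of "\<lambda>f. f" ?M y] by (simp add: split_def o_def mult.commute)
    then show "(\<Sum>(a, f)\<leftarrow>?M. cst a * f) y = 0 y" by (simp add: 1 zero_fun_apply)
  qed
  then have "(\<Sum>(a, f)\<leftarrow>?M. cst a * X.Phi f) y = 0"
    using X_Phi_sum_list[OF M] by (simp add: X.Phi_0 zero_fun_apply)
  then show ?thesis
    using sum_list_cst_apply[of X.Phi ?M y] by (simp add: split_def o_def mult.commute)
qed

text \<open>The point that makes the trace independent of the normal form: the identity terms vanish
  as a function of two variables, applying both forms \<open>Phi\<close> preserves this, and
  \<open>zs_zero\<close> leads back to the algebra.\<close>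

lemma tr_zero:
  assumes L: "valid L" and z: "nf L \<doteq> 0"
  shows "tr L \<doteq> 0"
proof -
  define M where "M = map (\<lambda>(f, g, w). (f, g)) (filter (\<lambda>(f, g, w). w = mat 1) L)"
  have M: "\<forall>(f, g) \<in> set M. polyfun f \<and> polyfun g"
    using L by (auto simp: M_def valid_def)
  have "(\<Sum>(f, g)\<leftarrow>M. f y * g v) = (\<Sum>t\<leftarrow>L. id_coeff t y v)" for y v
    unfolding M_def by (induction L) auto
  then have "(\<Sum>(f, g)\<leftarrow>M. f y * g v) = 0" for y v using nf_zero_coeff[OF L z] by simp
  then have PP: "(\<Sum>(f, g)\<leftarrow>M. X.Phi f y * Y.Phi g v) = 0" for y v using Phi_Phi_zero[OF M] by blast
  have "zs (map (\<lambda>(f, g). (X.Phi f, Y.Phi g)) M) \<doteq> 0"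
  proof (rule zs_zero)
    show "\<forall>(f, g) \<in> set (map (\<lambda>(f, g). (X.Phi f, Y.Phi g)) M). polyfun f \<and> polyfun g"
      using M by (auto simp: X_Phi_poly Y_Phi_poly)
    show "(\<Sum>(f, g)\<leftarrow>map (\<lambda>(f, g). (X.Phi f, Y.Phi g)) M. f y * g v) = 0" for y v
      using PP[of y v] by (simp add: split_def o_def)
  qed
  moreover have "zs (map (\<lambda>(f, g). (X.Phi f, Y.Phi g)) M) = tr L"
    unfolding M_def by (induction L) (auto simp: zs_def tr_def)
  ultimately show ?thesis by simp
qed

section \<open>The trace of arbitrary elements\<close>

definition T :: "'n cgen free \<Rightarrow> 'n cgen free" where
  "T p = tr (SOME L. valid L \<and> p \<doteq> nf L)"

definition neg where "neg = map (\<lambda>(f, g, w). (- f, g, w))"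

lemma neg: "valid L \<Longrightarrow> valid (neg L) \<and> nf (neg L) \<doteq> - nf L \<and> tr (neg L) \<doteq> - tr L"
proof (induction L)
  case (Cons t L)
  obtain f g w where t: "t = (f, g, w)" by (cases t) auto
  have p: "polyfun f" "polyfun g" "w \<in> W" using Cons.prems by (auto simp: valid_simps t)
  have IH: "valid (neg L)" "nf (neg L) \<doteq> - nf L" "tr (neg L) \<doteq> - tr L"
    using Cons by (auto simp: valid_simps)
  have "X.emb (- f) * Y.emb g * gr w \<doteq> - X.emb f * Y.emb g * gr w"
    by (intro cong_rmult X.emb_uminus p)
  from cong_add[OF this IH(2)] have 1: "nf (neg (t # L)) \<doteq> - nf (t # L)"
    by (simp add: neg_def t nf_simps)
  have "X.Phi (- f) = - X.Phi f"
    using X_Phi_cst[OF p(1), of "-1"] by (simp add: cst_minus cst_1)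
  then have "X.emb (X.Phi (- f)) \<doteq> - X.emb (X.Phi f)"
    using X.emb_uminus[OF X_Phi_poly[OF p(1)]] by simp
  then have "tr_term (- f, g, w) \<doteq> - tr_term (f, g, w)"
    using cong_rmult[of "X.emb (X.Phi (- f))" "- X.emb (X.Phi f)" "Y.emb (Y.Phi g)"] by simp
  from cong_add[OF this IH(3)] have "tr (neg (t # L)) \<doteq> - tr (t # L)"
    by (simp add: neg_def t tr_simps del: tr_term.simps)
  then show ?case using 1 IH p by (simp add: valid_simps neg_def t polyfun_uminus)
qed (simp add: neg_def valid_simps nf_simps tr_simps)

text \<open>Two normal forms \<open>M\<close> and \<open>L\<close> of \<open>p\<close> combine to
  the list \<open>M @ neg L\<close>, which sums to zero and so has trace zero.\<close>

lemma T_eqI: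
  assumes L: "valid L" "p \<doteq> nf L"
  shows "T p \<doteq> tr L"
proof -
  define M where "M = (SOME L. valid L \<and> p \<doteq> nf L)"
  have M: "valid M" "p \<doteq> nf M" "T p = tr M"
    using someI[of "\<lambda>L. valid L \<and> p \<doteq> nf L" L] L by (auto simp: M_def T_def)
  have "nf (M @ neg L) \<doteq> nf M + - nf L"
    unfolding nf_simps using neg[OF L(1)] by (intro cong_add cong_refl) blast
  also have "\<dots> \<doteq> p + - p" by (intro cong_add cong_uminus cong_sym[OF L(2)] cong_sym[OF M(2)])
  finally have "nf (M @ neg L) \<doteq> 0" by simp
  then have "tr (M @ neg L) \<doteq> 0" using M(1) neg[OF L(1)] by (intro tr_zero) (simp_all add: valid_simps)
  then have "tr M + tr (neg L) \<doteq> 0" by (simp add: tr_simps)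
  moreover have "tr M + - tr L \<doteq> tr M + tr (neg L)"
    using neg[OF L(1)] by (intro cong_add cong_refl) (blast intro: cong_sym)
  ultimately have "tr M - tr L \<doteq> 0" using cong_trans by fastforce
  then show ?thesis by (simp add: M(3) cong_diff_0[of "tr M"])
qed

lemma T_exists: "\<exists>L. valid L \<and> p \<doteq> nf L \<and> T p \<doteq> tr L"
  using normal_all[of p] T_eqI by (auto simp: normal_def)

lemma T_cong: "p \<doteq> q \<Longrightarrow> T p \<doteq> T q"
  using T_exists[of q] T_eqI by (metis cong_sym cong_trans)

lemma T_add: "T (p + q) \<doteq> T p + T q"
proof -
  obtain L where L: "valid L" "p \<doteq> nf L" "T p \<doteq> tr L" using T_exists by blast
  obtain M where M: "valid M" "q \<doteq> nf M" "T q \<doteq> tr M" using T_exists by blast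
  have "T (p + q) \<doteq> tr (L @ M)" using L M by (intro T_eqI) (simp_all add: valid_simps nf_simps cong_add)
  also have "tr (L @ M) = tr L + tr M" by (simp add: tr_simps)
  also have "\<dots> \<doteq> T p + T q" using L M by (intro cong_add cong_sym[OF L(3)] cong_sym[OF M(3)])
  finally show ?thesis .
qed

lemma T_0: "T 0 \<doteq> 0"
  using T_eqI[of "[]" 0] by (simp add: valid_simps nf_simps tr_simps)

lemma T_uminus: "T (- p) \<doteq> - T p"
proof -
  have "T (- p) + T p \<doteq> 0" using cong_trans[OF cong_sym[OF T_add[of "- p" p]]] T_0 by simp
  then show ?thesis by (simp add: cong_def)
qed

lemma T_diff: "T (p - q) \<doteq> T p - T q"
  using cong_trans[OF T_add cong_add[OF cong_refl T_uminus], of p q] by simp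

lemma T_sum: "T (\<Sum>i\<in>I. p i) \<doteq> (\<Sum>i\<in>I. T (p i))"
proof (induction I rule: infinite_finite_induct)
  case (insert i I)
  then show ?case using cong_trans[OF T_add cong_add[OF cong_refl]] by simp
qed (simp_all add: T_0)

lemma T_basic:
  "polyfun f \<Longrightarrow> polyfun g \<Longrightarrow> w \<in> W \<Longrightarrow>
    T (X.emb f * Y.emb g * gr w) \<doteq> (if w = mat 1 then X.emb (X.Phi f) * Y.emb (Y.Phi g) else 0)"
  using T_eqI[of "[(f, g, w)]" "X.emb f * Y.emb g * gr w"]
  by (simp add: valid_simps nf_simps tr_simps)

section \<open>The central subalgebra\<close>

text \<open>Against covectors the commutator is a sum of divided differences, which vanish on
  invariants; against \<open>W\<close> it is invariance itself. Letters outside \<open>W\<close>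
  give zero on both sides.\<close>

lemma X_central: assumes f: "X.invariant f" shows "X.emb f * p \<doteq> p * X.emb f"
proof (induction p rule: free_gen_induct)
  case (scalar a) then show ?case by (simp add: scalar_central)
next
  case (gen z)
  show ?case
  proof (cases z)
    case (Grp w)
    show ?thesis
    proof (cases "w \<in> W")
      case True
      then show ?thesis
        using cong_sym[OF X.gamma_emb[of w f]] X.invariantD[OF f] by (simp add: carrier_GW Grp)
    next
      case False
      have "X.emb f * gr w \<doteq> X.emb f * 0" "0 * X.emb f \<doteq> gr w * X.emb f"
        by (intro cong_lmult cong_rmult gr_not_W cong_sym[OF gr_not_W] False)+
      then show ?thesis unfolding Grp using cong_trans by fastforce
    qed
  next
    case (Vec x)
    have "X.emb f * gen (Vec x) \<doteq> X.emb f * X.emb (lf x)" by (intro cong_lmult cong_sym[OF X.emb_lf])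
    also have "\<dots> \<doteq> X.emb (lf x) * X.emb f" using f by (intro X.emb_commute polyfun_lf X.invariantD(1))
    also have "\<dots> \<doteq> gen (Vec x) * X.emb f" by (intro cong_rmult X.emb_lf)
    finally show ?thesis by (simp add: Vec)
  next
    case (Covec \<eta>) then show ?thesis using X.emb_invariant_commute[OF Vec_Covec f] by simp
  qed
next
  case (add p q) from cong_add[OF this] show ?case by (simp add: distrib_left distrib_right)
next
  case (mult p q)
  have "X.emb f * (p * q) = (X.emb f * p) * q" by (simp add: mult.assoc)
  also have "\<dots> \<doteq> (p * X.emb f) * q" by (intro cong_rmult mult)
  also have "\<dots> = p * (X.emb f * q)" by (simp add: mult.assoc)
  also have "\<dots> \<doteq> p * (q * X.emb f)" by (intro cong_lmult mult)
  finally show ?case by (simp add: mult.assoc)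
qed

lemma Y_central: assumes f: "Y.invariant f" shows "Y.emb f * p \<doteq> p * Y.emb f"
proof (induction p rule: free_gen_induct)
  case (scalar a) then show ?case by (simp add: scalar_central)
next
  case (gen z)
  show ?case
  proof (cases z)
    case (Grp w)
    show ?thesis
    proof (cases "w \<in> W")
      case True
      then show ?thesis
        using cong_sym[OF Y.gamma_emb[of w f]] Y.invariantD[OF f] by (simp add: carrier_GW Grp)
    next
      case False
      have "Y.emb f * gr w \<doteq> Y.emb f * 0" "0 * Y.emb f \<doteq> gr w * Y.emb f"
        by (intro cong_lmult cong_rmult gr_not_W cong_sym[OF gr_not_W] False)+
      then show ?thesis unfolding Grp using cong_trans by fastforce
    qed
  next
    case (Covec x)
    have "Y.emb f * gen (Covec x) \<doteq> Y.emb f * Y.emb (lf x)" by (intro cong_lmult cong_sym[OF Y.emb_lf])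
    also have "\<dots> \<doteq> Y.emb (lf x) * Y.emb f" using f by (intro Y.emb_commute polyfun_lf Y.invariantD(1))
    also have "\<dots> \<doteq> gen (Covec x) * Y.emb f" by (intro cong_rmult Y.emb_lf)
    finally show ?thesis by (simp add: Covec)
  next
    case (Vec x) then show ?thesis using Y.emb_invariant_commute[OF Covec_Vec f] by simp
  qed
next
  case (add p q) from cong_add[OF this] show ?case by (simp add: distrib_left distrib_right)
next
  case (mult p q)
  have "Y.emb f * (p * q) = (Y.emb f * p) * q" by (simp add: mult.assoc)
  also have "\<dots> \<doteq> (p * Y.emb f) * q" by (intro cong_rmult mult)
  also have "\<dots> = p * (Y.emb f * q)" by (simp add: mult.assoc)
  also have "\<dots> \<doteq> p * (q * Y.emb f)" by (intro cong_lmult mult)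
  finally show ?case by (simp add: mult.assoc)
qed

section \<open>Membership in the central subalgebra, up to congruence\<close>

definition inv_pairs where
  "inv_pairs L \<longleftrightarrow> (\<forall>(f, g) \<in> set L. X.invariant f \<and> Y.invariant g)"

definition Z0 :: "'n cgen free set" where
  "Z0 = {p. \<exists>L. inv_pairs L \<and> p \<doteq> zs L}"

lemma zs_simps: "zs [] = 0" "zs ((f, g) # L) = X.emb f * Y.emb g + zs L" "zs (L @ M) = zs L + zs M"
  by (simp_all add: zs_def)

lemma inv_pairs_simps: "inv_pairs []" "inv_pairs ((f, g) # L) \<longleftrightarrow> X.invariant f \<and> Y.invariant g \<and> inv_pairs L"
  "inv_pairs (L @ M) \<longleftrightarrow> inv_pairs L \<and> inv_pairs M"
  by (auto simp: inv_pairs_def)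

lemma Z0_cong: "p \<doteq> q \<Longrightarrow> q \<in> Z0 \<Longrightarrow> p \<in> Z0"
  unfolding Z0_def using cong_trans by blast

lemma Z0_0: "0 \<in> Z0"
  unfolding Z0_def by (intro CollectI exI[of _ "[]"]) (simp add: inv_pairs_simps zs_simps)

lemma Z0_add: "p \<in> Z0 \<Longrightarrow> q \<in> Z0 \<Longrightarrow> p + q \<in> Z0"
  unfolding Z0_def by (simp, metis cong_add inv_pairs_simps(3) zs_simps(3))

lemma Z0_basic: "X.invariant f \<Longrightarrow> Y.invariant g \<Longrightarrow> X.emb f * Y.emb g \<in> Z0"
  unfolding Z0_def by (intro CollectI exI[of _ "[(f, g)]"]) (simp add: inv_pairs_simps zs_simps)

lemma Z0_induct [consumes 1, case_names cong zero add basic]: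
  assumes "z \<in> Z0" "\<And>p q. p \<doteq> q \<Longrightarrow> P q \<Longrightarrow> P p" "P 0" "\<And>p q. P p \<Longrightarrow> P q \<Longrightarrow> P (p + q)"
    and "\<And>f g. X.invariant f \<Longrightarrow> Y.invariant g \<Longrightarrow> P (X.emb f * Y.emb g)"
  shows "P z"
proof -
  obtain L where L: "inv_pairs L" "z \<doteq> zs L" using assms(1) by (auto simp: Z0_def)
  have "P (zs L)"
    using L(1)
  proof (induction L)
    case (Cons t L)
    obtain f g where t: "t = (f, g)" by (cases t)
    show ?case using Cons assms(4,5) by (simp add: t inv_pairs_simps zs_simps)
  qed (simp add: zs_simps assms(3))
  then show ?thesis using assms(2) L(2) by blast
qed

lemma Z0_central: "z \<in> Z0 \<Longrightarrow> z * p \<doteq> p * z"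
proof (induction rule: Z0_induct)
  case (cong q r)
  then show ?case using cong_rmult[of q r p] cong_lmult[of q r p] cong_sym cong_trans by blast
next
  case (add q r) from cong_add[OF this] show ?case by (simp add: distrib_left distrib_right)
next
  case (basic f g)
  have "X.emb f * Y.emb g * p = X.emb f * (Y.emb g * p)" by (simp add: mult.assoc)
  also have "\<dots> \<doteq> X.emb f * (p * Y.emb g)" by (intro cong_lmult Y_central basic)
  also have "\<dots> = (X.emb f * p) * Y.emb g" by (simp add: mult.assoc)
  also have "\<dots> \<doteq> (p * X.emb f) * Y.emb g" by (intro cong_rmult X_central basic)
  finally show ?case by (simp add: mult.assoc)
qed simp_all

lemma invariant_term_mult:
  assumes a: "X.invariant a" "Y.invariant b" and f: "polyfun f" "polyfun g"
  shows "(X.emb a * Y.emb b) * (X.emb f * Y.emb g) \<doteq> X.emb (a * f) * Y.emb (b * g)"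
proof -
  have "(X.emb a * Y.emb b) * (X.emb f * Y.emb g) = X.emb a * (Y.emb b * X.emb f) * Y.emb g"
    by (simp add: mult.assoc)
  also have "\<dots> \<doteq> X.emb a * (X.emb f * Y.emb b) * Y.emb g"
    by (intro cong_rmult cong_lmult Y_central a)
  also have "\<dots> = (X.emb a * X.emb f) * (Y.emb b * Y.emb g)" by (simp add: mult.assoc)
  also have "\<dots> \<doteq> X.emb (a * f) * Y.emb (b * g)"
    by (intro cong_mult cong_sym[OF X.emb_mult] cong_sym[OF Y.emb_mult]
        X.invariantD(1)[OF a(1)] Y.invariantD(1)[OF a(2)] f)
  finally show ?thesis .
qed

lemma Z0_mult: "p \<in> Z0 \<Longrightarrow> q \<in> Z0 \<Longrightarrow> p * q \<in> Z0"
proof (induction p rule: Z0_induct)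
  case (cong p r) then show ?case using Z0_cong cong_rmult by blast
next
  case zero then show ?case by (simp add: Z0_0)
next
  case (add p r) then show ?case by (simp add: distrib_right Z0_add)
next
  case (basic a b)
  from basic(3) show ?case
  proof (induction q rule: Z0_induct)
    case (cong p r) then show ?case using Z0_cong cong_lmult by blast
  next
    case zero then show ?case by (simp add: Z0_0)
  next
    case (add p r) then show ?case by (simp add: distrib_left Z0_add)
  next
    case (basic f g)
    show ?case
      by (rule Z0_cong[OF invariant_term_mult Z0_basic])
         (use basic \<open>X.invariant a\<close> \<open>Y.invariant b\<close> in
          \<open>auto intro: X.invariantD Y.invariantD X.invariant_mult Y.invariant_mult\<close>)
  qed
qed

lemma scalar_Z0: "scalar a \<in> Z0"
proof -
  have "scalar a \<doteq> X.emb (cst a) * Y.emb 1"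
    using cong_mult[OF cong_sym[OF X.emb_cst[of a]] cong_sym[OF Y.emb_1]] by simp
  then show ?thesis using Z0_cong Z0_basic[OF X.invariant_cst Y.invariant_1] by blast
qed

lemma one_Z0: "1 \<in> Z0" using scalar_Z0[of 1] by (simp add: scalar_1)

lemma Z0_uminus: "p \<in> Z0 \<Longrightarrow> - p \<in> Z0"
  using Z0_mult[OF scalar_Z0[of "-1"], of p] by (simp add: scalar_minus scalar_1)

lemma T_Z0: "T p \<in> Z0"
proof -
  obtain L where L: "valid L" "T p \<doteq> tr L" using T_exists by blast
  have "tr L \<in> Z0"
    using L(1)
  proof (induction L)
    case (Cons t L)
    obtain f g w where t: "t = (f, g, w)" by (cases t) auto
    show ?case using Cons Z0_0 Z0_add Z0_basic[OF X.invariant_Phi Y.invariant_Phi, of f g]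
      by (simp add: t valid_simps tr_simps)
  qed (simp add: tr_simps Z0_0)
  then show ?thesis using L(2) Z0_cong by blast
qed

lemma T_Z0_mult: "z \<in> Z0 \<Longrightarrow> T (z * p) \<doteq> z * T p"
proof (induction rule: Z0_induct)
  case (cong q r)
  have "T (q * p) \<doteq> T (r * p)" by (intro T_cong cong_rmult cong)
  also have "\<dots> \<doteq> r * T p" by (rule cong)
  also have "\<dots> \<doteq> q * T p" by (intro cong_rmult cong_sym[OF cong(1)])
  finally show ?case .
next
  case zero then show ?case by (simp add: T_0)
next
  case (add q r)
  have "T ((q + r) * p) \<doteq> T (q * p) + T (r * p)" by (simp add: distrib_right T_add)
  also have "\<dots> \<doteq> q * T p + r * T p" by (intro cong_add add)
  finally show ?case by (simp add: distrib_right)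
next
  case (basic a b)
  let ?z = "X.emb a * Y.emb b"
  have pa: "polyfun a" "polyfun b" using basic X.invariantD Y.invariantD by auto
  show ?case
  proof (induction p rule: basic_induct)
    case (cong p q)
    have "T (?z * p) \<doteq> T (?z * q)" by (intro T_cong cong_lmult cong)
    also have "\<dots> \<doteq> ?z * T q" by (rule cong)
    also have "\<dots> \<doteq> ?z * T p" by (intro cong_lmult cong_sym[OF T_cong] cong)
    finally show ?case .
  next
    case zero
    show ?case using cong_trans[OF T_0 cong_lmult[OF cong_sym[OF T_0], of ?z, simplified]] by simp
  next
    case (add p q)
    have "T (?z * (p + q)) \<doteq> T (?z * p) + T (?z * q)" by (simp add: distrib_left T_add)
    also have "\<dots> \<doteq> ?z * T p + ?z * T q" by (intro cong_add add)
    also have "\<dots> = ?z * (T p + T q)" by (simp add: distrib_left)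
    also have "\<dots> \<doteq> ?z * T (p + q)" by (intro cong_lmult cong_sym[OF T_add])
    finally show ?case .
  next
    case (basic f g w)
    have "?z * (X.emb f * Y.emb g * gr w) \<doteq> X.emb (a * f) * Y.emb (b * g) * gr w"
      using cong_rmult[OF invariant_term_mult[OF \<open>X.invariant a\<close> \<open>Y.invariant b\<close> basic(1,2)]]
      by (simp add: mult.assoc)
    then have "T (?z * (X.emb f * Y.emb g * gr w)) \<doteq> T (X.emb (a * f) * Y.emb (b * g) * gr w)"
      by (rule T_cong)
    also have "\<dots> \<doteq> (if w = mat 1 then X.emb (X.Phi (a * f)) * Y.emb (Y.Phi (b * g)) else 0)"
      using basic pa by (intro T_basic polyfun_intros)
    also have "\<dots> = (if w = mat 1 then X.emb (a * X.Phi f) * Y.emb (b * Y.Phi g) else 0)"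
      using basic \<open>X.invariant a\<close> \<open>Y.invariant b\<close> by (simp add: X.Phi_invariant_mult Y.Phi_invariant_mult)
    also have "\<dots> \<doteq> (if w = mat 1 then ?z * (X.emb (X.Phi f) * Y.emb (Y.Phi g)) else 0)"
      using cong_sym[OF invariant_term_mult[OF \<open>X.invariant a\<close> \<open>Y.invariant b\<close> X_Phi_poly Y_Phi_poly]] basic
      by simp
    also have "\<dots> = ?z * (if w = mat 1 then X.emb (X.Phi f) * Y.emb (Y.Phi g) else 0)" by simp
    also have "\<dots> \<doteq> ?z * T (X.emb f * Y.emb g * gr w)"
      using basic by (intro cong_lmult cong_sym[OF T_basic])
    finally show ?case .
  qed
qed

end

section \<open>Symmetry of the trace\<close>

context cherednik
begin

text \<open>On the dual space a reflection has the inverse eigenvalue.\<close>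

lemma chi_chi_reflection: "s \<in> R \<Longrightarrow> X.chi s * Y.chi s = 1"
proof -
  assume s: "s \<in> R"
  have "X.lam s = 1 - 2 * kap s"
    using root_pairing[OF s] by (simp add: X.lam_def pairing_scale_left mult.commute)
  moreover have "Y.lam s = 1 - 2 * kap' s"
    using root_pairing[OF s] by (simp add: Y.lam_def pairing_scale_left pairing_commute[of "\<alpha>' s"] mult.commute)
  moreover have "(1 - 2 * kap s) * (1 - 2 * kap' s) = 1"
    using kap_nz'[OF s] by (simp add: kap'_def divide_simps)
  ultimately have "X.lam s * Y.lam s = 1" by simp
  then show ?thesis using X.chi_R[OF s] Y.chi_R[OF s]
    by (simp add: inverse_mult_distrib[symmetric] del: inverse_mult_distrib)
qed

lemma chi_chi: "w \<in> W \<Longrightarrow> X.chi w * Y.chi w = 1"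
proof -
  assume "w \<in> W"
  then have "w \<in> generate GW R" by (simp add: generate_GW)
  then show ?thesis
  proof (induction w rule: generate.induct)
    case one then show ?case by (simp only: X.chi_one Y.chi_one) simp
  next
    case (incl s) then show ?case by (rule chi_chi_reflection)
  next
    case (inv s)
    have s: "s \<in> carrier GW" "inv\<^bsub>GW\<^esub> s \<in> carrier GW" using inv R_W X.inv_closed by (auto simp: carrier_GW)
    have "X.chi (inv\<^bsub>GW\<^esub> s) * X.chi s = 1"
      using X.chi_mult[OF s(2,1)] X.chi_one X.l_inv[OF s(1)] by simp
    moreover have "Y.chi (inv\<^bsub>GW\<^esub> s) * Y.chi s = 1"
      using Y.chi_mult[OF s(2,1)] Y.chi_one X.l_inv[OF s(1)] by simp
    ultimately have "(X.chi (inv\<^bsub>GW\<^esub> s) * X.chi s) * (Y.chi (inv\<^bsub>GW\<^esub> s) * Y.chi s) = 1" by simp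
    then have "(X.chi (inv\<^bsub>GW\<^esub> s) * Y.chi (inv\<^bsub>GW\<^esub> s)) * (X.chi s * Y.chi s) = 1" by (simp only: ac_simps)
    then show ?case unfolding chi_chi_reflection[OF inv] by simp
  next
    case (eng a b)
    have ab: "a \<in> carrier GW" "b \<in> carrier GW" using eng.hyps by (simp_all add: generate_GW carrier_GW)
    have "X.chi (a \<otimes>\<^bsub>GW\<^esub> b) * Y.chi (a \<otimes>\<^bsub>GW\<^esub> b) = (X.chi a * Y.chi a) * (X.chi b * Y.chi b)"
      by (simp only: X.chi_mult[OF ab] Y.chi_mult[OF ab] ac_simps)
    then show ?case by (simp only: eng.IH) simp
  qed
qed

lemma act_mat_1: "X.act (mat 1) f = f" "Y.act (mat 1) f = f"
  using X.act_one Y.act_one by (simp_all only: one_GW)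

lemma T_scalar: "T (scalar a * p) \<doteq> scalar a * T p"
  by (rule T_Z0_mult[OF scalar_Z0])

text \<open>The degree argument of \<open>dual_bases_exist\<close>, in either factor. Terms of this
  shape are what appears when a vector or covector is exchanged with a polynomial, so
  \<open>T\<close> does not see such an exchange.\<close>

lemma T_basic_dd:
  assumes "polyfun f" "polyfun g" "w \<in> W" "s \<in> R"
  shows "T (X.emb (X.dd s f) * Y.emb g * gr w) \<doteq> 0" "T (X.emb f * Y.emb (Y.dd s g) * gr w) \<doteq> 0"
proof -
  obtain k b b' where X: "\<forall>f. \<forall>s\<in>R. polyfun f \<longrightarrow> X.Phi (X.dd s f) = 0" using X.dual_bases_exist by blast
  obtain k b b' where Y: "\<forall>f. \<forall>s\<in>R. polyfun f \<longrightarrow> Y.Phi (Y.dd s f) = 0" using Y.dual_bases_exist by blast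
  have "X.Phi (X.dd s f) = 0" using X assms by blast
  then have "X.emb (X.Phi (X.dd s f)) * Y.emb (Y.Phi g) \<doteq> 0"
    using cong_rmult[OF X.emb_0, of "Y.emb (Y.Phi g)"] by simp
  then have "(if w = mat 1 then X.emb (X.Phi (X.dd s f)) * Y.emb (Y.Phi g) else 0) \<doteq> 0" by simp
  then show "T (X.emb (X.dd s f) * Y.emb g * gr w) \<doteq> 0"
    by (rule cong_trans[OF T_basic[OF X.polyfun_dd[OF assms(4,1)] assms(2,3)]])
  have "Y.Phi (Y.dd s g) = 0" using Y assms by blast
  then have "X.emb (X.Phi f) * Y.emb (Y.Phi (Y.dd s g)) \<doteq> 0"
    using cong_lmult[OF Y.emb_0, of "X.emb (X.Phi f)"] by simp
  then have "(if w = mat 1 then X.emb (X.Phi f) * Y.emb (Y.Phi (Y.dd s g)) else 0) \<doteq> 0" by simp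
  then show "T (X.emb f * Y.emb (Y.dd s g) * gr w) \<doteq> 0"
    by (rule cong_trans[OF T_basic[OF assms(1) Y.polyfun_dd[OF assms(4,2)] assms(3)]])
qed

lemma T_sum_0:
  assumes "\<And>i. i \<in> I \<Longrightarrow> T (p i) \<doteq> 0" shows "T (\<Sum>i\<in>I. scalar (a i) * p i) \<doteq> 0"
proof -
  have "T (\<Sum>i\<in>I. scalar (a i) * p i) \<doteq> (\<Sum>i\<in>I. T (scalar (a i) * p i))" by (rule T_sum)
  also have "\<dots> \<doteq> (\<Sum>i\<in>I. scalar (a i) * 0)"
    using assms by (intro cong_sum cong_trans[OF T_scalar] cong_lmult)
  finally show ?thesis by simp
qed

text \<open>A group letter on the left twists both factors by their characters, which cancel.
  Vectors and covectors on the right are carried across \<open>w\<close>, becoming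
  \<open>w *v x\<close> and \<open>dual_act w \<eta>\<close>; the divided differences from further
  exchanges vanish under \<open>T\<close>, and the twist by \<open>w\<close> is trivial in the only
  case that counts, \<open>w = mat 1\<close>.\<close>

lemma T_commute_gen:
  assumes f: "polyfun f" and g: "polyfun g" and w: "w \<in> W"
  shows "T ((X.emb f * Y.emb g * gr w) * gen z) \<doteq> T (gen z * (X.emb f * Y.emb g * gr w))"
proof (cases z)
  case (Grp w')
  let ?p = "X.emb f * Y.emb g * gr w"
  show ?thesis
  proof (cases "w' \<in> W")
    case w': True
    have "?p * gr w' \<doteq> X.emb f * Y.emb g * gr (w ** w')"
      using cong_lmult[OF gr_mult[OF w w'], of "X.emb f * Y.emb g"] by (simp add: mult.assoc)
    then have "T (?p * gr w') \<doteq> T (X.emb f * Y.emb g * gr (w ** w'))" by (rule T_cong)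
    also have "\<dots> \<doteq> (if w ** w' = mat 1 then X.emb (X.Phi f) * Y.emb (Y.Phi g) else 0)"
      by (intro T_basic f g W_mult w w')
    also have "\<dots> = (if w' ** w = mat 1 then X.emb (X.Phi f) * Y.emb (Y.Phi g) else 0)"
      by (simp add: matrix_left_right_inverse)
    finally have 1: "T (?p * gr w') \<doteq> \<dots>" .
    have X: "X.emb (X.Phi (X.act w' f)) \<doteq> scalar (X.chi w') * X.emb (X.Phi f)"
      using X.emb_cst_mult[OF X_Phi_poly[OF f]] w' f by (simp add: X.Phi_act carrier_GW)
    have Y: "Y.emb (Y.Phi (Y.act w' g)) \<doteq> scalar (Y.chi w') * Y.emb (Y.Phi g)"
      using Y.emb_cst_mult[OF Y_Phi_poly[OF g]] w' g by (simp add: Y.Phi_act carrier_GW)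
    have "X.emb (X.Phi (X.act w' f)) * Y.emb (Y.Phi (Y.act w' g)) \<doteq>
        (scalar (X.chi w') * X.emb (X.Phi f)) * (scalar (Y.chi w') * Y.emb (Y.Phi g))"
      by (rule cong_mult[OF X Y])
    also have "\<dots> = scalar (X.chi w') * (X.emb (X.Phi f) * scalar (Y.chi w')) * Y.emb (Y.Phi g)"
      by (simp only: mult.assoc)
    also have "\<dots> = scalar (X.chi w') * (scalar (Y.chi w') * X.emb (X.Phi f)) * Y.emb (Y.Phi g)"
      by (simp only: scalar_central[of "Y.chi w'" "X.emb (X.Phi f)"])
    also have "\<dots> = scalar (X.chi w' * Y.chi w') * (X.emb (X.Phi f) * Y.emb (Y.Phi g))"
      by (simp only: scalar_mult mult.assoc)
    also have "\<dots> = X.emb (X.Phi f) * Y.emb (Y.Phi g)" by (simp add: chi_chi[OF w'] scalar_1)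
    finally have 2: "X.emb (X.Phi (X.act w' f)) * Y.emb (Y.Phi (Y.act w' g)) \<doteq> X.emb (X.Phi f) * Y.emb (Y.Phi g)" .
    have "T (gr w' * ?p) \<doteq> T (X.emb (X.act w' f) * Y.emb (Y.act w' g) * gr (w' ** w))"
      by (intro T_cong Grp_basic f g w w')
    also have "\<dots> \<doteq> (if w' ** w = mat 1 then X.emb (X.Phi (X.act w' f)) * Y.emb (Y.Phi (Y.act w' g)) else 0)"
      by (intro T_basic X.polyfun_act Y.polyfun_act f g W_mult w w')
    also have "\<dots> \<doteq> (if w' ** w = mat 1 then X.emb (X.Phi f) * Y.emb (Y.Phi g) else 0)"
      using 2 by simp
    finally show ?thesis unfolding Grp using 1 cong_sym cong_trans by blast
  next
    case False
    have "?p * gr w' \<doteq> ?p * 0" "gr w' * ?p \<doteq> 0 * ?p"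
      by (intro cong_lmult cong_rmult gr_not_W False)+
    then have "?p * gr w' \<doteq> gr w' * ?p" by (simp add: cong_def ideal_diff[OF is_ideal_Jx])
    then show ?thesis unfolding Grp by (rule T_cong)
  qed
next
  case (Vec x)
  let ?x = "w *v x" and ?S = "\<Sum>s\<in>R. scalar (ky (w *v x) s) * Y.emb (Y.dd s g) * gr s"
  have "gr w * gen (Vec x) \<doteq> gen (Vec ?x) * gr w"
    using w by (intro X.conj) (simp_all add: carrier_GW X.act_def lf_def fun_eq_iff pairing_matrix)
  then have "(X.emb f * Y.emb g) * (gr w * gen (Vec x)) \<doteq> (X.emb f * Y.emb g) * (gen (Vec ?x) * gr w)"
    by (rule cong_lmult)
  then have "X.emb f * Y.emb g * gr w * gen (Vec x) \<doteq> X.emb f * (Y.emb g * gen (Vec ?x)) * gr w"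
    by (simp add: mult.assoc)
  also have "\<dots> \<doteq> X.emb f * (gen (Vec ?x) * Y.emb g + ?S) * gr w"
  proof (intro cong_rmult cong_lmult)
    have "Y.emb g * gen (Vec ?x) - gen (Vec ?x) * Y.emb g \<doteq> ?S" using Y_Vec[OF g] by (simp add: ky_def)
    from cong_add[OF cong_refl this, of "gen (Vec ?x) * Y.emb g"]
    show "Y.emb g * gen (Vec ?x) \<doteq> gen (Vec ?x) * Y.emb g + ?S" by simp
  qed
  also have "\<dots> = X.emb f * gen (Vec ?x) * Y.emb g * gr w + X.emb f * ?S * gr w"
    by (simp add: distrib_left distrib_right mult.assoc)
  also have "\<dots> \<doteq> X.emb (lf ?x * f) * Y.emb g * gr w +
      (\<Sum>s\<in>R. scalar (ky ?x s) * (X.emb f * Y.emb (Y.dd s g) * gr (s ** w)))"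
  proof (rule cong_add)
    have "X.emb f * gen (Vec ?x) \<doteq> X.emb f * X.emb (lf ?x)" by (intro cong_lmult cong_sym[OF X.emb_lf])
    also have "\<dots> \<doteq> X.emb (f * lf ?x)" by (intro cong_sym[OF X.emb_mult] f polyfun_lf)
    finally show "X.emb f * gen (Vec ?x) * Y.emb g * gr w \<doteq> X.emb (lf ?x * f) * Y.emb g * gr w"
      unfolding mult.commute[of "lf ?x"] by (intro cong_rmult)
    have "X.emb f * ?S * gr w = (\<Sum>s\<in>R. scalar (ky ?x s) * (X.emb f * Y.emb (Y.dd s g) * (gr s * gr w)))"
      unfolding sum_distrib_left sum_distrib_right
    proof (intro sum.cong refl)
      fix s
      have "X.emb f * (scalar (ky ?x s) * Y.emb (Y.dd s g) * gr s) * gr w =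
        (X.emb f * scalar (ky ?x s)) * Y.emb (Y.dd s g) * gr s * gr w" by (simp only: mult.assoc)
      also have "X.emb f * scalar (ky ?x s) = scalar (ky ?x s) * X.emb f" by (rule scalar_central[symmetric])
      finally show "X.emb f * (scalar (ky ?x s) * Y.emb (Y.dd s g) * gr s) * gr w =
        scalar (ky ?x s) * (X.emb f * Y.emb (Y.dd s g) * (gr s * gr w))" by (simp only: mult.assoc)
    qed
    also have "\<dots> \<doteq> (\<Sum>s\<in>R. scalar (ky ?x s) * (X.emb f * Y.emb (Y.dd s g) * gr (s ** w)))"
      by (intro cong_sum cong_lmult gr_mult R_W w)
    finally show "X.emb f * ?S * gr w \<doteq> \<dots>" .
  qed
  finally have "T (X.emb f * Y.emb g * gr w * gen (Vec x)) \<doteq> T (X.emb (lf ?x * f) * Y.emb g * gr w +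
      (\<Sum>s\<in>R. scalar (ky ?x s) * (X.emb f * Y.emb (Y.dd s g) * gr (s ** w))))" by (rule T_cong)
  also have "\<dots> \<doteq> T (X.emb (lf ?x * f) * Y.emb g * gr w) + T (\<Sum>s\<in>R. scalar (ky ?x s) * (X.emb f * Y.emb (Y.dd s g) * gr (s ** w)))"
    by (rule T_add)
  also have "\<dots> \<doteq> T (X.emb (lf ?x * f) * Y.emb g * gr w) + 0"
    by (intro cong_add cong_refl T_sum_0 T_basic_dd f g W_mult R_W w)
  also have "\<dots> = T (X.emb (lf ?x * f) * Y.emb g * gr w)" by simp
  also have "\<dots> \<doteq> (if w = mat 1 then X.emb (X.Phi (lf ?x * f)) * Y.emb (Y.Phi g) else 0)"
    by (intro T_basic polyfun_intros f g w)
  also have "\<dots> = (if w = mat 1 then X.emb (X.Phi (lf x * f)) * Y.emb (Y.Phi g) else 0)" by simp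
  also have "\<dots> \<doteq> T (X.emb (lf x * f) * Y.emb g * gr w)"
    by (intro cong_sym[OF T_basic] polyfun_intros f g w)
  also have "\<dots> \<doteq> T (gen (Vec x) * (X.emb f * Y.emb g * gr w))"
    by (intro T_cong cong_sym[OF Vec_basic] f)
  finally show ?thesis by (simp only: Vec)
next
  case (Covec \<eta>)
  let ?h = "dual_act w \<eta>"
  have "gr w * gen (Covec \<eta>) \<doteq> gen (Covec ?h) * gr w"
    using w by (intro Y.conj)
      (simp_all add: carrier_GW Y.act_def lf_def fun_eq_iff pairing_commute[of _ \<eta>]
        pairing_commute[of _ "dual_act w \<eta>"] pairing_dual_act)
  then have "(X.emb f * Y.emb g) * (gr w * gen (Covec \<eta>)) \<doteq> (X.emb f * Y.emb g) * (gen (Covec ?h) * gr w)"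
    by (rule cong_lmult)
  then have "X.emb f * Y.emb g * gr w * gen (Covec \<eta>) \<doteq> X.emb f * (Y.emb g * gen (Covec ?h)) * gr w"
    by (simp add: mult.assoc)
  also have "\<dots> \<doteq> X.emb f * Y.emb (lf ?h * g) * gr w"
  proof (intro cong_rmult cong_lmult)
    have "Y.emb g * gen (Covec ?h) \<doteq> Y.emb g * Y.emb (lf ?h)" by (intro cong_lmult cong_sym[OF Y.emb_lf])
    also have "\<dots> \<doteq> Y.emb (g * lf ?h)" by (intro cong_sym[OF Y.emb_mult] g polyfun_lf)
    finally show "Y.emb g * gen (Covec ?h) \<doteq> Y.emb (lf ?h * g)" by (simp only: mult.commute)
  qed
  finally have "T (X.emb f * Y.emb g * gr w * gen (Covec \<eta>)) \<doteq> T (X.emb f * Y.emb (lf ?h * g) * gr w)"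
    by (rule T_cong)
  also have "\<dots> \<doteq> (if w = mat 1 then X.emb (X.Phi f) * Y.emb (Y.Phi (lf ?h * g)) else 0)"
    by (intro T_basic polyfun_intros f g w)
  also have "\<dots> = (if w = mat 1 then X.emb (X.Phi f) * Y.emb (Y.Phi (lf \<eta> * g)) else 0)"
    by (simp add: dual_act_def inv_one)
  also have "\<dots> \<doteq> T (X.emb f * Y.emb (lf \<eta> * g) * gr w)"
    by (intro cong_sym[OF T_basic] polyfun_intros f g w)
  finally have 1: "T (X.emb f * Y.emb g * gr w * gen (Covec \<eta>)) \<doteq> T (X.emb f * Y.emb (lf \<eta> * g) * gr w)" .
  have "T (gen (Covec \<eta>) * (X.emb f * Y.emb g * gr w)) \<doteq> T (X.emb f * Y.emb (lf \<eta> * g) * gr w -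
    (\<Sum>s\<in>R. scalar (kx \<eta> s) * (X.emb (X.dd s f) * Y.emb (Y.act s g) * gr (s ** w))))"
    by (intro T_cong Covec_basic f g w)
  also have "\<dots> \<doteq> T (X.emb f * Y.emb (lf \<eta> * g) * gr w) -
    T (\<Sum>s\<in>R. scalar (kx \<eta> s) * (X.emb (X.dd s f) * Y.emb (Y.act s g) * gr (s ** w)))" by (rule T_diff)
  also have "\<dots> \<doteq> T (X.emb f * Y.emb (lf \<eta> * g) * gr w) - 0"
    by (intro cong_diff cong_refl T_sum_0 T_basic_dd f Y.polyfun_act g W_mult R_W w)
  finally have "T (gen (Covec \<eta>) * (X.emb f * Y.emb g * gr w)) \<doteq> T (X.emb f * Y.emb (lf \<eta> * g) * gr w)" by simp
  then show ?thesis unfolding Covec using 1 cong_sym cong_trans by blast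
qed

text \<open>The elements \<open>q\<close> satisfying this for all \<open>p\<close> are closed under
  products, by rotating one factor at a time: \<open>p q r\<close>, \<open>r p q\<close>,
  \<open>q r p\<close>.\<close>

lemma T_symmetric: "T (p * q) \<doteq> T (q * p)"
proof (induction q arbitrary: p rule: free_gen_induct)
  case (scalar a) show ?case by (simp add: scalar_central)
next
  case (gen z)
  show ?case
  proof (induction p rule: basic_induct)
    case (cong p q)
    have "T (p * gen z) \<doteq> T (q * gen z)" by (intro T_cong cong_rmult cong)
    also have "\<dots> \<doteq> T (gen z * q)" by (rule cong)
    also have "\<dots> \<doteq> T (gen z * p)" by (intro T_cong cong_lmult cong_sym[OF cong(1)])
    finally show ?case .
  next
    case zero then show ?case by simp
  next
    case (add p q)
    have "T ((p + q) * gen z) \<doteq> T (p * gen z) + T (q * gen z)" by (simp add: distrib_right T_add)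
    also have "\<dots> \<doteq> T (gen z * p) + T (gen z * q)" by (intro cong_add add)
    also have "\<dots> \<doteq> T (gen z * (p + q))" by (simp add: distrib_left cong_sym[OF T_add])
    finally show ?case .
  next
    case (basic f g w) then show ?case by (rule T_commute_gen)
  qed
next
  case (add q r)
  have "T (p * (q + r)) \<doteq> T (p * q) + T (p * r)" by (simp add: distrib_left T_add)
  also have "\<dots> \<doteq> T (q * p) + T (r * p)" by (intro cong_add add)
  also have "\<dots> \<doteq> T ((q + r) * p)" by (simp add: distrib_right cong_sym[OF T_add])
  finally show ?case .
next
  case (mult q r)
  have "T (p * (q * r)) = T ((p * q) * r)" by (simp add: mult.assoc)
  also have "\<dots> \<doteq> T (r * (p * q))" by (rule mult)
  also have "\<dots> = T ((r * p) * q)" by (simp add: mult.assoc)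
  also have "\<dots> \<doteq> T (q * (r * p))" by (rule mult)
  finally show ?case by (simp add: mult.assoc)
qed

text \<open>Symmetry of \<open>T\<close> brings \<open>b\<close> next to \<open>a\<close>, and the
  group elements merge to \<open>w ** matrix_inv w'\<close>. This product twists \<open>d\<close>,
  but the trace vanishes unless it is the identity.\<close>

lemma T_cross:
  assumes p: "polyfun a" "polyfun b" "polyfun e" "polyfun d" and w: "w \<in> W" "w' \<in> W"
  shows "T ((X.emb a * Y.emb e * gr w) * (gr (matrix_inv w') * Y.emb d * X.emb b)) \<doteq>
    (if w = w' then X.emb (X.Phi (a * b)) * Y.emb (Y.Phi (e * d)) else 0)"
proof -
  let ?w = "w ** matrix_inv w'"
  have wW: "?w \<in> W" using w by (intro W_mult W_inv)
  have "T ((X.emb a * Y.emb e * gr w) * (gr (matrix_inv w') * Y.emb d * X.emb b)) =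
      T ((X.emb a * Y.emb e * (gr w * gr (matrix_inv w')) * Y.emb d) * X.emb b)" by (simp add: mult.assoc)
  also have "\<dots> \<doteq> T (X.emb b * (X.emb a * Y.emb e * (gr w * gr (matrix_inv w')) * Y.emb d))"
    by (rule T_symmetric)
  also have "\<dots> \<doteq> T (X.emb b * (X.emb a * Y.emb e * gr ?w * Y.emb d))"
    using w by (intro T_cong cong_lmult cong_rmult gr_mult W_inv)
  also have "\<dots> = T ((X.emb b * X.emb a) * (Y.emb e * (gr ?w * Y.emb d)))" by (simp add: mult.assoc)
  also have "\<dots> \<doteq> T ((X.emb b * X.emb a) * (Y.emb e * (Y.emb (Y.act ?w d) * gr ?w)))"
    using wW p by (intro T_cong cong_lmult Y.gamma_emb) (simp_all add: carrier_GW)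
  also have "\<dots> = T ((X.emb b * X.emb a) * (Y.emb e * Y.emb (Y.act ?w d)) * gr ?w)" by (simp add: mult.assoc)
  also have "\<dots> \<doteq> T (X.emb (b * a) * Y.emb (e * Y.act ?w d) * gr ?w)"
    using p by (intro T_cong cong_rmult cong_mult cong_sym[OF X.emb_mult] cong_sym[OF Y.emb_mult] Y.polyfun_act)
  also have "\<dots> \<doteq> (if ?w = mat 1 then X.emb (X.Phi (b * a)) * Y.emb (Y.Phi (e * Y.act ?w d)) else 0)"
    using p wW by (intro T_basic polyfun_mult Y.polyfun_act)
  also have "\<dots> = (if w = w' then X.emb (X.Phi (a * b)) * Y.emb (Y.Phi (e * d)) else 0)"
  proof -
    have "?w = mat 1 \<longleftrightarrow> w = w'"
    proof
      assume "?w = mat 1"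
      then have "?w ** w' = w'" by simp
      then show "w = w'" using inv_left[OF w(2)] by (simp flip: matrix_mul_assoc)
    qed (use inv_right w in simp)
    then show ?thesis
      using inv_right[OF w(2)] by (cases "w = w'") (simp_all add: act_mat_1 mult.commute[of b])
  qed
  finally show ?thesis .
qed

text \<open>In \<open>e'\<close> the factors stand in reverse order, so that in
  \<open>e i * e' j\<close> the group elements are adjacent and \<open>T_cross\<close> splits the
  trace into the two polynomial pairings. For spanning, both polynomial factors are expanded in
  their bases, and the coefficients move to the front because they are central.\<close>

lemma dual_bases:
  "\<exists>(I :: (nat \<times> nat \<times> (complex ^ 'n ^ 'n)) set) e e'. finite I \<and>
    (\<forall>i\<in>I. \<forall>j\<in>I. T (e i * e' j) \<doteq> (if i = j then 1 else 0)) \<and>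
    (\<forall>p. \<exists>z. (\<forall>i\<in>I. z i \<in> Z0) \<and> p \<doteq> (\<Sum>i\<in>I. z i * e i))"
proof -
  obtain k :: nat and b b' where b: "\<forall>i<k. polyfun (b i) \<and> polyfun (b' i)"
    and bb: "\<forall>i<k. \<forall>j<k. X.Phi (b i * b' j) = (if i = j then 1 else 0)"
    and bs: "\<forall>f. polyfun f \<longrightarrow> f = (\<Sum>i<k. X.Phi (f * b' i) * b i)"
    using X.dual_bases_exist by blast
  obtain l :: nat and d d' where d: "\<forall>i<l. polyfun (d i) \<and> polyfun (d' i)"
    and dd: "\<forall>i<l. \<forall>j<l. Y.Phi (d i * d' j) = (if i = j then 1 else 0)"
    and ds: "\<forall>f. polyfun f \<longrightarrow> f = (\<Sum>i<l. Y.Phi (f * d' i) * d i)"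
    using Y.dual_bases_exist by blast
  define I where "I = {..<k} \<times> {..<l} \<times> W"
  define e where "e = (\<lambda>(i, j, w). X.emb (b i) * Y.emb (d j) * gr w)"
  define e' where "e' = (\<lambda>(i, j, w). gr (matrix_inv w) * Y.emb (d' j) * X.emb (b' i))"
  have fin: "finite I" unfolding I_def using finite_W by simp
  have dual: "T (e x * e' y) \<doteq> (if x = y then 1 else 0)" if xy: "x \<in> I" "y \<in> I" for x y
  proof -
    obtain i j w where x: "x = (i, j, w)" by (cases x) auto
    obtain i' j' w' where y: "y = (i', j', w')" by (cases y) auto
    have ij: "i < k" "j < l" "w \<in> W" "i' < k" "j' < l" "w' \<in> W" using xy by (auto simp: I_def x y)
    have "T (e x * e' y) \<doteq> (if w = w' then X.emb (X.Phi (b i * b' i')) * Y.emb (Y.Phi (d j * d' j')) else 0)"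
      using T_cross[of "b i" "b' i'" "d j" "d' j'" w w'] b d ij by (simp add: e_def e'_def x y)
    also have "\<dots> = (if w = w' then X.emb (if i = i' then 1 else 0) * Y.emb (if j = j' then 1 else 0) else 0)"
      using bb dd ij by simp
    also have "\<dots> \<doteq> (if w = w' then (if i = i' then 1 else 0) * (if j = j' then 1 else 0) else 0)"
    proof -
      have "X.emb (if i = i' then 1 else 0) \<doteq> (if i = i' then 1 else 0)"
        "Y.emb (if j = j' then 1 else 0) \<doteq> (if j = j' then 1 else 0)"
        using X.emb_1 X.emb_0 Y.emb_1 Y.emb_0 by simp_all
      from cong_mult[OF this] show ?thesis by simp
    qed
    also have "\<dots> = (if x = y then 1 else 0)" by (simp add: x y)
    finally show ?thesis .
  qed
  have span: "\<exists>z. (\<forall>i\<in>I. z i \<in> Z0) \<and> p \<doteq> (\<Sum>i\<in>I. z i * e i)" for p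
  proof (induction p rule: basic_induct)
    case (cong p q) then show ?case using cong_trans by blast
  next
    case zero show ?case by (rule exI[of _ "\<lambda>_. 0"]) (simp add: Z0_0)
  next
    case (add p q)
    then obtain z z' where z: "\<forall>i\<in>I. z i \<in> Z0" "p \<doteq> (\<Sum>i\<in>I. z i * e i)"
      and z': "\<forall>i\<in>I. z' i \<in> Z0" "q \<doteq> (\<Sum>i\<in>I. z' i * e i)" by blast
    have "p + q \<doteq> (\<Sum>i\<in>I. (z i + z' i) * e i)"
      using cong_add[OF z(2) z'(2)] by (simp add: distrib_right sum.distrib)
    then show ?case using z z' by (intro exI[of _ "\<lambda>i. z i + z' i"]) (simp add: Z0_add)
  next
    case (basic f g w)
    define P where "P i = X.emb (X.Phi (f * b' i))" for i
    define Q where "Q j = Y.emb (Y.Phi (g * d' j))" for j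
    \<comment> \<open>The coefficients are concentrated at the group element \<open>w\<close> of the
      given term.\<close>
    define z where "z = (\<lambda>(i, j, w'). if w' = w then P i * Q j else 0)"
    have PI: "X.invariant (X.Phi (f * b' i))" if "i < k" for i
      using b that basic by (intro X.invariant_Phi polyfun_mult) auto
    have QI: "Y.invariant (Y.Phi (g * d' j))" if "j < l" for j
      using d that basic by (intro Y.invariant_Phi polyfun_mult) auto
    have zI: "\<forall>i\<in>I. z i \<in> Z0"
      using PI QI by (auto simp: z_def I_def P_def Q_def Z0_0 intro: Z0_basic)
    have Xf: "X.emb f \<doteq> (\<Sum>i<k. P i * X.emb (b i))"
    proof -
      have "X.emb f = X.emb (\<Sum>i<k. X.Phi (f * b' i) * b i)" using bs basic(1) by (metis (no_types))
      also have "\<dots> \<doteq> (\<Sum>i<k. X.emb (X.Phi (f * b' i) * b i))"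
        using b PI by (intro X.emb_sum polyfun_mult X.invariantD(1)[OF PI]) auto
      also have "\<dots> \<doteq> (\<Sum>i<k. P i * X.emb (b i))"
        unfolding P_def using b PI by (intro cong_sum X.emb_mult X.invariantD(1)[OF PI]) auto
      finally show ?thesis .
    qed
    have Yg: "Y.emb g \<doteq> (\<Sum>j<l. Q j * Y.emb (d j))"
    proof -
      have "Y.emb g = Y.emb (\<Sum>j<l. Y.Phi (g * d' j) * d j)" using ds basic(2) by (metis (no_types))
      also have "\<dots> \<doteq> (\<Sum>j<l. Y.emb (Y.Phi (g * d' j) * d j))"
        using d QI by (intro Y.emb_sum polyfun_mult Y.invariantD(1)[OF QI]) auto
      also have "\<dots> \<doteq> (\<Sum>j<l. Q j * Y.emb (d j))"
        unfolding Q_def using d QI by (intro cong_sum Y.emb_mult Y.invariantD(1)[OF QI]) auto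
      finally show ?thesis .
    qed
    have "X.emb f * Y.emb g * gr w \<doteq> (\<Sum>i<k. P i * X.emb (b i)) * (\<Sum>j<l. Q j * Y.emb (d j)) * gr w"
      by (intro cong_rmult cong_mult Xf Yg)
    also have "\<dots> = (\<Sum>i<k. \<Sum>j<l. P i * (X.emb (b i) * Q j) * Y.emb (d j) * gr w)"
      by (subst sum_product) (simp add: sum_distrib_right mult.assoc)
    also have "\<dots> \<doteq> (\<Sum>i<k. \<Sum>j<l. P i * (Q j * X.emb (b i)) * Y.emb (d j) * gr w)"
      unfolding Q_def using QI by (intro cong_sum cong_rmult cong_lmult cong_sym[OF Y_central]) auto
    also have "\<dots> = (\<Sum>i<k. \<Sum>j<l. z (i, j, w) * e (i, j, w))"
      by (simp add: z_def e_def mult.assoc)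
    also have "\<dots> = (\<Sum>i<k. \<Sum>j<l. \<Sum>w'\<in>W. z (i, j, w') * e (i, j, w'))"
    proof (intro sum.cong refl)
      fix i j
      have "(\<Sum>w'\<in>W. z (i, j, w') * e (i, j, w')) = (\<Sum>w'\<in>W. if w' = w then z (i, j, w) * e (i, j, w) else 0)"
        by (intro sum.cong refl) (auto simp: z_def)
      then show "z (i, j, w) * e (i, j, w) = (\<Sum>w'\<in>W. z (i, j, w') * e (i, j, w'))"
        using basic(3) finite_W by simp
    qed
    also have "\<dots> = (\<Sum>i\<in>I. z i * e i)"
      unfolding I_def by (simp add: sum.cartesian_product)
    finally show ?case using zI by blast
  qed
  have "(\<forall>i\<in>I. \<forall>j\<in>I. T (e i * e' j) \<doteq> (if i = j then 1 else 0)) \<and>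
      (\<forall>p. \<exists>z. (\<forall>i\<in>I. z i \<in> Z0) \<and> p \<doteq> (\<Sum>i\<in>I. z i * e i))"
    using dual span by blast
  with fin show ?thesis by (intro exI[of _ I] exI[of _ e] exI[of _ e'] conjI) simp_all
qed

end

section \<open>Symmetrising traces with dual bases\<close>

lemma (in ring) additive_finsum:
  assumes f: "f \<in> carrier R \<rightarrow> carrier R"
    and add: "\<And>x y. x \<in> carrier R \<Longrightarrow> y \<in> carrier R \<Longrightarrow> f (x \<oplus> y) = f x \<oplus> f y"
    and "finite I" "h \<in> I \<rightarrow> carrier R"
  shows "f (\<Oplus>i\<in>I. h i) = (\<Oplus>i\<in>I. f (h i))"
  using assms(3,4)
proof (induction I rule: finite_induct)
  case empty
  have c: "f \<zero> \<in> carrier R" using f by auto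
  have "f \<zero> \<oplus> f \<zero> = f \<zero>" using add[of \<zero> \<zero>] by simp
  then show ?case using c add.l_cancel_one by simp
next
  case (insert i I)
  have h: "h \<in> I \<rightarrow> carrier R" "h i \<in> carrier R" using insert.prems by auto
  have "f (\<Oplus>j\<in>insert i I. h j) = f (h i \<oplus> (\<Oplus>j\<in>I. h j))" using insert.hyps h by simp
  also have "\<dots> = f (h i) \<oplus> (\<Oplus>j\<in>I. f (h j))" using add h insert.IH by simp
  also have "\<dots> = (\<Oplus>j\<in>insert i I. f (h j))"
    using insert.hyps h f by (subst finsum_insert) auto
  finally show ?case .
qed

lemma (in ring) finsum_single:
  assumes "finite I" "i \<in> I" "x \<in> carrier R"
  shows "(\<Oplus>j\<in>I. if i = j then x else \<zero>) = x"
  using add.finprod_singleton[of i I "\<lambda>_. x"] assms by simp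

text \<open>Pairing with the \<open>e' j\<close> reads off coefficients with respect to the
  \<open>e i\<close>, which gives freeness. The isomorphism sends \<open>a\<close> to the functional
  \<open>t (x \<otimes> a)\<close> of \<open>x\<close>, and symmetry of \<open>t\<close> makes the
  identity its Nakayama automorphism.\<close>

lemma symmetric_frobenius_extensionI:
  fixes R :: "('a, 'm) ring_scheme" (structure)
  assumes R: "ring R" and Z: "subring Z R" and cen: "Z \<subseteq> ring_center R" and nz: "\<one> \<noteq> \<zero>"
    and I: "finite I" and e: "e \<in> I \<rightarrow> carrier R" and e': "e' \<in> I \<rightarrow> carrier R"
    and tZ: "t \<in> carrier R \<rightarrow> Z"
    and tadd: "\<And>x y. x \<in> carrier R \<Longrightarrow> y \<in> carrier R \<Longrightarrow> t (x \<oplus> y) = t x \<oplus> t y"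
    and tmult: "\<And>z x. z \<in> Z \<Longrightarrow> x \<in> carrier R \<Longrightarrow> t (z \<otimes> x) = z \<otimes> t x"
    and tsym: "\<And>x y. x \<in> carrier R \<Longrightarrow> y \<in> carrier R \<Longrightarrow> t (x \<otimes> y) = t (y \<otimes> x)"
    and dual: "\<And>i j. i \<in> I \<Longrightarrow> j \<in> I \<Longrightarrow> t (e i \<otimes> e' j) = (if i = j then \<one> else \<zero>)"
    and span: "\<And>x. x \<in> carrier R \<Longrightarrow> \<exists>z. z \<in> I \<rightarrow> Z \<and> x = (\<Oplus>i\<in>I. z i \<otimes> e i)"
  shows "symmetric_frobenius_extension R Z"
proof -
  interpret ring R by (rule R)
  have ZR: "z \<in> carrier R" if "z \<in> Z" for z using subringE(1)[OF Z] that by blast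
  have tR: "t x \<in> carrier R" if "x \<in> carrier R" for x using tZ ZR that by blast
  have tR': "t \<in> carrier R \<rightarrow> carrier R" using tR by blast
  have eR: "e i \<in> carrier R" "e' i \<in> carrier R" if "i \<in> I" for i using e e' that by auto
  have comm: "z \<otimes> x = x \<otimes> z" if "z \<in> Z" "x \<in> carrier R" for z x
    using cen that by (auto simp: ring_center_def)
  have coeff: "t ((\<Oplus>i\<in>I. z i \<otimes> e i) \<otimes> e' j) = z j" if z: "z \<in> I \<rightarrow> Z" and j: "j \<in> I" for z j
  proof -
    have zR: "z i \<in> carrier R" if "i \<in> I" for i using z ZR that by blast
    have ze: "(\<lambda>i. z i \<otimes> e i) \<in> I \<rightarrow> carrier R" using zR eR by auto
    have "(\<Oplus>i\<in>I. z i \<otimes> e i) \<otimes> e' j = (\<Oplus>i\<in>I. z i \<otimes> e i \<otimes> e' j)"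
      by (rule finsum_ldistr[OF I eR(2)[OF j] ze])
    also have "t \<dots> = (\<Oplus>i\<in>I. t (z i \<otimes> e i \<otimes> e' j))"
      using zR eR j by (intro additive_finsum[OF tR' tadd I]) auto
    also have "\<dots> = (\<Oplus>i\<in>I. if j = i then z j else \<zero>)"
    proof (rule finsum_cong')
      fix i assume i: "i \<in> I"
      have "t (z i \<otimes> e i \<otimes> e' j) = z i \<otimes> t (e i \<otimes> e' j)"
        using z i j zR eR by (auto simp: m_assoc intro!: tmult)
      then show "t (z i \<otimes> e i \<otimes> e' j) = (if j = i then z j else \<zero>)"
        using dual[OF i j] zR i by auto
    qed (use zR j in auto)
    also have "\<dots> = z j" using finsum_single[OF I j] zR j by simp
    finally show ?thesis .
  qed
  have expand: "x = (\<Oplus>i\<in>I. t (x \<otimes> e' i) \<otimes> e i)" if x: "x \<in> carrier R" for x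
  proof -
    obtain z where z: "z \<in> I \<rightarrow> Z" "x = (\<Oplus>i\<in>I. z i \<otimes> e i)" using span[OF x] by blast
    have zR: "z i \<in> carrier R" if "i \<in> I" for i using z ZR that by blast
    have "x = (\<Oplus>i\<in>I. z i \<otimes> e i)" by (rule z)
    also have "\<dots> = (\<Oplus>i\<in>I. t (x \<otimes> e' i) \<otimes> e i)"
      using coeff[OF z(1)] zR eR unfolding z(2) by (intro finsum_cong') auto
    finally show ?thesis .
  qed
  \<comment> \<open>The basis in \<open>free_of_finite_rank\<close> is a set, so distinct indices
    must give distinct elements; equal ones would force \<open>\<one> = \<zero>\<close>.\<close>
  have inj: "inj_on e I"
  proof (rule inj_onI, rule ccontr)
    fix i j assume ij: "i \<in> I" "j \<in> I" "e i = e j" "i \<noteq> j"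
    then show False using dual[of i i] dual[of j i] nz by simp
  qed
  have free: "free_of_finite_rank R Z"
    unfolding free_of_finite_rank_def
  proof (intro exI conjI ballI)
    show "finite (e ` I)" using I by simp
    show "e ` I \<subseteq> carrier R" using eR by blast
    fix r assume r: "r \<in> carrier R"
    have re: "(\<Oplus>b\<in>e ` I. a b \<otimes> b) = (\<Oplus>i\<in>I. a (e i) \<otimes> e i)" if "a \<in> e ` I \<rightarrow> Z" for a
    proof (rule finsum_reindex[OF _ inj])
      show "(\<lambda>b. a b \<otimes> b) \<in> e ` I \<rightarrow> carrier R"
      proof
        fix b assume "b \<in> e ` I"
        then show "a b \<otimes> b \<in> carrier R" using that ZR[of "a b"] eR by auto
      qed
    qed
    show "\<exists>!a. a \<in> e ` I \<rightarrow>\<^sub>E Z \<and> r = (\<Oplus>b\<in>e ` I. a b \<otimes> b)"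
    proof (rule ex_ex1I)
      let ?a = "restrict (\<lambda>b. t (r \<otimes> e' (inv_into I e b))) (e ` I)"
      have a: "?a \<in> e ` I \<rightarrow> Z" using r eR tZ inj by auto
      have "(\<Oplus>b\<in>e ` I. ?a b \<otimes> b) = (\<Oplus>i\<in>I. t (r \<otimes> e' i) \<otimes> e i)"
        unfolding re[OF a] using inj r eR tR by (intro finsum_cong') auto
      then show "\<exists>a. a \<in> e ` I \<rightarrow>\<^sub>E Z \<and> r = (\<Oplus>b\<in>e ` I. a b \<otimes> b)"
        using expand[OF r] a by (intro exI[of _ ?a]) (auto simp: PiE_def)
    next
      fix a a' assume a: "a \<in> e ` I \<rightarrow>\<^sub>E Z \<and> r = (\<Oplus>b\<in>e ` I. a b \<otimes> b)"
        and a': "a' \<in> e ` I \<rightarrow>\<^sub>E Z \<and> r = (\<Oplus>b\<in>e ` I. a' b \<otimes> b)"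
      have "a (e j) = a' (e j)" if j: "j \<in> I" for j
      proof -
        have pa: "a \<in> e ` I \<rightarrow> Z" "a' \<in> e ` I \<rightarrow> Z" using a a' by (auto simp: PiE_def)
        have "t (r \<otimes> e' j) = a (e j)"
          using coeff[of "\<lambda>i. a (e i)" j] j re[OF pa(1)] a pa by auto
        moreover have "t (r \<otimes> e' j) = a' (e j)"
          using coeff[of "\<lambda>i. a' (e i)" j] j re[OF pa(2)] a' pa by auto
        ultimately show ?thesis by simp
      qed
      then show "a = a'" using a a' by (intro PiE_ext[of a "e ` I" "\<lambda>_. Z"]) auto
    qed
  qed
  define F where "F a = restrict (\<lambda>x. t (x \<otimes> a)) (carrier R)" for a
  have F: "F a x = t (x \<otimes> a)" if "x \<in> carrier R" for a x using that by (simp add: F_def)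
  have F_hom: "F a \<in> hom_to_base R Z" if a: "a \<in> carrier R" for a
    unfolding hom_to_base_def
    using a tZ ZR by (auto simp: F_def l_distr tadd m_assoc tmult)
  have F_inj: "inj_on F (carrier R)"
  proof (rule inj_onI)
    fix a b assume ab: "a \<in> carrier R" "b \<in> carrier R" "F a = F b"
    \<comment> \<open>By symmetry the values of \<open>F a\<close> at the \<open>e' i\<close> are
      the coefficients of \<open>a\<close> in the basis \<open>e\<close>.\<close>
    have eq: "t (a \<otimes> e' i) = t (b \<otimes> e' i)" if i: "i \<in> I" for i
      using fun_cong[OF ab(3), of "e' i"] F eR[OF i] ab tsym by metis
    have "a = (\<Oplus>i\<in>I. t (a \<otimes> e' i) \<otimes> e i)" by (rule expand[OF ab(1)])
    also have "\<dots> = (\<Oplus>i\<in>I. t (b \<otimes> e' i) \<otimes> e i)"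
      using eq ab eR tR by (intro finsum_cong') auto
    also have "\<dots> = b" by (rule expand[OF ab(2), symmetric])
    finally show "a = b" .
  qed
  have F_surj: "\<exists>a\<in>carrier R. F a = \<phi>" if \<phi>: "\<phi> \<in> hom_to_base R Z" for \<phi>
  proof -
    have pZ: "\<phi> x \<in> Z" if "x \<in> carrier R" for x using \<phi> that by (auto simp: hom_to_base_def)
    have padd: "\<phi> (x \<oplus> y) = \<phi> x \<oplus> \<phi> y" if "x \<in> carrier R" "y \<in> carrier R" for x y
      using \<phi> that by (auto simp: hom_to_base_def)
    have pmult: "\<phi> (z \<otimes> x) = z \<otimes> \<phi> x" if "z \<in> Z" "x \<in> carrier R" for z x
      using \<phi> that by (auto simp: hom_to_base_def)
    have pR: "\<phi> \<in> carrier R \<rightarrow> carrier R" using pZ ZR by blast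
    \<comment> \<open>The dual basis, weighted with the values of \<open>\<phi>\<close> on the
      basis, represents \<open>\<phi>\<close>.\<close>
    define a where "a = (\<Oplus>i\<in>I. \<phi> (e i) \<otimes> e' i)"
    have pe: "(\<lambda>i. \<phi> (e i) \<otimes> e' i) \<in> I \<rightarrow> carrier R" using pZ ZR eR by auto
    have a: "a \<in> carrier R" unfolding a_def by (rule finsum_closed[OF pe])
    have te: "t (e j \<otimes> a) = \<phi> (e j)" if j: "j \<in> I" for j
    proof -
      have "e j \<otimes> a = (\<Oplus>i\<in>I. e j \<otimes> (\<phi> (e i) \<otimes> e' i))"
        unfolding a_def by (rule finsum_rdistr[OF I eR(1)[OF j] pe])
      also have "t \<dots> = (\<Oplus>i\<in>I. t (e j \<otimes> (\<phi> (e i) \<otimes> e' i)))"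
        using pe eR j by (intro additive_finsum[OF tR' tadd I]) auto
      also have "\<dots> = (\<Oplus>i\<in>I. if j = i then \<phi> (e j) else \<zero>)"
      proof (rule finsum_cong')
        fix i assume i: "i \<in> I"
        have z: "\<phi> (e i) \<in> Z" "\<phi> (e i) \<in> carrier R" using pZ ZR eR i by auto
        have "e j \<otimes> (\<phi> (e i) \<otimes> e' i) = \<phi> (e i) \<otimes> (e j \<otimes> e' i)"
          using comm[OF z(1) eR(1)[OF j]] z eR i j by (simp flip: m_assoc)
        then have "t (e j \<otimes> (\<phi> (e i) \<otimes> e' i)) = \<phi> (e i) \<otimes> t (e j \<otimes> e' i)"
          using z eR i j by (simp add: tmult)
        then show "t (e j \<otimes> (\<phi> (e i) \<otimes> e' i)) = (if j = i then \<phi> (e j) else \<zero>)"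
          using dual[OF j i] z by auto
      qed (use pZ ZR eR j in auto)
      also have "\<dots> = \<phi> (e j)" using finsum_single[OF I j] pZ ZR eR j by simp
      finally show ?thesis .
    qed
    have "t (x \<otimes> a) = \<phi> x" if x: "x \<in> carrier R" for x
    proof -
      obtain z where z: "z \<in> I \<rightarrow> Z" "x = (\<Oplus>i\<in>I. z i \<otimes> e i)" using span[OF x] by blast
      have zR: "z i \<in> carrier R" if "i \<in> I" for i using z ZR that by blast
      have ze: "(\<lambda>i. z i \<otimes> e i) \<in> I \<rightarrow> carrier R" using zR eR by auto
      have "x \<otimes> a = (\<Oplus>i\<in>I. z i \<otimes> e i \<otimes> a)" unfolding z(2) by (rule finsum_ldistr[OF I a ze])
      also have "t \<dots> = (\<Oplus>i\<in>I. t (z i \<otimes> e i \<otimes> a))"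
        using zR eR a by (intro additive_finsum[OF tR' tadd I]) auto
      also have "\<dots> = (\<Oplus>i\<in>I. \<phi> (z i \<otimes> e i))"
      proof (rule finsum_cong')
        fix i assume i: "i \<in> I"
        have zi: "z i \<in> Z" using z i by blast
        have "t (z i \<otimes> e i \<otimes> a) = z i \<otimes> t (e i \<otimes> a)"
          using zi zR eR a i by (simp add: m_assoc tmult)
        also have "\<dots> = \<phi> (z i \<otimes> e i)" using zi eR i by (simp add: te pmult)
        finally show "t (z i \<otimes> e i \<otimes> a) = \<phi> (z i \<otimes> e i)" .
      qed (use pZ ZR zR eR in auto)
      also have "\<dots> = \<phi> x" unfolding z(2) by (rule additive_finsum[OF pR padd I ze, symmetric])
      finally show ?thesis .
    qed
    then have "F a = \<phi>"
      using \<phi> by (intro extensionalityI[of _ "carrier R"]) (auto simp: F_def hom_to_base_def PiE_def)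
    then show ?thesis using a by blast
  qed
  have "bij_betw F (carrier R) (hom_to_base R Z)"
    unfolding bij_betw_def using F_inj F_hom F_surj by blast
  then have iso: "frobenius_iso R Z F"
    unfolding frobenius_iso_def
  proof (intro conjI ballI)
    fix a s x assume a: "a \<in> carrier R" and s: "s \<in> Z" and x: "x \<in> carrier R"
    have "t (x \<otimes> (a \<otimes> s)) = t (s \<otimes> (x \<otimes> a))"
      using comm[OF s, of "x \<otimes> a"] a x ZR[OF s] by (simp add: m_assoc)
    also have "\<dots> = t (x \<otimes> a) \<otimes> s" using a s x comm[OF s tR] by (simp add: tmult)
    finally show "F (a \<otimes> s) x = F a x \<otimes> s" using x by (simp add: F)
  qed (auto simp: F r_distr tadd m_assoc)
  have nak: "nakayama_automorphism R Z F (\<lambda>x. x)"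
    unfolding nakayama_automorphism_def frobenius_form_def
    using tsym by (auto simp: F ring_iso_def ring_hom_def bij_betw_def)
  have inner: "inner_automorphism R (\<lambda>x. x)"
    unfolding inner_automorphism_def by (intro bexI[of _ \<one>]) auto
  show ?thesis
    unfolding symmetric_frobenius_extension_def free_frobenius_extension_def
    using R Z cen free iso nak inner by blast
qed

section \<open>Transport to the quotient ring\<close>

context cherednik
begin

abbreviation "H \<equiv> cherednik_algebra W c \<alpha> \<alpha>'"

text \<open>The quotient map, extended to all words by \<open>res\<close>. With
  \<open>cl_eq_iff\<close> every congruence becomes an equality in \<open>H\<close>.\<close>

definition cl :: "'n cgen free \<Rightarrow> 'n cgen free set" where
  "cl p = cherednik_ideal W c \<alpha> \<alpha>' +>\<^bsub>FA\<^esub> res (cherednik_gens W) p"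

lemma ring_H: "ring H" by (rule ring_cherednik_algebra[OF subgroup_W])

lemma cl_eq_iff: "cl p = cl q \<longleftrightarrow> p \<doteq> q"
proof -
  interpret I: ideal "cherednik_ideal W c \<alpha> \<alpha>'" FA by (rule ideal_cherednik)
  have "res (cherednik_gens W) p \<ominus>\<^bsub>FA\<^esub> res (cherednik_gens W) q = res (cherednik_gens W) (p - q)"
    using res_carrier[of "cherednik_gens W" q]
    by (simp add: a_minus_def a_inv_free_algebra add_free_algebra res_diff)
  then show ?thesis
    using I.quotient_eq_iff_same_a_r_cos[OF ideal_cherednik res_carrier res_carrier, of p q]
    unfolding cl_def cong_def by (simp add: Jx_def)
qed

lemma cl_carrier: "cl p \<in> carrier H"
  and cl_mult: "cl p \<otimes>\<^bsub>H\<^esub> cl q = cl (p * q)"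
  and cl_add: "cl p \<oplus>\<^bsub>H\<^esub> cl q = cl (p + q)"
  and cl_one: "cl 1 = \<one>\<^bsub>H\<^esub>"
proof -
  interpret I: ideal "cherednik_ideal W c \<alpha> \<alpha>'" FA by (rule ideal_cherednik)
  note h = I.rcos_ring_hom[folded cherednik_algebra_def]
  show "cl p \<in> carrier H" using ring_hom_closed[OF h res_carrier] by (simp add: cl_def)
  show "cl p \<otimes>\<^bsub>H\<^esub> cl q = cl (p * q)"
    using ring_hom_mult[OF h res_carrier res_carrier, of p q] by (simp add: cl_def res_mult mult_free_algebra)
  show "cl p \<oplus>\<^bsub>H\<^esub> cl q = cl (p + q)"
    using ring_hom_add[OF h res_carrier res_carrier, of p q] by (simp add: cl_def res_add add_free_algebra)
  show "cl 1 = \<one>\<^bsub>H\<^esub>"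
    using ring_hom_one[OF h] by (simp add: cl_def res_1 one_free_algebra)
qed

lemma cl_zero: "cl 0 = \<zero>\<^bsub>H\<^esub>"
proof -
  interpret ring H by (rule ring_H)
  have "cl 0 \<oplus>\<^bsub>H\<^esub> cl 0 = cl 0" by (simp add: cl_add)
  then show ?thesis using add.l_cancel_one[OF cl_carrier cl_carrier] by simp
qed

lemma cl_uminus: "cl (- p) = \<ominus>\<^bsub>H\<^esub> cl p"
proof -
  interpret ring H by (rule ring_H)
  have "cl (- p) \<oplus>\<^bsub>H\<^esub> cl p = \<zero>\<^bsub>H\<^esub>" by (simp add: cl_add cl_zero)
  then show ?thesis using cl_carrier minus_equality by metis
qed

lemma cl_surj: "A \<in> carrier H \<Longrightarrow> \<exists>p. cl p = A"
proof -
  assume "A \<in> carrier H"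
  then obtain p where "p \<in> carrier FA" "A = cherednik_ideal W c \<alpha> \<alpha>' +>\<^bsub>FA\<^esub> p"
    by (auto simp: cherednik_algebra_def FactRing_def A_RCOSETS_def')
  then show ?thesis by (intro exI[of _ p]) (simp add: cl_def res_id)
qed

lemma cl_sum: "finite I \<Longrightarrow> cl (\<Sum>i\<in>I. p i) = (\<Oplus>\<^bsub>H\<^esub>i\<in>I. cl (p i))"
proof (induction I rule: finite_induct)
  case empty
  interpret ring H by (rule ring_H)
  show ?case by (simp add: cl_zero)
next
  case (insert i I)
  interpret ring H by (rule ring_H)
  have "cl (\<Sum>i\<in>insert i I. p i) = cl (p i) \<oplus>\<^bsub>H\<^esub> cl (\<Sum>i\<in>I. p i)"
    using insert.hyps by (simp add: cl_add)
  also have "\<dots> = (\<Oplus>\<^bsub>H\<^esub>i\<in>insert i I. cl (p i))"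
    unfolding insert.IH using insert.hyps cl_carrier by (simp add: Pi_I)
  finally show ?case .
qed

lemma cl_relabel: "(\<And>x. \<iota> x \<in> cherednik_gens W) \<Longrightarrow>
    cherednik_ideal W c \<alpha> \<alpha>' +>\<^bsub>FA\<^esub> relabel \<iota> p = cl (relabel \<iota> p)"
  by (simp add: cl_def res_relabel)

text \<open>An invariant coset is a fibre of \<open>ev\<close>, and by \<open>emb_ev\<close> all of
  its tensors have the same class after relabelling.\<close>

lemma symmetric_image_Vec:
  "symmetric_image W c \<alpha> \<alpha>' Vec (symmetric_invariants W (*v)) = {cl (X.emb f) | f. X.invariant f}"
proof -
  have inv: "symmetric_invariants W (*v) =
      {{q. ev q = f} | f. polyfun f \<and> (\<forall>w\<in>W. (\<lambda>v. f (transpose w *v v)) = f)}"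
  proof (rule symmetric_invariants_eq)
    show "pairing v (w *v x) = pairing (transpose w *v v) x" for w :: "complex ^ 'n ^ 'n" and x v
      by (simp only: pairing_matrix transpose_matrix_vector)
    show "w *v (matrix_inv w *v x) = x" if "w \<in> W" for w x by (rule inv_right'[OF that])
    show "transpose w ** transpose (matrix_inv w) = mat 1" if "w \<in> W" for w
      by (simp only: matrix_transpose_mul[symmetric] inv_left[OF that] transpose_mat)
  qed
  have xinv: "X.invariant f \<longleftrightarrow> polyfun f \<and> (\<forall>w\<in>W. (\<lambda>v. f (transpose w *v v)) = f)" for f
    by (simp add: X.invariant_def X.act_def carrier_GW)
  have rel: "cherednik_ideal W c \<alpha> \<alpha>' +>\<^bsub>FA\<^esub> relabel Vec q = cl (X.emb (ev q))" for q
    using cl_relabel[of Vec q] cl_eq_iff X.emb_ev[of q] by (simp add: cherednik_gens_def cong_sym)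
  show ?thesis
    unfolding symmetric_image_def inv
  proof (intro equalityI subsetI)
    fix A assume "A \<in> {cl (X.emb f) |f. X.invariant f}"
    then obtain f where f: "X.invariant f" "A = cl (X.emb f)" by blast
    have "ev (lift f) = f" using ev_lift X.invariantD(1)[OF f(1)] by blast
    then show "A \<in> {cherednik_ideal W c \<alpha> \<alpha>' +>\<^bsub>FA\<^esub> relabel Vec p |p A.
        A \<in> {{q. ev q = f} |f. polyfun f \<and> (\<forall>w\<in>W. (\<lambda>v. f (transpose w *v v)) = f)} \<and> p \<in> A}"
      using f xinv by (intro CollectI exI[of _ "lift f"] exI[of _ "{q. ev q = f}"]) (auto simp: rel)
  qed (auto simp: rel xinv)
qed

lemma symmetric_image_Covec:
  "symmetric_image W c \<alpha> \<alpha>' Covec (symmetric_invariants W dual_act) = {cl (Y.emb f) | f. Y.invariant f}"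
proof -
  have inv: "symmetric_invariants W dual_act =
      {{q. ev q = f} | f. polyfun f \<and> (\<forall>w\<in>W. (\<lambda>v. f (matrix_inv w *v v)) = f)}"
  proof (rule symmetric_invariants_eq)
    show "pairing v (dual_act w x) = pairing (matrix_inv w *v v) x" for w :: "complex ^ 'n ^ 'n" and x v
      by (simp only: pairing_commute[of v] pairing_dual_act pairing_commute[of x])
    show "dual_act w (x v* w) = x" if "w \<in> W" for w x
      by (simp only: dual_act_def vector_matrix_mul_assoc inv_right[OF that] vector_matrix_mul_rid)
    show "matrix_inv w ** w = mat 1" if "w \<in> W" for w by (rule inv_left[OF that])
  qed
  have xinv: "Y.invariant f \<longleftrightarrow> polyfun f \<and> (\<forall>w\<in>W. (\<lambda>v. f (matrix_inv w *v v)) = f)" for f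
    by (simp add: Y.invariant_def Y.act_def carrier_GW)
  have rel: "cherednik_ideal W c \<alpha> \<alpha>' +>\<^bsub>FA\<^esub> relabel Covec q = cl (Y.emb (ev q))" for q
    using cl_relabel[of Covec q] cl_eq_iff Y.emb_ev[of q] by (simp add: cherednik_gens_def cong_sym)
  show ?thesis
    unfolding symmetric_image_def inv
  proof (intro equalityI subsetI)
    fix A assume "A \<in> {cl (Y.emb f) |f. Y.invariant f}"
    then obtain f where f: "Y.invariant f" "A = cl (Y.emb f)" by blast
    have "ev (lift f) = f" using ev_lift Y.invariantD(1)[OF f(1)] by blast
    then show "A \<in> {cherednik_ideal W c \<alpha> \<alpha>' +>\<^bsub>FA\<^esub> relabel Covec p |p A.
        A \<in> {{q. ev q = f} |f. polyfun f \<and> (\<forall>w\<in>W. (\<lambda>v. f (matrix_inv w *v v)) = f)} \<and> p \<in> A}"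
      using f xinv by (intro CollectI exI[of _ "lift f"] exI[of _ "{q. ev q = f}"]) (auto simp: rel)
  qed (auto simp: rel xinv)
qed

lemma cherednik_base_eq: "cherednik_base W c \<alpha> \<alpha>' = cl ` Z0"
proof -
  let ?S = "{p \<otimes>\<^bsub>H\<^esub> q | p q. p \<in> {cl (X.emb f) | f. X.invariant f} \<and> q \<in> {cl (Y.emb f) | f. Y.invariant f}}"
  have base: "cherednik_base W c \<alpha> \<alpha>' = generate (add_monoid H) ?S"
    unfolding cherednik_base_def symmetric_image_Vec symmetric_image_Covec ..
  have add: "mult (add_monoid H) = add H" "one (add_monoid H) = zero H" by simp_all
  show ?thesis
    unfolding base
  proof (intro equalityI subsetI)
    fix A assume "A \<in> generate (add_monoid H) ?S"
    then show "A \<in> cl ` Z0"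
    proof (induction A rule: generate.induct)
      case one then show ?case using cl_zero Z0_0 by (metis add(2) image_eqI)
    next
      case (incl A)
      then obtain f g where "X.invariant f" "Y.invariant g" "A = cl (X.emb f * Y.emb g)"
        by (auto simp: cl_mult)
      then show ?case using Z0_basic by blast
    next
      case (inv A)
      then obtain f g where fg: "X.invariant f" "Y.invariant g" "A = cl (X.emb f * Y.emb g)"
        by (auto simp: cl_mult)
      have "inv\<^bsub>add_monoid H\<^esub> A = cl (- (X.emb f * Y.emb g))"
        by (simp only: cl_uminus fg(3) a_inv_def)
      then show ?case using Z0_uminus[OF Z0_basic[OF fg(1,2)]] by blast
    next
      case (eng A B)
      then obtain p q where "p \<in> Z0" "q \<in> Z0" "A = cl p" "B = cl q" by blast
      then show ?case using Z0_add by (auto simp: cl_add)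
    qed
  next
    fix A assume "A \<in> cl ` Z0"
    then obtain L where L: "inv_pairs L" "A = cl (zs L)"
      using cl_eq_iff by (auto simp: Z0_def)
    have "cl (zs L) \<in> generate (add_monoid H) ?S"
      using L(1)
    proof (induction L)
      case Nil
      show ?case using generate.one[of "add_monoid H" ?S] by (simp add: zs_simps cl_zero)
    next
      case (Cons t L)
      obtain f g where t: "t = (f, g)" by (cases t)
      have "cl (X.emb f) \<otimes>\<^bsub>H\<^esub> cl (Y.emb g) \<in> generate (add_monoid H) ?S"
        using Cons.prems by (intro generate.incl) (auto simp: t inv_pairs_simps)
      from generate.eng[OF this Cons.IH] show ?case
        using Cons.prems by (simp add: t inv_pairs_simps zs_simps cl_mult cl_add)
    qed
    then show "A \<in> generate (add_monoid H) ?S" by (simp add: L(2))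
  qed
qed

text \<open>The normal form of 1 has identity coefficient 1, which \<open>nf_zero_coeff\<close>
  would make zero.\<close>

lemma one_not_zero: "\<not> 1 \<doteq> 0"
proof
  assume "1 \<doteq> 0"
  moreover have "nf [(cst 1, 1, mat 1)] \<doteq> 1"
    using cong_sym[OF scalar_cong_basic[of 1]] by (simp add: nf_simps scalar_1)
  ultimately have z: "nf [(cst 1, 1, mat 1)] \<doteq> 0" using cong_trans by blast
  have "(\<Sum>t\<leftarrow>[(cst 1, 1, mat 1 :: complex ^ 'n ^ 'n)]. id_coeff t (0 :: complex ^ 'n) (0 :: complex ^ 'n)) = 0"
    by (rule nf_zero_coeff[OF _ z]) (simp_all add: valid_simps polyfun_cst polyfun_1 W_one)
  then show False by (simp add: fun_apply)
qed

lemma symmetric_frobenius_H: "symmetric_frobenius_extension H (cherednik_base W c \<alpha> \<alpha>')"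
proof -
  interpret ring H by (rule ring_H)
  obtain I :: "(nat \<times> nat \<times> (complex ^ 'n ^ 'n)) set" and e e' where I: "finite I"
    and dual: "\<forall>i\<in>I. \<forall>j\<in>I. T (e i * e' j) \<doteq> (if i = j then 1 else 0)"
    and span: "\<forall>p. \<exists>z. (\<forall>i\<in>I. z i \<in> Z0) \<and> p \<doteq> (\<Sum>i\<in>I. z i * e i)"
    using dual_bases by blast
  \<comment> \<open>\<open>T\<close> respects congruence, so the representative chosen for
    \<open>A\<close> does not matter.\<close>
  define t where "t A = cl (T (SOME p. cl p = A))" for A
  have t: "t (cl p) = cl (T p)" for p
  proof -
    have "cl (SOME q. cl q = cl p) = cl p" by (rule someI[of "\<lambda>q. cl q = cl p"]) simp
    then show ?thesis unfolding t_def cl_eq_iff by (rule T_cong)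
  qed
  have cl_T: "cl (T (p + q)) = cl (T p + T q)" "z \<in> Z0 \<Longrightarrow> cl (T (z * q)) = cl (z * T q)"
    "cl (T (p * q)) = cl (T (q * p))" for p q z
    using T_add T_Z0_mult T_symmetric cl_eq_iff by blast+
  show ?thesis
    unfolding cherednik_base_eq
  proof (rule symmetric_frobenius_extensionI[where I = I and e = "\<lambda>i. cl (e i)" and e' = "\<lambda>i. cl (e' i)" and t = t])
    show "subring (cl ` Z0) H"
    proof (rule subringI)
      show "cl ` Z0 \<subseteq> carrier H" using cl_carrier by blast
      show "\<one>\<^bsub>H\<^esub> \<in> cl ` Z0" using cl_one one_Z0 by blast
      show "\<ominus>\<^bsub>H\<^esub> A \<in> cl ` Z0" if "A \<in> cl ` Z0" for A
        using that Z0_uminus by (auto simp flip: cl_uminus)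
      show "A \<otimes>\<^bsub>H\<^esub> B \<in> cl ` Z0" "A \<oplus>\<^bsub>H\<^esub> B \<in> cl ` Z0" if "A \<in> cl ` Z0" "B \<in> cl ` Z0" for A B
        using that Z0_mult Z0_add by (auto simp: cl_mult cl_add)
    qed
    show "cl ` Z0 \<subseteq> ring_center H"
    proof
      fix A assume "A \<in> cl ` Z0"
      then obtain z where z: "z \<in> Z0" "A = cl z" by blast
      have "cl z \<otimes>\<^bsub>H\<^esub> B = B \<otimes>\<^bsub>H\<^esub> cl z" if B: "B \<in> carrier H" for B
      proof -
        obtain p where p: "cl p = B" using cl_surj[OF B] by blast
        have "cl (z * p) = cl (p * z)" using Z0_central[OF z(1)] by (simp only: cl_eq_iff)
        then show ?thesis using p by (auto simp: cl_mult)
      qed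
      then show "A \<in> ring_center H" by (simp add: z ring_center_def cl_carrier)
    qed
    show "\<one>\<^bsub>H\<^esub> \<noteq> \<zero>\<^bsub>H\<^esub>" using one_not_zero cl_eq_iff[of 1 0] by (simp add: cl_one cl_zero)
    show "t \<in> carrier H \<rightarrow> cl ` Z0" by (auto simp: t_def intro: T_Z0)
    show "t (A \<oplus>\<^bsub>H\<^esub> B) = t A \<oplus>\<^bsub>H\<^esub> t B" if "A \<in> carrier H" "B \<in> carrier H" for A B
      using cl_surj[OF that(1)] cl_surj[OF that(2)] cl_T(1) by (auto simp: cl_add t)
    show "t (A \<otimes>\<^bsub>H\<^esub> B) = A \<otimes>\<^bsub>H\<^esub> t B" if "A \<in> cl ` Z0" "B \<in> carrier H" for A B
      using that(1) cl_surj[OF that(2)] cl_T(2) by (auto simp: cl_mult t)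
    show "t (A \<otimes>\<^bsub>H\<^esub> B) = t (B \<otimes>\<^bsub>H\<^esub> A)" if "A \<in> carrier H" "B \<in> carrier H" for A B
      using cl_surj[OF that(1)] cl_surj[OF that(2)] cl_T(3) by (auto simp: cl_mult t)
    show "t (cl (e i) \<otimes>\<^bsub>H\<^esub> cl (e' j)) = (if i = j then \<one>\<^bsub>H\<^esub> else \<zero>\<^bsub>H\<^esub>)" if "i \<in> I" "j \<in> I" for i j
    proof -
      have "cl (T (e i * e' j)) = cl (if i = j then 1 else 0)" using dual that cl_eq_iff by blast
      then show ?thesis by (simp add: cl_mult t cl_one cl_zero)
    qed
    show "\<exists>z. z \<in> I \<rightarrow> cl ` Z0 \<and> A = (\<Oplus>\<^bsub>H\<^esub>i\<in>I. z i \<otimes>\<^bsub>H\<^esub> cl (e i))" if A: "A \<in> carrier H" for A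
    proof -
      obtain p where p: "cl p = A" using cl_surj[OF A] by blast
      obtain z where z: "\<forall>i\<in>I. z i \<in> Z0" "p \<doteq> (\<Sum>i\<in>I. z i * e i)" using span by blast
      have "A = cl (\<Sum>i\<in>I. z i * e i)" using z(2) p cl_eq_iff by blast
      also have "\<dots> = (\<Oplus>\<^bsub>H\<^esub>i\<in>I. cl (z i) \<otimes>\<^bsub>H\<^esub> cl (e i))" by (simp add: cl_sum[OF I] cl_mult)
      finally show ?thesis using z(1) by (intro exI[of _ "\<lambda>i. cl (z i)"]) auto
    qed
  qed (use I ring_H cl_carrier in auto)
qed

end

theorem theorem3p5:
  fixes W :: "(complex ^ 'n ^ 'n) set"
    and c :: "complex ^ 'n ^ 'n \<Rightarrow> complex"
    and \<alpha> \<alpha>' :: "complex ^ 'n ^ 'n \<Rightarrow> complex ^ 'n"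
  assumes "irreducible_complex_reflection_group W"
    and "\<forall>w \<in> W. \<forall>s \<in> reflections W. c (w ** s ** matrix_inv w) = c s"
    and "roots_and_coroots W \<alpha> \<alpha>'"
  shows "symmetric_frobenius_extension (cherednik_algebra W c \<alpha> \<alpha>') (cherednik_base W c \<alpha> \<alpha>')"
proof -
  interpret cherednik W c \<alpha> \<alpha>' by standard (rule assms)+
  show ?thesis by (rule symmetric_frobenius_H)
qed

end
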